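(* Let $d\ge 1$ and let $N$ be a positive integer. Let $R\subset\mathbb{R}^{d}$ be a measurable set which contains $\mathbf{0}$ as an interior point, and suppose $f\in C^{N+2}(R)$ and $g\in C^{N}(R)$ are real-valued. Suppose moreover that $f$ has a unique, nondegenerate minimum value of $0$ at $\mathbf{0}$. Assume that for some $k_{0}>0$ the integral $\int_{R}e^{-k_{0}f}g\,d^{d}\mathbf{x}$ converges. Then there exist a linear transformation $P:\mathbb{R}^{d}\rightarrow\mathbb{R}^{d}$ such that, in the coordinates $\mathbf{y}=P\mathbf{x}$, the Hessian $H_{y}f(\mathbf{0})$ of $f$ at $\mathbf{0}$ with respect to $\mathbf{y}$ is the $d\times d$ identity matrix, and an asymptotic expansion $$\int_{R}e^{-kf}g\,d^{d}\mathbf{x}=k^{-d/2}\sum_{j=0}^{\lfloor N/2\rfloor}\zeta_{2j}k^{-j}+O\left(k^{-(N+d)/2+1}\right),\qquad k\rightarrow\infty,$$ where the coefficients are given by $$\zeta_{2j}=\frac{(2\pi)^{d/2}}{\sqrt{\det H_{x}f(\mathbf{0})}}\sum_{m=0}^{2j}\sum_{r=1}^{m}\frac{(-1)^{r}}{r!}\sum_{|\beta|=2j-m}\ \sum_{\substack{n_{1}+\cdots+n_{r}=m\\ n_{i}\geq1,\ i=1,\dots,r}}\ \sum_{|\alpha_{1}|=n_{1}+2}\cdots\sum_{|\alpha_{r}|=n_{r}+2}\operatorname{even}(\beta+\alpha_{1}+\cdots+\alpha_{r})\,\frac{(\beta+\alpha_{1}+\cdots+\alpha_{r}-\mathbf{1})!!}{\beta!\,\alpha_{1}!\cdots\alpha_{r}!}\,D_{y}^{\beta}g(\mathbf{0})\,D_{y}^{\alpha_{1}}f(\mathbf{0})\cdots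 D_{y}^{\alpha_{r}}f(\mathbf{0}).$$ Empty sums, $0!$ and $(-1)!!$ are all understood to be $1$; for $m=0$, where the sum over $r$ is empty, this means a single term containing no $n_i$ and no $\alpha_i$, i.e. the $m=0$ contribution to the sum over $m$ is $\sum_{|\beta|=2j}\operatorname{even}(\beta)\frac{(\beta-\mathbf{1})!!}{\beta!}D_{y}^{\beta}g(\mathbf{0})$.
   Context: $k$ is a real parameter. Integrals are Lebesgue integrals, and "converges" means the integrand is Lebesgue integrable. For non-open $R$, $C^{m}(R)$ means functions on $R$ that are restrictions of $C^m$ functions on an open set containing $R$. $H_{x}f(\mathbf{0})$ is the Hessian matrix of $f$ at $\mathbf{0}$ with respect to the original coordinates $\mathbf{x}$; a critical point is nondegenerate if the Hessian there is invertible. $\beta,\alpha_1,\dots,\alpha_r$ range over multi-indices in $\mathbb{Z}_{\ge0}^{d}$; for $\alpha=(\alpha^{1},\dots,\alpha^{d})$, $|\alpha|=\sum_p\alpha^{p}$, $\alpha!=\prod_p \alpha^{p}!$, $\mathbf{1}=(1,\dots,1)$, and $\alpha!!=\prod_p\alpha^{p}!!$, where $n!!=n(n-2)(n-4)\cdots$ is the double factorial (ending at $2$ for even $n$, at $3$ or equivalently $1$ for odd $n$), with $1!!=(-1)!!=1$ and $0!=1$. $D_{y}^{\alpha}$ denotes the mixed partial derivative of order $\alpha$ with respect to the coordinates $\mathbf{y}=P\mathbf{x}$ (i.e. applied to $f\circ P^{-1}$, $g\circ P^{-1}$). $\operatorname{even}(\alpha)=1$ if all components of $\alpha$ are even, and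 $0$ otherwise. $\lfloor N/2\rfloor$ is the largest integer less than or equal to $N/2$. $h(k)=O(k^{p})$ as $k\to\infty$ means $|h(k)|\le Ck^{p}$ for some constant $C>0$ and all sufficiently large $k$.
   Formalization: "Unique minimum" also requires f to be bounded away from 0 on R outside every ball around 0 (automatic for compact R); without this the claim fails, e.g. R=(-1,1), f=x²(1-x)², g=1, N=3. *)

theory Defs
  imports "HOL-Analysis.Analysis" "HOL-Library.Landau_Symbols" "HOL-Library.Multiset"
begin

section \<open>Partial derivatives and functions of class \<open>C\<^sup>m\<close>\<close>

definition partial :: "'d::finite \<Rightarrow> (real^'d \<Rightarrow> real) \<Rightarrow> real^'d \<Rightarrow> real" where
  "partial i f x = deriv (\<lambda>t. f (x + t *\<^sub>R axis i 1)) 0"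

primrec C_on :: "nat \<Rightarrow> (real^'d::finite) set \<Rightarrow> (real^'d \<Rightarrow> real) \<Rightarrow> bool" where
  "C_on 0 U f \<longleftrightarrow> continuous_on U f"
| "C_on (Suc m) U f \<longleftrightarrow> continuous_on U f \<and>
     (\<forall>i. (\<forall>x\<in>U. (\<lambda>t. f (x + t *\<^sub>R axis i 1)) differentiable (at 0)) \<and> C_on m U (partial i f))"

text \<open>For a set \<open>R\<close> that need not be open: restrictions of \<open>C\<^sup>m\<close> functions on an open
  set containing \<open>R\<close>. Only the values of \<open>f\<close> on \<open>R\<close> matter.\<close>

definition C_restr :: "nat \<Rightarrow> (real^'d::finite) set \<Rightarrow> (real^'d \<Rightarrow> real) \<Rightarrow> bool" where
  "C_restr m R f \<longleftrightarrow> (\<exists>U F. open U \<and> R \<subseteq> U \<and> C_on m U F \<and> (\<forall>x\<in>R. F x = f x))"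

definition hessian :: "(real^'d::finite \<Rightarrow> real) \<Rightarrow> real^'d \<Rightarrow> real^'d^'d" where
  "hessian f x = (\<chi> i j. partial i (partial j f) x)"


section \<open>Unique minima\<close>

text \<open>A unique minimum at \<open>a\<close> is understood as in Laplace's method: away from \<open>a\<close> the
  function is strictly larger than \<open>f a\<close>, and its values on \<open>R\<close> do not come arbitrarily close
  to \<open>f a\<close> outside a neighbourhood of \<open>a\<close>. For a continuous function on a compact set
  the second condition follows from the first (see below). In general it does not, and it cannot
  be dispensed with: \<open>f x = x\<^sup>2 (1 - x)\<^sup>2\<close> on the open interval from \<open>-1\<close> to
  \<open>1\<close> is strictly minimal at \<open>0\<close>, but the end point \<open>1\<close> contributes to the
  leading term of the Laplace integral.\<close>

definition unique_minimum_at ::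
    "('a::metric_space \<Rightarrow> real) \<Rightarrow> 'a set \<Rightarrow> 'a \<Rightarrow> bool" where
  "unique_minimum_at f R a \<longleftrightarrow> a \<in> R \<and> (\<forall>x\<in>R. x \<noteq> a \<longrightarrow> f a < f x) \<and>
     (\<forall>e>0. \<exists>c>f a. \<forall>x\<in>R. e \<le> dist x a \<longrightarrow> c \<le> f x)"

lemma unique_minimum_at_compact:
  assumes "compact R" "continuous_on R f"
  shows "unique_minimum_at f R a \<longleftrightarrow> a \<in> R \<and> (\<forall>x\<in>R. x \<noteq> a \<longrightarrow> f a < f x)"
proof -
  have "\<exists>c>f a. \<forall>x\<in>R. e \<le> dist x a \<longrightarrow> c \<le> f x"
    if less: "\<forall>x\<in>R. x \<noteq> a \<longrightarrow> f a < f x" and "e > 0" for e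
  proof -
    define S where "S = R \<inter> {x. e \<le> dist x a}"
    have "compact S"
      unfolding S_def using assms(1)
      by (intro compact_Int_closed closed_Collect_le continuous_intros)
    show ?thesis
    proof (cases "S = {}")
      case True
      then have "\<forall>x\<in>R. e \<le> dist x a \<longrightarrow> f a + 1 \<le> f x" by (auto simp: S_def)
      then show ?thesis by (intro exI[of _ "f a + 1"]) auto
    next
      case False
      moreover have "continuous_on S f"
        using assms(2) by (rule continuous_on_subset) (auto simp: S_def)
      ultimately obtain z where z: "z \<in> S" "\<forall>x\<in>S. f z \<le> f x"
        using \<open>compact S\<close> continuous_attains_inf by blast
      have "f a < f z" using z(1) less \<open>e > 0\<close> by (auto simp: S_def)
      then show ?thesis using z(2) by (intro exI[of _ "f z"]) (auto simp: S_def)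
    qed
  qed
  then show ?thesis by (auto simp: unique_minimum_at_def)
qed


section \<open>Multi-indices\<close>

definition multi_indices :: "nat \<Rightarrow> (nat^'d::finite) set" where
  "multi_indices n = {\<alpha>. (\<Sum>p\<in>UNIV. \<alpha> $ p) = n}"

lemma finite_multi_indices: "finite (multi_indices n :: (nat^'d::finite) set)"
proof (rule finite_subset)
  show "multi_indices n \<subseteq> vec_lambda ` (UNIV \<rightarrow>\<^sub>E {..n} :: ('d \<Rightarrow> nat) set)"
  proof
    fix \<alpha> :: "nat^'d"
    assume "\<alpha> \<in> multi_indices n"
    then have "(\<Sum>p\<in>UNIV. \<alpha> $ p) = n" by (simp add: multi_indices_def)
    moreover have "\<alpha> $ p \<le> (\<Sum>p\<in>UNIV. \<alpha> $ p)" for p by (rule member_le_sum) auto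
    ultimately have "($) \<alpha> \<in> UNIV \<rightarrow>\<^sub>E {..n}" by auto
    moreover have "\<alpha> = vec_lambda (($) \<alpha>)" by simp
    ultimately show "\<alpha> \<in> vec_lambda ` (UNIV \<rightarrow>\<^sub>E {..n})" by blast
  qed
qed (intro finite_imageI finite_PiE, auto)

definition multi_fact :: "nat^'d::finite \<Rightarrow> real" where
  "multi_fact \<alpha> = (\<Prod>p\<in>UNIV. fact (\<alpha> $ p))"

text \<open>Double factorials are taken on \<open>int\<close> so that \<open>(-1)!!\<close> makes sense; it is the
  empty product.\<close>

definition double_fact :: "int \<Rightarrow> int" where
  "double_fact n = \<Prod>{i. 1 \<le> i \<and> i \<le> n \<and> even (n - i)}"

definition multi_double_fact :: "int^'d::finite \<Rightarrow> real" where
  "multi_double_fact \<gamma> = (\<Prod>p\<in>UNIV. of_int (double_fact (\<gamma> $ p)))"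

definition even_indicator :: "nat^'d::finite \<Rightarrow> real" where
  "even_indicator \<alpha> = (if \<forall>p. even (\<alpha> $ p) then 1 else 0)"

text \<open>The partial derivatives are applied in some order, one coordinate \<open>p\<close> at a time,
  \<open>\<alpha> $ p\<close> times in total. By Schwarz's theorem the order is irrelevant at interior points
  for functions of class \<open>C\<^sup>m\<close> with \<open>m = |\<alpha>|\<close>.\<close>

definition mixed_partial :: "nat^'d::finite \<Rightarrow> (real^'d \<Rightarrow> real) \<Rightarrow> real^'d \<Rightarrow> real" where
  "mixed_partial \<alpha> f = foldr partial (SOME ps. \<forall>p. count_list ps p = \<alpha> $ p) f"

lemma mixed_partial_order_exists: "\<exists>ps. \<forall>p. count_list ps p = \<alpha> $ p"
proof -
  obtain ps where "mset ps = Abs_multiset (\<lambda>p. \<alpha> $ p)" by (metis ex_mset)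
  then have "\<forall>p. count (mset ps) p = \<alpha> $ p" by (simp add: Abs_multiset_inverse)
  then show ?thesis by (auto simp: count_mset intro: exI[of _ ps])
qed


section \<open>The coefficients\<close>

text \<open>Tuples indexed by \<open>1,\<dots>,r\<close> are extensional functions on \<open>{1..r}\<close>.\<close>

definition compositions :: "nat \<Rightarrow> nat \<Rightarrow> (nat \<Rightarrow> nat) set" where
  "compositions m r = {n \<in> {1..r} \<rightarrow>\<^sub>E {1..}. (\<Sum>i=1..r. n i) = m}"

lemma finite_compositions: "finite (compositions m r)"
proof (rule finite_subset)
  show "compositions m r \<subseteq> {1..r} \<rightarrow>\<^sub>E {..m}"
  proof
    fix n assume n: "n \<in> compositions m r"
    have "n i \<le> (\<Sum>i=1..r. n i)" if "i \<in> {1..r}" for i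
      by (rule member_le_sum) (use that in auto)
    with n show "n \<in> {1..r} \<rightarrow>\<^sub>E {..m}"
      unfolding compositions_def PiE_iff by (auto simp del: One_nat_def)
  qed
qed (simp add: finite_PiE)

definition multi_index_tuples :: "(nat \<Rightarrow> nat) \<Rightarrow> nat \<Rightarrow> (nat \<Rightarrow> nat^'d::finite) set" where
  "multi_index_tuples n r = (\<Pi>\<^sub>E i\<in>{1..r}. multi_indices (n i + 2))"

lemma finite_multi_index_tuples:
  "finite (multi_index_tuples n r :: (nat \<Rightarrow> nat^'d::finite) set)"
  unfolding multi_index_tuples_def by (intro finite_PiE finite_multi_indices) simp

text \<open>The weight \<open>even(\<gamma>) (\<gamma> - \<one>)!!\<close>, which is the Gaussian moment of order \<open>\<gamma>\<close>.\<close>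

definition gauss_weight :: "nat^'d::finite \<Rightarrow> real" where
  "gauss_weight \<gamma> = even_indicator \<gamma> * multi_double_fact ((\<chi> p. int (\<gamma> $ p)) - 1)"

text \<open>The coefficient \<open>\<zeta>\<^bsub>2j\<^esub>\<close> in the coordinates \<open>y = P x\<close>. The term for \<open>m = 0\<close>
  is the one in which the sums over \<open>r\<close>, the \<open>n\<^sub>i\<close> and the \<open>\<alpha>\<^sub>i\<close> are absent.\<close>

definition laplace_coeff ::
    "(real^'d::finite \<Rightarrow> real) \<Rightarrow> (real^'d \<Rightarrow> real) \<Rightarrow> (real^'d \<Rightarrow> real^'d) \<Rightarrow> nat \<Rightarrow> real" where
  "laplace_coeff f g P j =
     (let fy = f \<circ> inv P; gy = g \<circ> inv P in
      (2 * pi) powr (real CARD('d) / 2) / sqrt (det (hessian f 0)) *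
      (\<Sum>m=0..2*j.
        if m = 0 then
          \<Sum>\<beta>\<in>multi_indices (2*j). gauss_weight \<beta> / multi_fact \<beta> * mixed_partial \<beta> gy 0
        else
          \<Sum>r=1..m. (-1)^r / fact r *
            (\<Sum>\<beta>\<in>multi_indices (2*j - m). \<Sum>n\<in>compositions m r. \<Sum>\<alpha>\<in>multi_index_tuples n r.
               gauss_weight (\<beta> + (\<Sum>i=1..r. \<alpha> i)) / (multi_fact \<beta> * (\<Prod>i=1..r. multi_fact (\<alpha> i))) *
               mixed_partial \<beta> gy 0 * (\<Prod>i=1..r. mixed_partial (\<alpha> i) fy 0))))"

end

theory Submission
  imports Defs "HOL-Probability.Distributions" "HOL-Combinatorics.Multiset_Permutations"
begin

text \<open>The integral localises at the minimum. Outside a neighbourhood \<open>W\<close> of \<open>0\<close> the exponent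
\<open>f\<close> is at least some \<open>c > 0\<close>, so that part of the integral is at most
\<open>exp (- (k - k0) c)\<close> times the integral of \<open>|exp (- k0 f) g|\<close>, which is smaller than every power of
\<open>k\<close> (\<open>laplace_tail\<close>, \<open>exp_decay_bigo\<close>).

Near \<open>0\<close> there are two substitutions. At a nondegenerate minimum the Hessian \<open>H\<close> is symmetric
and positive definite, hence congruent to the identity: the inner product \<open>u \<bullet> H v\<close> has an
orthonormal basis, whose vectors are the columns of a matrix \<open>A\<close> with \<open>|det A| = 1 / sqrt (det H)\<close>
(\<open>normal_coordinates\<close>). In the coordinates \<open>y\<close> with \<open>x = A y\<close> the exponent is
\<open>|y|\<^sup>2 / 2 + O(|y|\<^sup>3)\<close>. Next put \<open>y = \<epsilon> z\<close> with \<open>\<epsilon> = 1 / sqrt k\<close>, so that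
\<open>k f = |z|\<^sup>2 / 2 + S\<close>, where by Taylor's formula \<open>S\<close> is a polynomial in \<open>\<epsilon>\<close> without
constant term, up to \<open>\<epsilon>\<^sup>N\<close> times a quantity of polynomial growth in \<open>z\<close>. The
coefficient of \<open>\<epsilon>\<^sup>n\<close> in \<open>S\<close> is the homogeneous Taylor polynomial of \<open>f\<close> of degree
\<open>n + 2\<close>. Likewise \<open>g\<close> is, up to such a remainder, a polynomial in
\<open>\<epsilon>\<close> whose coefficient at \<open>\<epsilon>\<^sup>n\<close> is its homogeneous Taylor polynomial of degree \<open>n\<close>.

It remains to expand \<open>exp (- S) g\<close> in powers of \<open>\<epsilon>\<close> and to integrate against the Gaussian
\<open>exp (- |z|\<^sup>2 / 2)\<close>. The exponential series contributes \<open>(-1)\<^sup>r / r!\<close> and an \<open>r\<close>-fold product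
of the coefficients of \<open>S\<close>, whose indices \<open>n\<^sub>1, ..., n\<^sub>r\<close> form a composition of \<open>m\<close>. Multiplied out
over multi-indices, each term is a monomial \<open>z\<^bsup>\<gamma>\<^esup>\<close>, and its Gaussian moment
\<open>(2 \<pi>)\<^bsup>d/2\<^esup> even(\<gamma>) (\<gamma> - 1)!!\<close> is the weight in the coefficient \<open>\<zeta>\<close>. Odd powers of
\<open>\<epsilon>\<close> carry monomials of odd degree and integrate to \<open>0\<close>. On the shrunken domain
\<open>|\<epsilon> z| \<le> \<delta>\<close> one has \<open>|S| \<le> |z|\<^sup>2 / 4\<close>, so all remainders are dominated by a polynomial times
\<open>exp (- |z|\<^sup>2 / 4)\<close>, and extending the Gaussian integrals to the whole space costs only a further
\<open>O(\<epsilon>\<^sup>N)\<close> (\<open>gaussian_integral_expansion\<close>). Hence the terms with \<open>2 j < N\<close> describe the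
integral up to \<open>O(k\<^bsup>-(N+d)/2\<^esup>)\<close>; for even \<open>N\<close> the term \<open>j = N / 2\<close> is of that same order.\<close>

section \<open>Functions of class \<open>C\<^sup>m\<close> and directional derivatives\<close>

lemma partial_cong:
  assumes "open U" "x \<in> U" "\<And>x. x \<in> U \<Longrightarrow> f x = g x"
  shows "partial i f x = partial i g x"
proof -
  have "isCont (\<lambda>t. x + t *\<^sub>R axis i (1::real)) 0" by (intro continuous_intros)
  then have "\<forall>\<^sub>F t in nhds (0::real). x + t *\<^sub>R axis i 1 \<in> U"
    using assms(1,2) unfolding continuous_at_open eventually_nhds
    by (metis add.right_neutral scaleR_zero_left)
  then show ?thesis unfolding partial_def
    by (intro deriv_cong_ev) (auto elim!: eventually_mono simp: assms(3))
qed

lemma differentiable_partial_cong: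
  fixes f g :: "real^'d::finite \<Rightarrow> real"
  assumes "open U" "x \<in> U" "\<And>x. x \<in> U \<Longrightarrow> f x = g x"
  assumes "(\<lambda>t. f (x + t *\<^sub>R axis i 1)) differentiable (at (0::real))"
  shows "(\<lambda>t. g (x + t *\<^sub>R axis i (1::real))) differentiable (at 0)"
proof -
  have "isCont (\<lambda>t. x + t *\<^sub>R axis i (1::real)) 0" by (intro continuous_intros)
  then have "\<forall>\<^sub>F t in nhds (0::real). x + t *\<^sub>R axis i 1 \<in> U"
    using assms(1,2) unfolding continuous_at_open eventually_nhds
    by (metis add.right_neutral scaleR_zero_left)
  then have "\<forall>\<^sub>F t in nhds (0::real). f (x + t *\<^sub>R axis i 1) = g (x + t *\<^sub>R axis i 1)"
    by eventually_elim (rule assms(3))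
  then have "((\<lambda>t. f (x + t *\<^sub>R axis i 1)) has_real_derivative D) (at 0) \<longleftrightarrow>
      ((\<lambda>t. g (x + t *\<^sub>R axis i 1)) has_real_derivative D) (at 0)" for D
    by (rule DERIV_cong_ev[OF refl _ refl])
  then show ?thesis
    using assms(4) unfolding real_differentiable_def by blast
qed

text \<open>Partial derivatives are local, so on an open set the class \<open>C\<^sup>m\<close> depends only on the values there.
This is what allows a function on \<open>R\<close> to be treated as \<open>C\<^sup>m\<close> in the interior of \<open>R\<close> without
reference to the extension that \<open>C_restr\<close> provides.\<close>

lemma C_on_cong_imp:
  assumes "open U" "\<And>x. x \<in> U \<Longrightarrow> f x = g x" "C_on m U f"
  shows "C_on m U g"
  using assms(2,3)
proof (induction m arbitrary: f g)
  case 0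
  then show ?case by (simp cong: continuous_on_cong)
next
  case (Suc m)
  have "C_on m U (partial i g)" for i
    by (rule Suc.IH[of "partial i f"])
      (use Suc.prems partial_cong[OF assms(1) _ Suc.prems(1)] in auto)
  moreover have "(\<lambda>t. g (x + t *\<^sub>R axis i (1::real))) differentiable (at 0)" if "x \<in> U" for x i
    by (rule differentiable_partial_cong[OF assms(1) that Suc.prems(1)]) (use Suc.prems(2) that in auto)
  moreover have "continuous_on U g"
    using Suc.prems by (simp cong: continuous_on_cong)
  ultimately show ?case by simp
qed

lemma C_on_subset:
  assumes "C_on m U f" "V \<subseteq> U"
  shows "C_on m V f"
  using assms by (induction m arbitrary: f) (auto intro: continuous_on_subset)

lemma C_on_imp_continuous: "C_on m U f \<Longrightarrow> continuous_on U f"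
  by (cases m) auto

lemma C_on_Suc_D: "C_on (Suc m) U f \<Longrightarrow> C_on m U f"
  by (induction m arbitrary: f) auto

lemma C_on_mono: "C_on m U f \<Longrightarrow> n \<le> m \<Longrightarrow> C_on n U f"
proof (induction m)
  case (Suc m)
  then show ?case by (cases "n = Suc m") (auto intro: C_on_Suc_D simp del: C_on.simps)
qed simp

lemma C_on_partial: "C_on (Suc m) U f \<Longrightarrow> C_on m U (partial i f)"
  by simp

lemma C_on_foldr_partial: "C_on (length ps + m) U f \<Longrightarrow> C_on m U (foldr partial ps f)"
proof (induction ps arbitrary: m)
  case (Cons p ps)
  then have "C_on (Suc m) U (foldr partial ps f)" by (simp del: C_on.simps)
  then show ?case using C_on_partial by (simp del: C_on.simps)
qed simp

lemma has_partial:
  assumes "C_on (Suc m) U f" "x + t *\<^sub>R axis i 1 \<in> U"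
  shows "((\<lambda>t. f (x + t *\<^sub>R axis i 1)) has_real_derivative partial i f (x + t *\<^sub>R axis i 1)) (at t)"
proof -
  have "(\<lambda>s. f ((x + t *\<^sub>R axis i 1) + s *\<^sub>R axis i 1)) differentiable (at 0)"
    using assms by simp
  then have "((\<lambda>s. f ((x + t *\<^sub>R axis i 1) + s *\<^sub>R axis i 1)) has_real_derivative
      partial i f (x + t *\<^sub>R axis i 1)) (at 0)"
    unfolding partial_def DERIV_deriv_iff_real_differentiable .
  then have "((\<lambda>s. f (x + (s + t) *\<^sub>R axis i 1)) has_real_derivative
      partial i f (x + t *\<^sub>R axis i 1)) (at 0)"
    by (simp add: algebra_simps)
  then show ?thesis
    using DERIV_shift[of "\<lambda>t. f (x + t *\<^sub>R axis i 1)" _ 0 t] by simp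
qed

lemma has_partial_0:
  assumes "C_on (Suc m) U f" "x \<in> U"
  shows "((\<lambda>t. f (x + t *\<^sub>R axis i 1)) has_real_derivative partial i f x) (at 0)"
  using has_partial[of m U f x 0 i] assms by simp

lemma partial_eqI:
  "((\<lambda>t. f (x + t *\<^sub>R axis i 1)) has_real_derivative D) (at 0) \<Longrightarrow> partial i f x = D"
  unfolding partial_def by (rule DERIV_imp_deriv)

lemma C_on_zero: "C_on m U (\<lambda>x. 0)"
proof (induction m)
  case (Suc m)
  have "partial i (\<lambda>x. 0) = (\<lambda>x. 0)" for i :: 'a
    by (rule ext, rule partial_eqI) simp
  with Suc show ?case by simp
qed simp

lemma partial_add:
  assumes "C_on (Suc m) U f" "C_on (Suc m) U g" "x \<in> U"
  shows "partial i (\<lambda>x. f x + g x) x = partial i f x + partial i g x"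
  by (rule partial_eqI, rule DERIV_add; rule has_partial_0[OF _ assms(3)], fact)

lemma partial_cmult:
  assumes "C_on (Suc m) U f" "x \<in> U"
  shows "partial i (\<lambda>x. c * f x) x = c * partial i f x"
  by (rule partial_eqI, rule DERIV_cmult, rule has_partial_0[OF assms])

lemma C_on_add:
  assumes "open U" "C_on m U f" "C_on m U g"
  shows "C_on m U (\<lambda>x. f x + g x)"
  using assms(2,3)
proof (induction m arbitrary: f g)
  case 0
  then show ?case by (simp add: continuous_on_add continuous_on_mult_left)
next
  case (Suc m)
  have "C_on m U (partial i (\<lambda>x. f x + g x))" for i
  proof (rule C_on_cong_imp[OF assms(1)])
    show "C_on m U (\<lambda>x. partial i f x + partial i g x)"
      by (rule Suc.IH) (use Suc.prems in simp_all)
    show "partial i f x + partial i g x = partial i (\<lambda>x. f x + g x) x" if "x \<in> U" for x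
      using partial_add[OF Suc.prems that] by (rule sym)
  qed
  moreover have "continuous_on U (\<lambda>x. f x + g x)"
    using Suc.prems by (intro continuous_on_add) auto
  moreover have "(\<lambda>t. f (x + t *\<^sub>R axis i 1) + g (x + t *\<^sub>R axis i 1)) differentiable (at 0)"
    if "x \<in> U" for x i
    by (rule differentiable_add) (use Suc.prems that in simp_all)
  ultimately show ?case unfolding C_on.simps by blast
qed

lemma C_on_cmult:
  assumes "open U" "C_on m U f"
  shows "C_on m U (\<lambda>x. c * f x)"
  using assms(2)
proof (induction m arbitrary: f)
  case 0
  then show ?case by (simp add: continuous_on_add continuous_on_mult_left)
next
  case (Suc m)
  have "C_on m U (partial i (\<lambda>x. c * f x))" for i
  proof (rule C_on_cong_imp[OF assms(1)])
    show "C_on m U (\<lambda>x. c * partial i f x)"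
      by (rule Suc.IH) (use Suc.prems in simp)
    show "c * partial i f x = partial i (\<lambda>x. c * f x) x" if "x \<in> U" for x
      using partial_cmult[OF Suc.prems that] by (rule sym)
  qed
  moreover have "continuous_on U (\<lambda>x. c * f x)"
    using Suc.prems by (intro continuous_on_mult_left) simp
  moreover have "(\<lambda>t. c * f (x + t *\<^sub>R axis i 1)) differentiable (at 0)" if "x \<in> U" for x i
    by (rule differentiable_mult[OF differentiable_const]) (use Suc.prems that in simp)
  ultimately show ?case unfolding C_on.simps by blast
qed

lemma C_on_sum:
  assumes "open U" "\<And>k. k \<in> K \<Longrightarrow> C_on m U (f k)"
  shows "C_on m U (\<lambda>x. \<Sum>k\<in>K. f k x)"
  using assms(2)
proof (induction K rule: infinite_finite_induct)
  case (insert k K)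
  have "C_on m U (\<lambda>x. f k x + (\<Sum>k\<in>K. f k x))"
    by (rule C_on_add[OF assms(1)]) (use insert in blast)+
  then show ?case using insert(1,2) by (simp del: C_on.simps)
qed (simp_all add: C_on_zero del: C_on.simps)

lemma partial_sum:
  assumes "open U" "\<And>k. k \<in> K \<Longrightarrow> C_on (Suc m) U (f k)" "x \<in> U" 
  shows "partial i (\<lambda>x. \<Sum>k\<in>K. c k * f k x) x = (\<Sum>k\<in>K. c k * partial i (f k) x)"
proof (rule partial_eqI, rule DERIV_sum)
  show "((\<lambda>t. c k * f k (x + t *\<^sub>R axis i 1)) has_real_derivative c k * partial i (f k) x) (at 0)"
    if "k \<in> K" for k
    by (rule DERIV_cmult, rule has_partial_0[OF assms(2,3)], rule that)
qed

text \<open>The derivative of \<open>f\<close> in the direction \<open>v\<close>. Its iterates \<open>(dird v ^^ n) f\<close> are the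
derivatives of \<open>t \<mapsto> f (t v)\<close>, so they are the natural form of the Taylor coefficients; the multi-index
form is derived from them.\<close>

definition dird :: "real^'d::finite \<Rightarrow> (real^'d \<Rightarrow> real) \<Rightarrow> real^'d \<Rightarrow> real" where
  "dird v f x = (\<Sum>i\<in>UNIV. v $ i * partial i f x)"

lemma C_on_dird:
  assumes "open U" "C_on (Suc m) U f"
  shows "C_on m U (dird v f)"
  unfolding dird_def[abs_def]
  by (intro C_on_sum C_on_cmult assms C_on_partial)

lemma C_on_dird_pow:
  assumes "open U" "C_on (n + m) U f"
  shows "C_on m U ((dird v ^^ n) f)"
  using assms(2)
proof (induction n arbitrary: m)
  case (Suc n)
  have "C_on (Suc m) U ((dird v ^^ n) f)" by (rule Suc.IH) (use Suc.prems in simp)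
  then show ?case using C_on_dird[OF assms(1)] by simp
qed simp

text \<open>Stated for an increment \<open>h\<close> of either sign, possibly \<open>0\<close>, since it is applied to the components of
an arbitrary vector.\<close>

lemma real_MVT_any:
  fixes \<phi> :: "real \<Rightarrow> real"
  assumes "\<And>t. \<bar>t\<bar> \<le> \<bar>h\<bar> \<Longrightarrow> (\<phi> has_real_derivative \<phi>' t) (at t)"
  shows "\<exists>t. \<bar>t\<bar> \<le> \<bar>h\<bar> \<and> \<phi> h - \<phi> 0 = h * \<phi>' t"
proof (cases "h = 0")
  case False
  then consider "0 < h" | "h < 0" by linarith
  then show ?thesis
  proof cases
    case 1
    have "\<exists>t>0. t < h \<and> \<phi> h - \<phi> 0 = (h - 0) * \<phi>' t"
      by (rule MVT2) (use 1 assms in auto)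
    then obtain t where "t > 0" "t < h" "\<phi> h - \<phi> 0 = h * \<phi>' t" by auto
    then show ?thesis using 1 by (intro exI[of _ t]) auto
  next
    case 2
    have "\<exists>t>h. t < 0 \<and> \<phi> 0 - \<phi> h = (0 - h) * \<phi>' t"
      by (rule MVT2) (use 2 assms in auto)
    then obtain t where "h < t" "t < 0" "\<phi> 0 - \<phi> h = (0 - h) * \<phi>' t" by blast
    then show ?thesis using 2 by (intro exI[of _ t]) (auto simp: algebra_simps)
  qed
qed (auto intro: exI[of _ 0])

text \<open>The increment is decomposed into steps parallel to the axes, and the mean value theorem is applied to each step.\<close>

lemma C_1_increment:
  assumes C: "C_on 1 U f" and UV: "ball x r \<subseteq> U"
    and close: "\<And>i y. y \<in> ball x r \<Longrightarrow> \<bar>partial i f y - partial i f x\<bar> \<le> e"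
    and h: "norm h < r"
  shows "\<bar>f (x + h) - f x - dird h f x\<bar> \<le> e * (\<Sum>i\<in>UNIV. \<bar>h $ i\<bar>)"
proof -
  \<comment> \<open>\<open>pr S\<close> is the part of \<open>h\<close> in the coordinates of \<open>S\<close>, which are added one at a time.\<close>
  define pr where "pr S = (\<chi> i. if i \<in> S then h $ i else 0)" for S
  have "finite S \<Longrightarrow> \<bar>f (x + pr S) - f x - (\<Sum>i\<in>S. h $ i * partial i f x)\<bar> \<le> e * (\<Sum>i\<in>S. \<bar>h $ i\<bar>)"
    for S :: "'a set"
  proof (induction S rule: finite_induct)
    case empty
    have "pr {} = 0" by (simp add: pr_def vec_eq_iff)
    then show ?case by simp
  next
    case (insert a S)
    have ins: "pr (insert a S) = pr S + (h $ a) *\<^sub>R axis a 1"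
      using insert by (auto simp: pr_def vec_eq_iff axis_def)
    have in_ball: "x + pr S + t *\<^sub>R axis a 1 \<in> ball x r" if "\<bar>t\<bar> \<le> \<bar>h $ a\<bar>" for t
    proof -
      have "norm (pr S + t *\<^sub>R axis a 1) \<le> norm h"
        by (rule norm_le_componentwise_cart)
          (use insert that in \<open>auto simp: pr_def axis_def\<close>)
      then have "norm (- (pr S + t *\<^sub>R axis a 1)) < r" using h by (simp only: norm_minus_cancel)
      then show ?thesis by (simp add: dist_norm)
    qed
    have "((\<lambda>t. f (x + pr S + t *\<^sub>R axis a 1)) has_real_derivative
        partial a f (x + pr S + t *\<^sub>R axis a 1)) (at t)" if "\<bar>t\<bar> \<le> \<bar>h $ a\<bar>" for t
      using has_partial[of 0 U f "x + pr S" t a] C in_ball[OF that] UV by auto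
    from real_MVT_any[OF this] obtain t where t: "\<bar>t\<bar> \<le> \<bar>h $ a\<bar>"
      and eq: "f (x + pr (insert a S)) - f (x + pr S) = h $ a * partial a f (x + pr S + t *\<^sub>R axis a 1)"
      by (auto simp: ins add.assoc)
    have "\<bar>h $ a * (partial a f (x + pr S + t *\<^sub>R axis a 1) - partial a f x)\<bar> \<le> \<bar>h $ a\<bar> * e"
      unfolding abs_mult by (intro mult_left_mono close in_ball t) auto
    then show ?case
      using insert eq by (simp add: algebra_simps)
  qed
  from this[of UNIV] have "\<bar>f (x + pr UNIV) - f x - dird h f x\<bar> \<le> e * (\<Sum>i\<in>UNIV. \<bar>h $ i\<bar>)"
    by (simp add: dird_def)
  moreover have "pr UNIV = h" by (simp add: pr_def vec_eq_iff)
  ultimately show ?thesis by simp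
qed

text \<open>By continuity the partial derivatives stay, near \<open>x\<close>, within \<open>e / d\<close> of their values at \<open>x\<close>,
where \<open>d\<close> is the number of coordinates; this makes the error of the linear approximation at most
\<open>e |h|\<close>.\<close>

lemma C_1_has_derivative:
  assumes "open U" "C_on (Suc m) U f" "x \<in> U"
  shows "(f has_derivative (\<lambda>h. dird h f x)) (at x)"
  unfolding has_derivative_at_alt
proof (intro conjI allI impI)
  show "bounded_linear (\<lambda>h. dird h f x)"
    unfolding dird_def
    by (intro bounded_linear_sum bounded_linear_mult_const bounded_linear_vec_nth)
next
  fix e :: real assume "e > 0"
  define c where "c = real CARD('a)"
  have c: "c > 0" by (simp add: c_def)
  have C1: "C_on 1 U f" using assms(2) by (rule C_on_mono) simp
  have "\<exists>d>0. \<forall>y\<in>U. dist y x < d \<longrightarrow> dist (partial i f y) (partial i f x) < e / c" for i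
  proof -
    have "continuous_on U (partial i f)"
      using C1 by simp
    moreover have "e / c > 0" using c \<open>e > 0\<close> by simp
    ultimately show ?thesis using assms(3) unfolding continuous_on_iff by blast
  qed
  then obtain d where d: "\<And>i. d i > 0"
    "\<And>i y. y \<in> U \<Longrightarrow> dist y x < d i \<Longrightarrow> dist (partial i f y) (partial i f x) < e / c"
    by metis
  obtain r0 where r0: "r0 > 0" "ball x r0 \<subseteq> U" using assms(1,3) openE by blast
  define r where "r = Min (insert r0 (range d))"
  have r: "r > 0" "r \<le> r0" "\<And>i. r \<le> d i" using d r0 by (auto simp: r_def intro!: Min_le simp del: Min_insert)
  have rU: "ball x r \<subseteq> U" using r r0 by auto
  have close: "\<bar>partial i f y - partial i f x\<bar> \<le> e / c" if "y \<in> ball x r" for i y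
    using d(2)[of y i] r(3)[of i] that rU by (auto simp: dist_real_def dist_commute)
  show "\<exists>d>0. \<forall>y. norm (y - x) < d \<longrightarrow> norm (f y - f x - dird (y - x) f x) \<le> e * norm (y - x)"
  proof (intro exI[of _ r] conjI allI impI \<open>r > 0\<close>)
    fix y assume "norm (y - x) < r"
    then have "\<bar>f (x + (y - x)) - f x - dird (y - x) f x\<bar> \<le> e / c * (\<Sum>i\<in>UNIV. \<bar>(y - x) $ i\<bar>)"
      by (intro C_1_increment[OF C1 rU]) (use close in auto)
    also have "\<dots> \<le> e / c * (\<Sum>i\<in>(UNIV::'a set). norm (y - x))"
      using c \<open>e > 0\<close> by (intro mult_left_mono sum_mono component_le_norm_cart) auto
    also have "\<dots> = e * norm (y - x)" using c by (simp add: c_def)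
    finally show "norm (f y - f x - dird (y - x) f x) \<le> e * norm (y - x)" by simp
  qed
qed

lemma partial_compose_linear:
  assumes "open U" "C_on (Suc m) U f" "linear A" "A x \<in> U"
  shows "partial i (f \<circ> A) x = dird (A (axis i 1)) f (A x)"
proof (rule partial_eqI)
  have "((\<lambda>t. A x + t *\<^sub>R A (axis i 1)) has_derivative (\<lambda>t. t *\<^sub>R A (axis i 1))) (at 0)"
    by (auto intro!: derivative_eq_intros)
  then have "(f \<circ> (\<lambda>t. A x + t *\<^sub>R A (axis i 1)) has_derivative
      (\<lambda>h. dird h f (A x)) \<circ> (\<lambda>t. t *\<^sub>R A (axis i 1))) (at 0)"
    by (rule diff_chain_at) (use C_1_has_derivative[OF assms(1,2,4)] in simp)
  then have "((\<lambda>t. f (A x + t *\<^sub>R A (axis i 1))) has_derivative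
      (\<lambda>t. dird (t *\<^sub>R A (axis i 1)) f (A x))) (at 0)"
    by (simp add: o_def)
  moreover have "A (x + t *\<^sub>R axis i 1) = A x + t *\<^sub>R A (axis i 1)" for t
    using assms(3) by (simp add: linear_add linear_scale)
  moreover have "dird (t *\<^sub>R v) f y = dird v f y * t" for t v y
    by (simp add: dird_def sum_distrib_left mult_ac)
  ultimately show "((\<lambda>t. (f \<circ> A) (x + t *\<^sub>R axis i 1)) has_real_derivative dird (A (axis i 1)) f (A x)) (at 0)"
    by (simp add: has_field_derivative_def)
qed

text \<open>By the chain rule the partial derivatives of \<open>f \<circ> A\<close> are directional derivatives of \<open>f\<close>
composed with \<open>A\<close>, so the claim follows by induction on \<open>m\<close>.\<close>

lemma C_on_compose_linear:
  assumes "open U" "C_on m U f" "linear A"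
  shows "C_on m (A -` U) (f \<circ> A)"
  using assms(2)
proof (induction m arbitrary: f)
  case 0
  have "continuous_on (A -` U) A"
    using assms(3) by (simp add: linear_continuous_on linear_conv_bounded_linear)
  with 0 show ?case
    by (auto simp del: o_apply intro!: continuous_on_compose elim: continuous_on_subset)
next
  case (Suc m)
  have contA: "continuous_on S A" for S
    using assms(3) by (simp add: linear_continuous_on linear_conv_bounded_linear)
  have op: "open (A -` U)"
    using continuous_open_vimage[OF assms(1)] contA[of UNIV] assms(1) open_vimage by blast
  have "continuous_on (A -` U) (f \<circ> A)"
    using C_on_imp_continuous[OF Suc.prems]
    by (intro continuous_on_compose contA) (auto elim: continuous_on_subset)
  moreover have "C_on m (A -` U) (partial i (f \<circ> A))" for i
  proof (rule C_on_cong_imp[OF op])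
    show "C_on m (A -` U) (dird (A (axis i 1)) f \<circ> A)"
      by (intro Suc.IH C_on_dird assms Suc.prems)
    show "(dird (A (axis i 1)) f \<circ> A) x = partial i (f \<circ> A) x" if "x \<in> A -` U" for x
      using partial_compose_linear[OF assms(1) Suc.prems assms(3)] that by simp
  qed
  moreover have "(\<lambda>t. (f \<circ> A) (x + t *\<^sub>R axis i 1)) differentiable (at 0)" if "x \<in> A -` U" for x i
  proof -
    have "(f has_derivative (\<lambda>h. dird h f (A x))) (at (A x))"
      using C_1_has_derivative[OF assms(1) Suc.prems] that by simp
    then have "f differentiable at ((\<lambda>t. A x + t *\<^sub>R A (axis i 1)) (0::real))"
      unfolding differentiable_def by auto
    then have "(f \<circ> (\<lambda>t. A x + t *\<^sub>R A (axis i 1))) differentiable (at (0::real))"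
      by (intro differentiable_chain_at) (auto intro!: derivative_intros)
    moreover have "A (x + t *\<^sub>R axis i 1) = A x + t *\<^sub>R A (axis i 1)" for t
      using assms(3) by (simp add: linear_add linear_scale)
    ultimately show ?thesis by (simp add: o_def)
  qed
  ultimately show ?case by (simp del: o_apply)
qed

section \<open>Symmetry of mixed partial derivatives\<close>

text \<open>Schwarz's theorem, by comparing the two mean value expressions of a second difference.\<close>

lemma partial_commute:
  assumes U: "open U" and C: "C_on (Suc (Suc m)) U f" and x: "x \<in> U"
  shows "partial i (partial j f) x = partial j (partial i f) x"
proof -
  have C2: "C_on 2 U f" using C by (rule C_on_mono) simp
  have C1: "C_on 1 U f" using C by (rule C_on_mono) simp
  have Cp: "C_on 1 U (partial i f)" for i using C_on_partial[of 1 U f] C2 by (simp add: numeral_2_eq_2)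
  have cont: "continuous_on U (partial i (partial j f))" for i j
    using Cp[of j] by simp
  obtain r where r: "r > 0" "ball x r \<subseteq> U" using U x openE by blast
  \<comment> \<open>By the mean value theorem in direction \<open>a\<close> and then in direction \<open>b\<close>, the second
    difference over a square of side \<open>s\<close> is \<open>s\<^sup>2\<close> times a mixed derivative in the square.\<close>
  have second_diff: "\<exists>y. dist x y \<le> 2 * s \<and>
      f (x + s *\<^sub>R axis a 1 + s *\<^sub>R axis b 1) - f (x + s *\<^sub>R axis a 1) - f (x + s *\<^sub>R axis b 1) + f x
        = s * s * partial b (partial a f) y"
    if s: "0 < s" "2 * s < r" for s a b
  proof -
    have near: "dist x (x + t *\<^sub>R axis a 1 + u *\<^sub>R axis b 1) \<le> 2 * s" if "\<bar>t\<bar> \<le> \<bar>s\<bar>" "\<bar>u\<bar> \<le> \<bar>s\<bar>" for t u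
    proof -
      have "dist x (x + t *\<^sub>R axis a 1 + u *\<^sub>R axis b 1) = norm (t *\<^sub>R axis a 1 + u *\<^sub>R axis b (1::real))"
        unfolding dist_norm by (subst norm_minus_commute) (simp add: add.assoc)
      also have "\<dots> \<le> \<bar>t\<bar> + \<bar>u\<bar>"
        by (rule order_trans[OF norm_triangle_ineq]) simp
      finally show ?thesis using that s by simp
    qed
    have inU: "x + t *\<^sub>R axis a 1 + u *\<^sub>R axis b 1 \<in> U" if "\<bar>t\<bar> \<le> \<bar>s\<bar>" "\<bar>u\<bar> \<le> \<bar>s\<bar>" for t u
      using near[OF that] s r by auto
    define \<phi> where "\<phi> t = f (x + s *\<^sub>R axis b 1 + t *\<^sub>R axis a 1) - f (x + t *\<^sub>R axis a 1)" for t
    have "(\<phi> has_real_derivative partial a f (x + s *\<^sub>R axis b 1 + t *\<^sub>R axis a 1) -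
        partial a f (x + t *\<^sub>R axis a 1)) (at t)" if "\<bar>t\<bar> \<le> \<bar>s\<bar>" for t
      unfolding \<phi>_def
      by (intro DERIV_diff has_partial[of 0 U])
        (use C1 inU[OF that, of s] inU[OF that, of 0] in \<open>simp_all add: algebra_simps\<close>)
    from real_MVT_any[OF this] obtain t where t: "\<bar>t\<bar> \<le> \<bar>s\<bar>" and
      1: "\<phi> s - \<phi> 0 = s * (partial a f (x + s *\<^sub>R axis b 1 + t *\<^sub>R axis a 1) - partial a f (x + t *\<^sub>R axis a 1))"
      by auto
    have "((\<lambda>u. partial a f (x + t *\<^sub>R axis a 1 + u *\<^sub>R axis b 1)) has_real_derivative
        partial b (partial a f) (x + t *\<^sub>R axis a 1 + u *\<^sub>R axis b 1)) (at u)" if "\<bar>u\<bar> \<le> \<bar>s\<bar>" for u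
      by (rule has_partial[of 0 U]) (use Cp inU[OF t that] in simp_all)
    from real_MVT_any[OF this] obtain u where u: "\<bar>u\<bar> \<le> \<bar>s\<bar>" and
      2: "partial a f (x + t *\<^sub>R axis a 1 + s *\<^sub>R axis b 1) - partial a f (x + t *\<^sub>R axis a 1) =
        s * partial b (partial a f) (x + t *\<^sub>R axis a 1 + u *\<^sub>R axis b 1)"
      by auto
    show ?thesis
      using near[OF t u] 1 2
      by (intro exI[of _ "x + t *\<^sub>R axis a 1 + u *\<^sub>R axis b 1"]) (simp add: \<phi>_def algebra_simps)
  qed
  have "\<bar>partial i (partial j f) x - partial j (partial i f) x\<bar> < e" if e: "e > 0" for e
  proof -
    have "\<exists>d>0. \<forall>y\<in>U. dist y x < d \<longrightarrow> dist (partial a (partial b f) y) (partial a (partial b f) x) < e / 2" for a b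
      using cont[of a b] x e unfolding continuous_on_iff by (metis half_gt_zero)
    then obtain d where d: "\<And>a b. d a b > 0" "\<And>a b y. y \<in> U \<Longrightarrow> dist y x < d a b \<Longrightarrow>
        dist (partial a (partial b f) y) (partial a (partial b f) x) < e / 2"
      by metis
    define w where "w = min r (min (d i j) (d j i))"
    have w: "0 < w" "w \<le> r" "w \<le> d i j" "w \<le> d j i" using r d by (auto simp: w_def)
    define s where "s = w / 3"
    have s: "0 < s" "2 * s < r" "2 * s < d i j" "2 * s < d j i"
      using w by (auto simp: s_def)
    obtain y where y: "dist x y \<le> 2 * s"
      "f (x + s *\<^sub>R axis i 1 + s *\<^sub>R axis j 1) - f (x + s *\<^sub>R axis i 1) - f (x + s *\<^sub>R axis j 1) + f x
        = s * s * partial j (partial i f) y"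
      using second_diff[OF s(1,2)] by blast
    obtain z where z: "dist x z \<le> 2 * s"
      "f (x + s *\<^sub>R axis j 1 + s *\<^sub>R axis i 1) - f (x + s *\<^sub>R axis j 1) - f (x + s *\<^sub>R axis i 1) + f x
        = s * s * partial i (partial j f) z"
      using second_diff[OF s(1,2)] by blast
    have "s * s * partial j (partial i f) y = s * s * partial i (partial j f) z"
      using y(2) z(2) by (simp add: algebra_simps)
    then have eq: "partial j (partial i f) y = partial i (partial j f) z" using s by simp
    have "y \<in> U" "z \<in> U" using y(1) z(1) s(2) r(2) by auto
    then have "dist (partial j (partial i f) y) (partial j (partial i f) x) < e / 2"
      "dist (partial i (partial j f) z) (partial i (partial j f) x) < e / 2"
      using d(2)[of y j i] d(2)[of z i j] y(1) z(1) s by (auto simp: dist_commute)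
    then show ?thesis using eq unfolding dist_real_def by linarith
  qed
  from this[of "\<bar>partial i (partial j f) x - partial j (partial i f) x\<bar>"] show ?thesis by auto
qed

lemma foldr_partial_move:
  assumes U: "open U" and "C_on (Suc (length as)) U f" and "x \<in> U"
  shows "foldr partial as (partial p f) x = partial p (foldr partial as f) x"
  using assms(2,3)
proof (induction as arbitrary: x)
  case (Cons a as)
  have "foldr partial (a # as) (partial p f) x = partial a (partial p (foldr partial as f)) x"
    using Cons.IH Cons.prems C_on_Suc_D by (auto intro!: partial_cong[OF U] simp del: C_on.simps)
  also have "\<dots> = partial p (partial a (foldr partial as f)) x"
    by (rule partial_commute[OF U, of 0]) (use Cons.prems C_on_foldr_partial[of as 2 U f] in
      \<open>simp_all del: C_on.simps add: numeral_2_eq_2\<close>)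
  finally show ?case by simp
qed simp

text \<open>By repeated use of \<open>partial_commute\<close>, iterated partial derivatives depend only on how often each
coordinate occurs. In particular the unspecified order in \<open>mixed_partial\<close> is harmless.\<close>

lemma foldr_partial_mset:
  assumes U: "open U" and "C_on (length ps) U f" and "mset ps = mset qs" and "x \<in> U"
  shows "foldr partial ps f x = foldr partial qs f x"
  using assms(2-4)
proof (induction ps arbitrary: qs x)
  case (Cons p ps)
  have "p \<in> set qs" using Cons.prems(2) by (metis list.set_intros(1) mset_eq_setD)
  then obtain as bs where qs: "qs = as @ p # bs" by (meson split_list)
  have ms: "mset ps = mset (as @ bs)" using Cons.prems(2) by (simp add: qs)
  then have len: "length ps = length as + length bs" by (metis length_append size_mset)
  have "foldr partial (p # ps) f x = partial p (foldr partial (as @ bs) f) x"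
    using Cons.IH[OF _ ms] Cons.prems C_on_Suc_D[of "length ps" U f]
    by (auto intro!: partial_cong[OF U] simp del: C_on.simps)
  also have "\<dots> = foldr partial as (partial p (foldr partial bs f)) x"
    using foldr_partial_move[OF U, of as "foldr partial bs f" x p] Cons.prems(1,3)
      C_on_foldr_partial[of bs "Suc (length as)" U f]
    by (simp del: C_on.simps add: len add.commute)
  finally show ?case by (simp add: qs)
qed simp

lemma mixed_partial_eq_foldr:
  assumes "open U" "C_on (length ps) U f" "\<And>p. count_list ps p = \<alpha> $ p" "x \<in> U"
  shows "mixed_partial \<alpha> f x = foldr partial ps f x"
proof -
  define qs where "qs = (SOME ps. \<forall>p. count_list ps p = \<alpha> $ p)"
  have qs: "count_list qs p = \<alpha> $ p" for p
    using someI_ex[OF mixed_partial_order_exists[of \<alpha>]] unfolding qs_def by blast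
  have "mset ps = mset qs"
    by (rule multiset_eqI) (simp add: assms(3) qs count_mset)
  from foldr_partial_mset[OF assms(1,2) this assms(4)] show ?thesis
    by (simp add: mixed_partial_def qs_def)
qed

section \<open>Taylor's formula in multi-indices\<close>

lemma dird_pow_lists:
  assumes U: "open U" and "C_on n U f" and "x \<in> U"
  shows "(dird v ^^ n) f x =
    (\<Sum>ps | length ps = n. prod_list (map (($) v) ps) * foldr partial ps f x)"
  using assms(2,3)
proof (induction n arbitrary: x)
  case 0
  have "{ps :: 'a list. length ps = 0} = {[]}" by auto
  then show ?case by simp
next
  case (Suc n)
  have fin: "finite {ps :: 'a list. length ps = n}"
    using finite_lists_length_eq[of "UNIV :: 'a set" n] by simp
  have Cps: "C_on (Suc 0) U (foldr partial ps f)" if "length ps = n" for ps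
    using C_on_foldr_partial[of ps 1 U f] Suc.prems(1) that by (simp del: C_on.simps)
  have "(dird v ^^ Suc n) f x = (\<Sum>i\<in>UNIV. v $ i * partial i ((dird v ^^ n) f) x)"
    by (simp add: dird_def)
  also have "\<dots> = (\<Sum>i\<in>UNIV. v $ i *
      partial i (\<lambda>x. \<Sum>ps | length ps = n. prod_list (map (($) v) ps) * foldr partial ps f x) x)"
    using Suc.IH[OF C_on_Suc_D[OF Suc.prems(1)]] Suc.prems(2)
    by (intro sum.cong refl arg_cong2[where f="(*)"] partial_cong[OF U])
  also have "\<dots> = (\<Sum>i\<in>UNIV. v $ i *
      (\<Sum>ps | length ps = n. prod_list (map (($) v) ps) * partial i (foldr partial ps f) x))"
    using Cps Suc.prems(2)
    by (intro sum.cong refl arg_cong2[where f="(*)"] partial_sum[OF U, where m = 0])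
      (auto simp del: C_on.simps)
  also have "\<dots> = (\<Sum>(i, ps)\<in>UNIV \<times> {ps. length ps = n}.
      prod_list (map (($) v) (i # ps)) * foldr partial (i # ps) f x)"
    by (simp add: sum.cartesian_product sum_distrib_left mult.assoc)
  also have "\<dots> = (\<Sum>ps | length ps = Suc n. prod_list (map (($) v) ps) * foldr partial ps f x)"
    by (rule sum.reindex_bij_witness[of _ "\<lambda>ps. (hd ps, tl ps)" "\<lambda>(i, ps). i # ps"])
      (auto simp: length_Suc_conv)
  finally show ?case .
qed

definition monom_at :: "real^'d::finite \<Rightarrow> nat^'d \<Rightarrow> real" where
  "monom_at v \<alpha> = (\<Prod>p\<in>UNIV. (v $ p) ^ (\<alpha> $ p))"

lemma prod_list_map_eq_monom_at:
  fixes v :: "real^'d::finite"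
  shows "prod_list (map (($) v) ps) = monom_at v (\<chi> p. count_list ps p)"
proof (induction ps)
  case (Cons a ps)
  have "monom_at v (\<chi> p. count_list (a # ps) p) =
      (\<Prod>p\<in>UNIV. (if p = a then v $ p else 1) * (v $ p) ^ count_list ps p)"
    unfolding monom_at_def by (intro prod.cong) auto
  also have "\<dots> = v $ a * monom_at v (\<chi> p. count_list ps p)"
    by (simp add: prod.distrib monom_at_def)
  finally show ?case using Cons by simp
qed (simp add: monom_at_def)

lemma sum_count_list_UNIV: "(\<Sum>p\<in>UNIV. count_list ps (p :: 'd::finite)) = length ps"
  by (rule sum_count_set) auto

lemma card_lists_of_multi_index:
  fixes \<alpha> :: "nat^'d::finite"
  assumes "\<alpha> \<in> multi_indices n"
  shows "real (card {ps. length ps = n \<and> (\<chi> p. count_list ps p) = \<alpha>}) = fact n / multi_fact \<alpha>"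
proof -
  define A where "A = Abs_multiset (\<lambda>p. \<alpha> $ p)"
  have cA: "count A p = \<alpha> $ p" for p by (simp add: A_def Abs_multiset_inverse)
  have sum: "(\<Sum>p\<in>UNIV. \<alpha> $ p) = n" using assms by (simp add: multi_indices_def)
  have "size A = (\<Sum>p\<in>set_mset A. count A p)" by (rule size_multiset_overloaded_eq)
  also have "\<dots> = (\<Sum>p\<in>UNIV. count A p)"
    by (rule sum.mono_neutral_left) (auto simp: not_in_iff)
  finally have size: "size A = n" by (simp add: cA sum)
  have eq: "{ps. length ps = n \<and> (\<chi> p. count_list ps p) = \<alpha>} = permutations_of_multiset A"
  proof (intro set_eqI iffI)
    fix ps assume "ps \<in> permutations_of_multiset A"
    then have ms: "mset ps = A" by (simp add: permutations_of_multiset_def)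
    then have "length ps = n" using size by (metis size_mset)
    moreover have "count_list ps p = \<alpha> $ p" for p
      using ms cA[of p] by (simp add: count_mset[symmetric])
    ultimately show "ps \<in> {ps. length ps = n \<and> (\<chi> p. count_list ps p) = \<alpha>}"
      by (simp add: vec_eq_iff)
  next
    fix ps assume "ps \<in> {ps. length ps = n \<and> (\<chi> p. count_list ps p) = \<alpha>}"
    then have "count_list ps p = \<alpha> $ p" for p by auto
    then have "mset ps = A" by (intro multiset_eqI) (simp add: cA count_mset)
    then show "ps \<in> permutations_of_multiset A" by (simp add: permutations_of_multiset_def)
  qed
  have "(\<Prod>p\<in>set_mset A. fact (count A p)) = (\<Prod>p\<in>UNIV. fact (count A p) :: nat)"
    by (rule prod.mono_neutral_left) (auto simp: not_in_iff)
  then have "card (permutations_of_multiset A) = fact n div (\<Prod>p\<in>UNIV. fact (\<alpha> $ p))"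
    "(\<Prod>p\<in>UNIV. fact (\<alpha> $ p) :: nat) dvd fact n"
    using card_permutations_of_multiset[of A] by (simp_all add: size cA)
  then show ?thesis
    unfolding eq by (simp add: real_of_nat_div multi_fact_def)
qed

text \<open>The multinomial theorem for differential operators: expanding the \<open>n\<close>-th power of
\<open>\<Sum>\<^sub>i v\<^sub>i \<partial>\<^sub>i\<close> gives one term for every list of \<open>n\<close> coordinates, and \<open>n! / \<alpha>!\<close>
lists have the multi-index \<open>\<alpha>\<close>.\<close>

lemma dird_pow_multi_indices:
  fixes f :: "real^'d::finite \<Rightarrow> real"
  assumes U: "open U" and C: "C_on n U f" and x: "x \<in> U"
  shows "(dird v ^^ n) f x / fact n =
    (\<Sum>\<alpha>\<in>multi_indices n. mixed_partial \<alpha> f x / multi_fact \<alpha> * monom_at v \<alpha>)"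
proof -
  define L where "L = {ps :: 'd list. length ps = n}"
  define g where "g ps = (\<chi> p. count_list ps p)" for ps :: "'d list"
  have fin: "finite L"
    using finite_lists_length_eq[of "UNIV :: 'd set" n] by (simp add: L_def)
  have sub: "g ` L \<subseteq> multi_indices n"
    by (auto simp: g_def L_def multi_indices_def sum_count_list_UNIV)
  have "(dird v ^^ n) f x = (\<Sum>ps\<in>L. prod_list (map (($) v) ps) * foldr partial ps f x)"
    unfolding L_def by (rule dird_pow_lists[OF assms])
  also have "\<dots> = (\<Sum>\<alpha>\<in>multi_indices n. \<Sum>ps\<in>{ps\<in>L. g ps = \<alpha>}.
      prod_list (map (($) v) ps) * foldr partial ps f x)"
    by (rule sum.group[OF fin finite_multi_indices sub, symmetric])
  also have "\<dots> = (\<Sum>\<alpha>\<in>multi_indices n. \<Sum>ps\<in>{ps\<in>L. g ps = \<alpha>}.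
      monom_at v \<alpha> * mixed_partial \<alpha> f x)"
  proof (intro sum.cong refl, clarify)
    fix ps assume "ps \<in> L"
    then have "mixed_partial (g ps) f x = foldr partial ps f x"
      by (intro mixed_partial_eq_foldr[OF U _ _ x]) (use C in \<open>auto simp: L_def g_def\<close>)
    then show "prod_list (map (($) v) ps) * foldr partial ps f x =
        monom_at v (g ps) * mixed_partial (g ps) f x"
      by (simp add: prod_list_map_eq_monom_at g_def)
  qed
  also have "\<dots> = (\<Sum>\<alpha>\<in>multi_indices n. fact n / multi_fact \<alpha> * (monom_at v \<alpha> * mixed_partial \<alpha> f x))"
    by (intro sum.cong refl) (simp add: L_def g_def flip: card_lists_of_multi_index)
  finally show ?thesis by (simp add: sum_divide_distrib mult_ac)
qed

text \<open>The one-dimensional Taylor formula with Lagrange remainder for \<open>t \<mapsto> f (t y)\<close>.\<close>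

lemma taylor_along_segment:
  fixes f :: "real^'d::finite \<Rightarrow> real"
  assumes U: "open U" and C: "C_on m U f" and "m > 0"
    and seg: "\<And>t. 0 \<le> t \<Longrightarrow> t \<le> 1 \<Longrightarrow> t *\<^sub>R y \<in> U"
  shows "\<exists>t. 0 < t \<and> t < 1 \<and>
    f y = (\<Sum>n<m. (dird y ^^ n) f 0 / fact n) + (dird y ^^ m) f (t *\<^sub>R y) / fact m"
proof -
  define D where "D n t = (dird y ^^ n) f (t *\<^sub>R y)" for n and t :: real
  have "\<exists>t. 0 < t \<and> t < (1::real) \<and>
      D 0 1 = (\<Sum>n<m. (D n 0 / fact n) * 1 ^ n) + (D m t / fact m) * 1 ^ m"
  proof (rule Maclaurin)
    show "\<forall>n t. n < m \<and> 0 \<le> t \<and> t \<le> 1 \<longrightarrow> (D n has_real_derivative D (Suc n) t) (at t)"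
    proof (intro allI impI, elim conjE)
      fix n and t :: real assume n: "n < m" and t: "0 \<le> t" "t \<le> 1"
      have "C_on (Suc 0) U ((dird y ^^ n) f)"
        using C_on_dird_pow[OF U, of n "Suc 0" f y] C_on_mono[OF C, of "n + Suc 0"] n by simp
      from C_1_has_derivative[OF U this seg[OF t]]
      have "((dird y ^^ n) f \<circ> (\<lambda>t. t *\<^sub>R y) has_derivative
          (\<lambda>h. dird h ((dird y ^^ n) f) (t *\<^sub>R y)) \<circ> (\<lambda>s. s *\<^sub>R y)) (at t)"
        by (intro diff_chain_at) (auto intro!: derivative_eq_intros)
      moreover have "dird (s *\<^sub>R y) h z = dird y h z * s" for s h z
        by (simp add: dird_def sum_distrib_left mult_ac)
      ultimately show "(D n has_real_derivative D (Suc n) t) (at t)"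
        by (simp add: has_field_derivative_def D_def[abs_def] o_def)
    qed
  qed (use \<open>m > 0\<close> in auto)
  then show ?thesis by (simp add: D_def)
qed

lemma dird_pow_bound:
  fixes f :: "real^'d::finite \<Rightarrow> real"
  assumes U: "open U" and C: "C_on m U f" and K: "compact K" "K \<subseteq> U"
  shows "\<exists>B\<ge>0. \<forall>x\<in>K. \<forall>v. \<bar>(dird v ^^ m) f x\<bar> \<le> B * norm v ^ m"
proof -
  define L where "L = {ps :: 'd list. length ps = m}"
  have "\<exists>B. \<forall>x\<in>K. \<bar>foldr partial ps f x\<bar> \<le> B" if "ps \<in> L" for ps
  proof -
    have "continuous_on U (foldr partial ps f)"
      using C_on_foldr_partial[of ps 0 U f] C that by (simp add: L_def)
    then have "compact (foldr partial ps f ` K)"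
      using K by (intro compact_continuous_image) (auto elim: continuous_on_subset)
    then have "bounded (foldr partial ps f ` K)" by (rule compact_imp_bounded)
    then show ?thesis unfolding bounded_iff by auto
  qed
  then obtain B where B: "\<And>ps x. ps \<in> L \<Longrightarrow> x \<in> K \<Longrightarrow> \<bar>foldr partial ps f x\<bar> \<le> B ps" by metis
  have comp: "\<bar>prod_list (map (($) v) ps)\<bar> \<le> norm v ^ length ps" for v :: "real^'d" and ps
    by (induction ps) (auto simp: abs_mult intro!: mult_mono component_le_norm_cart)
  show ?thesis
  proof (intro exI[of _ "\<Sum>ps\<in>L. \<bar>B ps\<bar>"] conjI ballI allI sum_nonneg abs_ge_zero)
    fix x v assume x: "x \<in> K"
    have "\<bar>(dird v ^^ m) f x\<bar> = \<bar>\<Sum>ps\<in>L. prod_list (map (($) v) ps) * foldr partial ps f x\<bar>"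
      unfolding L_def using dird_pow_lists[OF U C] x K by auto
    also have "\<dots> \<le> (\<Sum>ps\<in>L. norm v ^ m * \<bar>B ps\<bar>)"
      by (intro order_trans[OF sum_abs] sum_mono)
        (use comp B x in \<open>fastforce simp: abs_mult L_def intro!: mult_mono\<close>)
    also have "\<dots> = (\<Sum>ps\<in>L. \<bar>B ps\<bar>) * norm v ^ m" by (simp add: sum_distrib_left mult.commute)
    finally show "\<bar>(dird v ^^ m) f x\<bar> \<le> (\<Sum>ps\<in>L. \<bar>B ps\<bar>) * norm v ^ m" .
  qed
qed

theorem multivariate_taylor:
  fixes f :: "real^'d::finite \<Rightarrow> real"
  assumes U: "open U" and C: "C_on m U f" and "m > 0" and r: "cball 0 r \<subseteq> U"
  shows "\<exists>B\<ge>0. \<forall>y\<in>cball 0 r. \<bar>f y - (\<Sum>n<m. (dird y ^^ n) f 0 / fact n)\<bar> \<le> B * norm y ^ m"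
proof -
  obtain B where B: "B \<ge> 0" "\<And>x v. x \<in> cball 0 r \<Longrightarrow> \<bar>(dird v ^^ m) f x\<bar> \<le> B * norm v ^ m"
    using dird_pow_bound[OF U C compact_cball r] by blast
  show ?thesis
  proof (intro exI[of _ "B / fact m"] conjI ballI)
    fix y :: "real^'d" assume "y \<in> cball 0 r"
    then have seg: "t *\<^sub>R y \<in> cball 0 r" if "0 \<le> t" "t \<le> 1" for t
      using that mult_left_le_one_le[of "norm y" t] by auto
    obtain t where "0 < t" "t < 1"
      "f y = (\<Sum>n<m. (dird y ^^ n) f 0 / fact n) + (dird y ^^ m) f (t *\<^sub>R y) / fact m"
      using taylor_along_segment[OF U C \<open>m > 0\<close>, of y] seg r by blast
    then show "\<bar>f y - (\<Sum>n<m. (dird y ^^ n) f 0 / fact n)\<bar> \<le> B / fact m * norm y ^ m"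
      using B(2)[OF seg[of t], of y] by (simp add: divide_right_mono)
  qed (use B in auto)
qed

section \<open>Linear changes of variables\<close>

text \<open>The theorem \<open>measure_linear_image\<close> concerns well-ordered index types. A copy of an arbitrary
finite type carries such an order, and permuting coordinates changes neither Lebesgue measure nor
determinants.\<close>

typedef (overloaded) 'd ordered_copy = "UNIV :: 'd::finite set" ..

instance ordered_copy :: (finite) finite
proof
  have "UNIV = Abs_ordered_copy ` (UNIV :: 'a set)"
    by (metis Abs_ordered_copy_cases UNIV_eq_I rangeI)
  then show "finite (UNIV :: 'a ordered_copy set)" by (metis finite finite_imageI)
qed

instantiation ordered_copy :: (finite) wellorder
begin

definition rank_ordered_copy :: "'a ordered_copy \<Rightarrow> nat" where
  "rank_ordered_copy x = to_nat_on UNIV (Rep_ordered_copy x)"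

definition less_eq_ordered_copy :: "'a ordered_copy \<Rightarrow> 'a ordered_copy \<Rightarrow> bool" where
  "x \<le> y \<longleftrightarrow> rank_ordered_copy x \<le> rank_ordered_copy y"

definition less_ordered_copy :: "'a ordered_copy \<Rightarrow> 'a ordered_copy \<Rightarrow> bool" where
  "x < y \<longleftrightarrow> rank_ordered_copy x < rank_ordered_copy y"

instance
proof
  fix x y :: "'a ordered_copy"
  assume "x \<le> y" "y \<le> x"
  then have "to_nat_on UNIV (Rep_ordered_copy x) = to_nat_on UNIV (Rep_ordered_copy y)"
    by (simp add: less_eq_ordered_copy_def rank_ordered_copy_def)
  then have "Rep_ordered_copy x = Rep_ordered_copy y"
    by (simp add: countable_finite)
  then show "x = y" by (simp add: Rep_ordered_copy_inject)
next
  fix P :: "'a ordered_copy \<Rightarrow> bool" and a :: "'a ordered_copy"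
  assume step: "\<And>x. (\<And>y. y < x \<Longrightarrow> P y) \<Longrightarrow> P x"
  show "P a"
  proof (induction a rule: measure_induct_rule[of rank_ordered_copy])
    case (less x)
    show ?case by (rule step, rule less, simp add: less_ordered_copy_def)
  qed
qed (auto simp: less_eq_ordered_copy_def less_ordered_copy_def)

end

lemma bij_Rep_ordered_copy: "bij (Rep_ordered_copy :: 'd::finite ordered_copy \<Rightarrow> 'd)"
  by (rule bijI') (auto simp: Rep_ordered_copy_inject intro: Abs_ordered_copy_inverse[symmetric])

text \<open>Conjugation with the bijection maps the permutations of one index type onto those of the other and
preserves signs.\<close>

lemma det_reindex:
  fixes B :: "'a::comm_ring_1^'d::finite^'d" and s :: "'e::finite \<Rightarrow> 'd"
  assumes "bij s"
  shows "det (\<chi> i j. B $ s i $ s j) = det B"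
proof -
  have inj: "inj s" and surj: "surj s" using assms by (auto simp: bij_def)
  have inv: "inv s (s x) = x" "s (inv s y) = y" for x y
    using inj surj by (auto simp: surj_f_inv_f)
  have map: "map_permutation UNIV s p = s \<circ> p \<circ> inv s" for p :: "'e \<Rightarrow> 'e"
    using surj by (simp add: map_permutation_def restrict_id_def fun_eq_iff)
  have bijs: "bij (s \<circ> p \<circ> inv s)" if "bij p" for p
    using that assms by (intro bij_comp bij_imp_bij_inv)
  have bijs': "bij (inv s \<circ> q \<circ> s)" if "bij q" for q
    using that assms by (intro bij_comp bij_imp_bij_inv)
  have perm': "p permutes UNIV \<longleftrightarrow> bij p" for p :: "'e \<Rightarrow> 'e"
    by (auto intro: permutes_bij bij_imp_permutes)
  have perm'': "p permutes UNIV \<longleftrightarrow> bij p" for p :: "'d \<Rightarrow> 'd"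
    by (auto intro: permutes_bij bij_imp_permutes)
  show ?thesis unfolding det_def
  proof (rule sum.reindex_bij_witness[of _ "\<lambda>q. inv s \<circ> q \<circ> s" "\<lambda>p. s \<circ> p \<circ> inv s"]; clarify?)
    fix p :: "'e \<Rightarrow> 'e" assume p: "p permutes UNIV"
    show "inv s \<circ> (s \<circ> p \<circ> inv s) \<circ> s = p" by (simp add: fun_eq_iff inv)
    show "s \<circ> p \<circ> inv s permutes UNIV"
      using bijs p by (simp only: perm' perm'')
    have "sign (s \<circ> p \<circ> inv s) = sign p"
      using sign_map_permutation[OF inj p] by (simp add: map)
    moreover have "(\<Prod>i\<in>UNIV. B $ i $ (s \<circ> p \<circ> inv s) i) = (\<Prod>i\<in>UNIV. B $ s i $ s (p i))"
      using prod.reindex_bij_betw[OF assms, of "\<lambda>i. B $ i $ (s \<circ> p \<circ> inv s) i"] by (simp add: inv)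
    ultimately show "of_int (sign (s \<circ> p \<circ> inv s)) * (\<Prod>i\<in>UNIV. B $ i $ (s \<circ> p \<circ> inv s) i) =
        of_int (sign p) * (\<Prod>i\<in>UNIV. (\<chi> i j. B $ s i $ s j) $ i $ p i)"
      by simp
  next
    fix q :: "'d \<Rightarrow> 'd" assume q: "q permutes UNIV"
    show "s \<circ> (inv s \<circ> q \<circ> s) \<circ> inv s = q" by (simp add: fun_eq_iff inv)
    show "inv s \<circ> q \<circ> s permutes UNIV"
      using bijs' q by (simp only: perm' perm'')
  qed
qed

lemma prod_Basis_vec:
  fixes h :: "real^'d::finite \<Rightarrow> 'a::comm_monoid_mult"
  shows "(\<Prod>b\<in>Basis. h b) = (\<Prod>i\<in>UNIV. h (axis i 1))"
proof -
  have B: "(Basis :: (real^'d) set) = (\<lambda>i. axis i 1) ` UNIV"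
    by (auto simp: Basis_vec_def)
  have "inj (\<lambda>i :: 'd. axis i (1::real))" by (auto simp: inj_on_def axis_eq_axis)
  then show ?thesis unfolding B by (subst prod.reindex) auto
qed

lemma lborel_reindex:
  fixes s :: "'e::finite \<Rightarrow> 'd::finite"
  assumes "bij s"
  shows "(lborel :: (real^'e) measure) = distr lborel borel (\<lambda>x :: real^'d. \<chi> i. x $ s i)"
proof (rule lborel_eqI)
  fix l u :: "real^'e"
  assume le: "\<And>b. b \<in> Basis \<Longrightarrow> l \<bullet> b \<le> u \<bullet> b"
  have le': "l $ i \<le> u $ i" for i
    using le[of "axis i 1"] by (simp add: inner_axis)
  have inv: "inv s (s x) = x" "s (inv s y) = y" for x y
    using assms by (auto simp: bij_def surj_f_inv_f)
  have cont: "continuous_on UNIV (\<lambda>x :: real^'d. \<chi> i. x $ s i)"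
    by (intro continuous_intros)
  then have meas: "(\<lambda>x :: real^'d. \<chi> i. x $ s i) \<in> borel_measurable borel"
    by (rule borel_measurable_continuous_onI)
  have pre: "(\<lambda>x :: real^'d. \<chi> i. x $ s i) -` box l u = box (\<chi> i. l $ inv s i) (\<chi> i. u $ inv s i)"
  proof (rule set_eqI)
    fix x :: "real^'d"
    have "(\<forall>i. l $ i < x $ s i \<and> x $ s i < u $ i) \<longleftrightarrow>
        (\<forall>j. l $ inv s j < x $ j \<and> x $ j < u $ inv s j)"
      by (metis inv)
    then show "x \<in> (\<lambda>x :: real^'d. \<chi> i. x $ s i) -` box l u \<longleftrightarrow>
        x \<in> box (\<chi> i. l $ inv s i) (\<chi> i. u $ inv s i)"
      by (simp add: mem_box_cart)
  qed
  have "emeasure (distr lborel borel (\<lambda>x :: real^'d. \<chi> i. x $ s i)) (box l u) =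
      emeasure lborel (box (\<chi> i. l $ inv s i) (\<chi> i. u $ inv s i))"
    using meas by (simp add: emeasure_distr pre)
  also have "\<dots> = (\<Prod>i\<in>UNIV. u $ inv s i - l $ inv s i)"
  proof -
    have "\<forall>b\<in>Basis. (\<chi> i. l $ inv s i) \<bullet> b \<le> (\<chi> i. u $ inv s i) \<bullet> (b :: real^'d)"
      using le' by (auto simp: Basis_vec_def inner_axis)
    then show ?thesis
      by (simp add: emeasure_lborel_box_eq prod_Basis_vec inner_axis)
  qed
  also have "\<dots> = (\<Prod>i\<in>UNIV. u $ i - l $ i)"
    using prod.reindex_bij_betw[OF assms, of "\<lambda>i. u $ inv s i - l $ inv s i"] by (simp add: inv)
  finally show "emeasure (distr lborel borel (\<lambda>x :: real^'d. \<chi> i. x $ s i)) (box l u) =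
      (\<Prod>b\<in>Basis. (u - l) \<bullet> b)"
    by (simp add: prod_Basis_vec inner_axis)
qed simp

lemma emeasure_linear_image_box_wellorder:
  fixes B :: "real^'n::{finite,wellorder}^'n::{finite,wellorder}"
  assumes "(*v) B ` box l u \<in> sets borel"
  shows "emeasure lborel ((*v) B ` box l u) = ennreal \<bar>det B\<bar> * emeasure lborel (box l u)"
proof -
  have 1: "(*v) B ` box l u \<in> lmeasurable"
    using measurable_linear_image[of "(*v) B" "box l u"] by simp
  have 2: "measure lebesgue ((*v) B ` box l u) = \<bar>det B\<bar> * measure lebesgue (box l u)"
    using measure_linear_image[of "(*v) B" "box l u"] by simp
  have "emeasure lborel ((*v) B ` box l u) = emeasure lebesgue ((*v) B ` box l u)"
    using assms by simp
  also have "\<dots> = ennreal (\<bar>det B\<bar> * measure lebesgue (box l u))"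
    using 1 by (simp only: emeasure_eq_measure2 2)
  also have "\<dots> = ennreal \<bar>det B\<bar> * emeasure lebesgue (box l u)"
    by (simp add: ennreal_mult emeasure_eq_measure2)
  finally show ?thesis by simp
qed

lemma emeasure_linear_image_box:
  fixes B :: "real^'d::finite^'d"
  assumes AB: "A ** B = mat 1" and BA: "B ** A = mat 1"
  shows "emeasure lborel ((*v) B ` box l u) = ennreal \<bar>det B\<bar> * emeasure lborel (box l u)"
proof -
  define s where "s = (Rep_ordered_copy :: 'd ordered_copy \<Rightarrow> 'd)"
  have s: "bij s" unfolding s_def by (rule bij_Rep_ordered_copy)
  have inv: "inv s (s x) = x" "s (inv s y) = y" for x y
    using s by (auto simp: bij_def surj_f_inv_f)
  define \<Phi> where "\<Phi> x = (\<chi> i. x $ s i)" for x :: "real^'d"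
  have meas: "\<Phi> \<in> borel_measurable borel"
    unfolding \<Phi>_def[abs_def] by (intro borel_measurable_continuous_onI continuous_intros)
  have vimg: "emeasure lborel (\<Phi> -` X) = emeasure lborel X" if "X \<in> sets borel" for X
    using lborel_reindex[OF s] emeasure_distr[of \<Phi> lborel borel X] meas that by (simp add: \<Phi>_def[abs_def])
  define B' A' where "B' = (\<chi> i j. B $ s i $ s j)" and "A' = (\<chi> i j. A $ s i $ s j)"
  have comm: "(\<chi> i j. M $ s i $ s j) *v \<Phi> x = \<Phi> (M *v x)" for M x
    using sum.reindex_bij_betw[OF s, of "\<lambda>j. M $ s i $ j * x $ j" for i]
    by (simp add: \<Phi>_def matrix_vector_mult_def vec_eq_iff)
  have surj\<Phi>: "\<exists>x. y = \<Phi> x" for y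
    by (rule exI[of _ "\<chi> i. y $ inv s i"]) (simp add: \<Phi>_def vec_eq_iff inv)
  have box: "\<Phi> -` box (\<Phi> l) (\<Phi> u) = box l u"
  proof (rule set_eqI)
    fix x :: "real^'d"
    have "(\<forall>i. l $ s i < x $ s i \<and> x $ s i < u $ s i) \<longleftrightarrow> (\<forall>j. l $ j < x $ j \<and> x $ j < u $ j)"
      by (metis inv(2))
    then show "x \<in> \<Phi> -` box (\<Phi> l) (\<Phi> u) \<longleftrightarrow> x \<in> box l u"
      by (simp add: mem_box_cart \<Phi>_def)
  qed
  have inverse: "A *v (B *v x) = x" "B *v (A *v x) = x" for x
    by (simp_all add: matrix_vector_mul_assoc AB BA)
  have img: "(*v) B' ` box (\<Phi> l) (\<Phi> u) = (*v) A' -` box (\<Phi> l) (\<Phi> u)"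
  proof (intro set_eqI iffI)
    fix y assume "y \<in> (*v) B' ` box (\<Phi> l) (\<Phi> u)"
    then obtain x where "\<Phi> x \<in> box (\<Phi> l) (\<Phi> u)" "y = B' *v \<Phi> x" using surj\<Phi> by (metis imageE)
    then show "y \<in> (*v) A' -` box (\<Phi> l) (\<Phi> u)"
      by (simp add: B'_def A'_def comm inverse)
  next
    fix y assume y: "y \<in> (*v) A' -` box (\<Phi> l) (\<Phi> u)"
    obtain x where x: "y = \<Phi> x" using surj\<Phi> by blast
    have "y = B' *v (A' *v y)" by (simp add: x B'_def A'_def comm inverse)
    with y show "y \<in> (*v) B' ` box (\<Phi> l) (\<Phi> u)" by auto
  qed
  have "open ((*v) A' -` box (\<Phi> l) (\<Phi> u))"
    by (intro open_vimage open_box linear_continuous_on) auto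
  then have bor: "(*v) B' ` box (\<Phi> l) (\<Phi> u) \<in> sets borel"
    unfolding img by simp
  have "\<Phi> -` ((*v) B' ` box (\<Phi> l) (\<Phi> u)) = (*v) B ` box l u"
  proof (intro set_eqI iffI)
    fix x assume "x \<in> \<Phi> -` ((*v) B' ` box (\<Phi> l) (\<Phi> u))"
    then have "A *v x \<in> box l u"
      by (simp add: img A'_def comm) (simp flip: box)
    then show "x \<in> (*v) B ` box l u" using inverse(2)[of x] by (metis imageI)
  next
    fix x assume "x \<in> (*v) B ` box l u"
    then obtain z where "z \<in> box l u" "x = B *v z" by blast
    then show "x \<in> \<Phi> -` ((*v) B' ` box (\<Phi> l) (\<Phi> u))"
      by (simp add: img A'_def comm inverse) (simp flip: box)
  qed
  then have "emeasure lborel ((*v) B ` box l u) = emeasure lborel ((*v) B' ` box (\<Phi> l) (\<Phi> u))"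
    using vimg[OF bor] by simp
  also have "\<dots> = ennreal \<bar>det B'\<bar> * emeasure lborel (box (\<Phi> l) (\<Phi> u))"
    by (rule emeasure_linear_image_box_wellorder[OF bor])
  also have "emeasure lborel (box (\<Phi> l) (\<Phi> u)) = emeasure lborel (box l u)"
    using vimg[of "box (\<Phi> l) (\<Phi> u)"] by (simp add: box)
  also have "det B' = det B" unfolding B'_def by (rule det_reindex[OF s])
  finally show ?thesis .
qed

text \<open>Both sides agree on boxes, and \<open>A\<close> pulls a box back to its image under the inverse matrix.\<close>

lemma lborel_linear:
  fixes A :: "real^'d::finite^'d"
  assumes A: "invertible A"
  shows "lborel = density (distr lborel borel ((*v) A)) (\<lambda>_. ennreal \<bar>det A\<bar>)"
proof (rule lborel_eqI)
  fix l u :: "real^'d"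
  assume le: "\<And>b. b \<in> Basis \<Longrightarrow> l \<bullet> b \<le> u \<bullet> b"
  obtain B where AB: "A ** B = mat 1" and BA: "B ** A = mat 1"
    using A unfolding invertible_def by blast
  have inverse: "A *v (B *v x) = x" "B *v (A *v x) = x" for x
    by (simp_all add: matrix_vector_mul_assoc AB BA)
  have meas: "(*v) A \<in> borel_measurable borel"
    by (intro borel_measurable_continuous_onI linear_continuous_on) auto
  have "(*v) A -` box l u = (*v) B ` box l u"
  proof (intro set_eqI iffI)
    fix x assume "x \<in> (*v) A -` box l u"
    then have "B *v (A *v x) \<in> (*v) B ` box l u" by auto
    then show "x \<in> (*v) B ` box l u" by (simp add: inverse)
  qed (auto simp: inverse)
  then have "emeasure (density (distr lborel borel ((*v) A)) (\<lambda>_. ennreal \<bar>det A\<bar>)) (box l u) =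
      ennreal \<bar>det A\<bar> * emeasure lborel ((*v) B ` box l u)"
    using meas by (simp add: emeasure_density emeasure_distr nn_integral_cmult_indicator)
  also have "\<dots> = ennreal (\<bar>det A\<bar> * \<bar>det B\<bar>) * emeasure lborel (box l u)"
    unfolding emeasure_linear_image_box[OF AB BA] by (simp add: ennreal_mult mult.assoc)
  also have "\<bar>det A\<bar> * \<bar>det B\<bar> = 1"
    using arg_cong[OF AB, of det] by (simp add: det_mul flip: abs_mult)
  finally show "emeasure (density (distr lborel borel ((*v) A)) (\<lambda>_. ennreal \<bar>det A\<bar>)) (box l u) =
      (\<Prod>b\<in>Basis. (u - l) \<bullet> b)"
    using le by (simp add: emeasure_lborel_box_eq)
qed simp

theorem integral_linear_substitution:
  fixes A :: "real^'d::finite^'d" and h :: "real^'d \<Rightarrow> real"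
  assumes A: "invertible A" and h: "h \<in> borel_measurable borel"
  shows "integral\<^sup>L lborel h = \<bar>det A\<bar> * integral\<^sup>L lborel (\<lambda>x. h (A *v x))"
proof -
  have meas: "(*v) A \<in> borel_measurable borel"
    by (intro borel_measurable_continuous_onI linear_continuous_on) auto
  have "integral\<^sup>L lborel h = integral\<^sup>L (density (distr lborel borel ((*v) A)) (\<lambda>_. ennreal \<bar>det A\<bar>)) h"
    using lborel_linear[OF A] by simp
  also have "\<dots> = integral\<^sup>L (distr lborel borel ((*v) A)) (\<lambda>x. \<bar>det A\<bar> *\<^sub>R h x)"
    using h by (intro integral_density) auto
  also have "\<dots> = \<bar>det A\<bar> * integral\<^sup>L lborel (\<lambda>x. h (A *v x))"
    using h meas by (subst integral_distr) auto
  finally show ?thesis .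
qed

section \<open>Gaussian moments\<close>

lemma double_fact_minus_1 [simp]: "double_fact (-1) = 1"
proof -
  have "{i :: int. 1 \<le> i \<and> i \<le> -1 \<and> even (-1 - i)} = {}" by auto
  then show ?thesis unfolding double_fact_def by (simp only: prod.empty)
qed

lemma double_fact_odd: "real_of_int (double_fact (2 * int k - 1)) = fact (2 * k) / (2 ^ k * fact k)"
proof (induction k)
  case (Suc k)
  have eq: "{i :: int. 1 \<le> i \<and> i \<le> 2 * int (Suc k) - 1 \<and> even (2 * int (Suc k) - 1 - i)} =
      insert (2 * int k + 1) {i. 1 \<le> i \<and> i \<le> 2 * int k - 1 \<and> even (2 * int k - 1 - i)}"
    by (auto, presburger+)
  have "double_fact (2 * int (Suc k) - 1) = (2 * int k + 1) * double_fact (2 * int k - 1)"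
    unfolding double_fact_def eq
    by (subst prod.insert) (auto intro: finite_subset[of _ "{1..2 * int k - 1}"])
  moreover have "fact (2 * Suc k) / (2 ^ Suc k * fact (Suc k)) =
      ((2 * real k + 2) * ((2 * real k + 1) * fact (2 * k))) / ((2 * real k + 2) * (2 ^ k * fact k))"
    by (simp add: algebra_simps)
  moreover have "\<dots> = (2 * real k + 1) * (fact (2 * k) / (2 ^ k * fact k))"
    by (subst mult_divide_mult_cancel_left) auto
  ultimately show ?case using Suc by simp
qed simp

lemma gauss_moment_1:
  "has_bochner_integral lborel (\<lambda>x :: real. exp (- (x\<^sup>2 / 2)) * x ^ n)
    (sqrt (2 * pi) * (if even n then of_int (double_fact (int n - 1)) else 0))"
proof -
  have "has_bochner_integral lborel (\<lambda>x. std_normal_density x * x ^ n)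
      (if even n then of_int (double_fact (int n - 1)) else 0)"
  proof (cases "even n")
    case True
    then obtain k where "n = 2 * k" by (rule evenE)
    then show ?thesis using std_normal_moment_even[of k] double_fact_odd[of k] by simp
  next
    case False
    then obtain k where "n = 2 * k + 1" by (rule oddE)
    then show ?thesis using std_normal_moment_odd[of k] by simp
  qed
  from has_bochner_integral_mult_right[OF this, of "sqrt (2 * pi)"]
  show ?thesis by (simp add: std_normal_density_def)
qed

lemma integrable_prod_components:
  fixes h :: "'d::finite \<Rightarrow> real \<Rightarrow> real"
  assumes "\<And>i. integrable lborel (h i)"
  shows "integrable lborel (\<lambda>x :: real^'d. \<Prod>i\<in>UNIV. h i (x $ i))" (is ?I)
    and "integral\<^sup>L lborel (\<lambda>x :: real^'d. \<Prod>i\<in>UNIV. h i (x $ i)) = (\<Prod>i\<in>UNIV. integral\<^sup>L lborel (h i))" (is ?E)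
proof -
  interpret product_sigma_finite "\<lambda>_ :: real^'d. lborel :: real measure" by standard
  define k where "k b = h (THE i. b = axis i (1::real))" for b :: "real^'d"
  have k: "k (axis i 1) = h i" for i
    by (simp add: k_def axis_eq_axis)
  have int: "integrable lborel (k b)" for b unfolding k_def by (rule assms)
  have [measurable]: "h i \<in> borel_measurable borel" for i
    using assms[of i] by (simp add: integrable_iff_bounded)
  have [measurable]: "k b \<in> borel_measurable borel" for b
    using int[of b] by (simp add: integrable_iff_bounded)
  define T where "T = (\<lambda>f. \<Sum>b\<in>Basis. f b *\<^sub>R b :: real^'d)"
  have T[measurable]: "T \<in> (\<Pi>\<^sub>M b\<in>Basis. lborel) \<rightarrow>\<^sub>M borel" unfolding T_def by measurable
  have L: "(lborel :: (real^'d) measure) = distr (\<Pi>\<^sub>M b\<in>Basis. lborel) borel T"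
    unfolding T_def by (rule lborel_eq)
  have eq: "(\<Prod>i\<in>UNIV. h i (T f $ i)) = (\<Prod>b\<in>Basis. k b (f b))" for f
  proof -
    have "T f $ i = f (axis i 1)" for i
    proof -
      have "T f $ i = T f \<bullet> axis i 1" by (simp add: inner_axis)
      also have "\<dots> = f (axis i 1)"
        unfolding T_def by (rule inner_sum_left_Basis) (simp add: axis_in_Basis_iff)
      finally show ?thesis .
    qed
    then show ?thesis by (simp add: prod_Basis_vec k)
  qed
  have F: "(\<lambda>x :: real^'d. \<Prod>i\<in>UNIV. h i (x $ i)) \<in> borel_measurable borel" by measurable
  have "integrable (\<Pi>\<^sub>M b\<in>Basis. lborel) (\<lambda>f. \<Prod>b\<in>Basis. k b (f b))"
    by (rule product_integrable_prod) (simp_all add: int)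
  then have "integrable (distr (\<Pi>\<^sub>M b\<in>Basis. lborel) borel T) (\<lambda>x :: real^'d. \<Prod>i\<in>UNIV. h i (x $ i))"
    by (subst integrable_distr_eq[OF T F]) (simp add: eq)
  then show ?I unfolding L .
  have "integral\<^sup>L (distr (\<Pi>\<^sub>M b\<in>Basis. lborel) borel T) (\<lambda>x :: real^'d. \<Prod>i\<in>UNIV. h i (x $ i)) =
      integral\<^sup>L (\<Pi>\<^sub>M b\<in>(Basis :: (real^'d) set). lborel) (\<lambda>f. \<Prod>b\<in>Basis. k b (f b))"
    by (subst integral_distr[OF T F]) (simp add: eq)
  also have "\<dots> = (\<Prod>b\<in>(Basis :: (real^'d) set). integral\<^sup>L lborel (k b))"
    by (rule product_integral_prod) (simp_all add: int)
  also have "\<dots> = (\<Prod>i\<in>UNIV. integral\<^sup>L lborel (h i))"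
    by (simp add: prod_Basis_vec k)
  finally show ?E unfolding L .
qed

lemma gauss_prod: "exp (- ((norm z)\<^sup>2 / 2)) * monom_at z \<gamma> =
    (\<Prod>i\<in>UNIV. exp (- ((z $ i)\<^sup>2 / 2)) * (z $ i) ^ (\<gamma> $ i))" for z :: "real^'d::finite"
proof -
  have "(norm z)\<^sup>2 = (\<Sum>i\<in>UNIV. (z $ i)\<^sup>2)"
    by (simp add: norm_vec_def L2_set_def sum_nonneg)
  then have "exp (- ((norm z)\<^sup>2 / 2)) = (\<Prod>i\<in>UNIV. exp (- ((z $ i)\<^sup>2 / 2)))"
    by (simp add: exp_sum sum_divide_distrib flip: sum_negf)
  then show ?thesis by (simp add: monom_at_def prod.distrib)
qed

text \<open>The Gaussian and the monomial are products of functions of single coordinates, so the integral is a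
product of one-dimensional moments. These are \<open>(n - 1)!!\<close> for even \<open>n\<close> and \<open>0\<close> for odd \<open>n\<close>, up to
the factor \<open>sqrt (2 \<pi>)\<close>.\<close>

lemma gauss_moment:
  fixes \<gamma> :: "nat^'d::finite"
  shows "integrable lborel (\<lambda>z :: real^'d. exp (- ((norm z)\<^sup>2 / 2)) * monom_at z \<gamma>)"
    and "(\<integral>z. exp (- ((norm z)\<^sup>2 / 2)) * monom_at z \<gamma> \<partial>lborel) =
      (2 * pi) powr (real CARD('d) / 2) * gauss_weight \<gamma>"
proof -
  define m where "m i = (if even (\<gamma> $ i) then real_of_int (double_fact (int (\<gamma> $ i) - 1)) else 0)" for i
  have hbi: "has_bochner_integral lborel (\<lambda>x :: real. exp (- (x\<^sup>2 / 2)) * x ^ (\<gamma> $ i)) (sqrt (2 * pi) * m i)" for i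
    using gauss_moment_1[of "\<gamma> $ i"] by (simp add: m_def)
  then have int: "integrable lborel (\<lambda>x :: real. exp (- (x\<^sup>2 / 2)) * x ^ (\<gamma> $ i))" for i
    by (rule integrable.intros)
  show "integrable lborel (\<lambda>z :: real^'d. exp (- ((norm z)\<^sup>2 / 2)) * monom_at z \<gamma>)"
    unfolding gauss_prod by (rule integrable_prod_components(1)[OF int])
  have "(\<integral>z. exp (- ((norm z)\<^sup>2 / 2)) * monom_at z \<gamma> \<partial>lborel) =
      (\<Prod>i\<in>UNIV. \<integral>x. exp (- (x\<^sup>2 / 2)) * x ^ (\<gamma> $ i) \<partial>lborel)"
    unfolding gauss_prod by (rule integrable_prod_components(2)[OF int])
  also have "\<dots> = (\<Prod>i\<in>UNIV. sqrt (2 * pi) * m i)"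
    by (intro prod.cong refl has_bochner_integral_integral_eq hbi)
  also have "\<dots> = sqrt (2 * pi) ^ CARD('d) * (\<Prod>i\<in>UNIV. m i)"
    by (simp add: prod.distrib)
  also have "sqrt (2 * pi) ^ CARD('d) = (2 * pi) powr (real CARD('d) / 2)"
    by (simp add: powr_half_sqrt[symmetric] powr_powr flip: powr_realpow)
  also have "(\<Prod>i\<in>UNIV. m i) = gauss_weight \<gamma>"
  proof (cases "\<forall>i. even (\<gamma> $ i)")
    case True
    then show ?thesis
      by (simp add: gauss_weight_def even_indicator_def multi_double_fact_def m_def)
  next
    case False
    then obtain i where "odd (\<gamma> $ i)" by auto
    then have "m i = 0" by (simp add: m_def)
    then have "(\<Prod>i\<in>UNIV. m i) = 0" by (intro prod_zero) auto
    with False show ?thesis by (auto simp: gauss_weight_def even_indicator_def)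
  qed
  finally show "(\<integral>z. exp (- ((norm z)\<^sup>2 / 2)) * monom_at z \<gamma> \<partial>lborel) =
      (2 * pi) powr (real CARD('d) / 2) * gauss_weight \<gamma>" .
qed

lemma power_div_fact_le_exp:
  fixes x :: real
  assumes "0 \<le> x"
  shows "x ^ n / fact n \<le> exp x"
proof -
  have "(\<Sum>m\<in>{n}. x ^ m /\<^sub>R fact m) \<le> (\<Sum>m. x ^ m /\<^sub>R fact m)"
    using assms by (intro sum_le_suminf summable_exp_generic) auto
  then show ?thesis by (simp add: exp_def divide_inverse mult.commute)
qed

lemma polynomial_le_exp_square:
  fixes c :: real
  assumes "c > 0"
  shows "\<exists>C\<ge>0. \<forall>t\<ge>0. (1 + t) ^ K \<le> C * exp (c * t\<^sup>2)"
proof -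
  \<comment> \<open>The bound comes from \<open>(1 + t) ^ K \<le> 2 ^ K * (1 + t ^ (2 * K))\<close> and the \<open>K\<close>-th term of the exponential series.\<close>
  define C where "C = 2 ^ K * (1 + fact K / c ^ K)"
  have "(1 + t) ^ K \<le> C * exp (c * t\<^sup>2)" if t: "t \<ge> 0" for t :: real
  proof -
    have pos: "0 \<le> c * t\<^sup>2" using assms by simp
    have e1: "1 \<le> exp (c * t\<^sup>2)" using pos by simp
    have "(c * t\<^sup>2) ^ K / fact K \<le> exp (c * t\<^sup>2)"
      by (rule power_div_fact_le_exp[OF pos])
    then have "(t\<^sup>2) ^ K \<le> fact K / c ^ K * exp (c * t\<^sup>2)"
      using assms by (simp add: field_simps power_mult_distrib)
    moreover have "(1 + t) ^ K \<le> 2 ^ K * (1 + (t\<^sup>2) ^ K)"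
    proof (cases "t \<le> 1")
      case True
      have "(1 + t) ^ K \<le> 2 ^ K" using True t by (intro power_mono) auto
      also have "\<dots> \<le> 2 ^ K * (1 + (t\<^sup>2) ^ K)" by simp
      finally show ?thesis .
    next
      case False
      have "1 + t \<le> 2 * t\<^sup>2" 
        using False self_le_power[of t 2] by simp
      then have "(1 + t) ^ K \<le> (2 * t\<^sup>2) ^ K" using t by (intro power_mono) auto
      also have "\<dots> = 2 ^ K * (t\<^sup>2) ^ K" by (rule power_mult_distrib)
      also have "\<dots> \<le> 2 ^ K * (1 + (t\<^sup>2) ^ K)" by simp
      finally show ?thesis .
    qed
    ultimately have "(1 + t) ^ K \<le> 2 ^ K * (exp (c * t\<^sup>2) + fact K / c ^ K * exp (c * t\<^sup>2))"
      using e1 by (smt (verit) mult_left_mono zero_le_power)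
    then show ?thesis by (simp add: C_def algebra_simps)
  qed
  moreover have "C \<ge> 0" using assms by (simp add: C_def)
  ultimately show ?thesis by blast
qed

lemma integrable_gauss_scaled:
  assumes "c > 0"
  shows "integrable lborel (\<lambda>z :: real^'d::finite. exp (- (c * (norm z)\<^sup>2)))"
proof -
  have "integrable lborel (\<lambda>x :: real. exp (- (c * x\<^sup>2)))"
  proof -
    have "integrable lborel (normal_density 0 (sqrt (1 / (2 * c))))"
      using assms by simp
    then have "integrable lborel (\<lambda>x. sqrt (2 * pi * (1 / (2 * c))) * normal_density 0 (sqrt (1 / (2 * c))) x)"
      by (rule integrable_mult_right)
    then show ?thesis using assms by (simp add: normal_density_def mult.commute)
  qed
  from integrable_prod_components(1)[of "\<lambda>_ :: 'd. \<lambda>x. exp (- (c * x\<^sup>2))", OF this]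
  have "integrable lborel (\<lambda>z :: real^'d. \<Prod>i\<in>UNIV. exp (- (c * (z $ i)\<^sup>2)))" .
  moreover have "exp (- (c * (norm z)\<^sup>2)) = (\<Prod>i\<in>UNIV. exp (- (c * (z $ i)\<^sup>2)))" for z :: "real^'d"
  proof -
    have "(norm z)\<^sup>2 = (\<Sum>i\<in>UNIV. (z $ i)\<^sup>2)"
      by (simp add: norm_vec_def L2_set_def sum_nonneg)
    then show ?thesis
      by (simp add: exp_sum sum_distrib_left flip: sum_negf)
  qed
  ultimately show ?thesis by simp
qed

lemma integrable_polynomial_gauss:
  assumes "c > 0"
  shows "integrable lborel (\<lambda>z :: real^'d::finite. (1 + norm z) ^ K * exp (- (c * (norm z)\<^sup>2)))"
proof -
  obtain C where "C \<ge> 0" and C: "\<And>t. t \<ge> 0 \<Longrightarrow> (1 + t) ^ K \<le> C * exp (c / 2 * t\<^sup>2)"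
    using polynomial_le_exp_square[of "c / 2" K] assms by auto
  show ?thesis
  proof (rule Bochner_Integration.integrable_bound)
    show "integrable lborel (\<lambda>z :: real^'d. C * exp (- (c / 2 * (norm z)\<^sup>2)))"
      using assms by (intro integrable_mult_right integrable_gauss_scaled) simp
    show "AE z in lborel. norm ((1 + norm z) ^ K * exp (- (c * (norm z)\<^sup>2)))
        \<le> norm (C * exp (- (c / 2 * (norm (z :: real^'d))\<^sup>2)))"
    proof (rule AE_I2)
      fix z :: "real^'d"
      have "(1 + norm z) ^ K * exp (- (c * (norm z)\<^sup>2)) \<le>
          C * exp (c / 2 * (norm z)\<^sup>2) * exp (- (c * (norm z)\<^sup>2))"
        by (intro mult_right_mono C) auto
      also have "\<dots> = C * exp (- (c / 2 * (norm z)\<^sup>2))"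
        by (simp add: mult.assoc flip: exp_add)
      finally show "norm ((1 + norm z) ^ K * exp (- (c * (norm z)\<^sup>2)))
          \<le> norm (C * exp (- (c / 2 * (norm z)\<^sup>2)))"
        using \<open>C \<ge> 0\<close> by (simp add: abs_mult)
    qed
  qed measurable
qed

section \<open>Normal coordinates at a minimum\<close>

lemma dird_dird_eq_hessian:
  assumes "open U" "C_on (Suc (Suc m)) U f" "x \<in> U"
  shows "dird u (dird v f) x = u \<bullet> (hessian f x *v v)"
proof -
  have "partial i (dird v f) x = (\<Sum>j\<in>UNIV. v $ j * partial i (partial j f) x)" for i
    unfolding dird_def[abs_def]
    by (rule partial_sum[OF assms(1) C_on_partial[OF assms(2)] assms(3)])
  then show ?thesis
    by (simp add: dird_def inner_vec_def matrix_vector_mult_def hessian_def mult.commute)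
qed

lemma hessian_symmetric:
  assumes "open U" "C_on (Suc (Suc m)) U f" "x \<in> U"
  shows "u \<bullet> (hessian f x *v v) = v \<bullet> (hessian f x *v u)"
proof -
  have "u \<bullet> (hessian f x *v v) = (\<Sum>i\<in>UNIV. \<Sum>j\<in>UNIV. u $ i * (hessian f x $ i $ j * v $ j))"
    by (simp add: inner_vec_def matrix_vector_mult_def sum_distrib_left)
  also have "\<dots> = (\<Sum>j\<in>UNIV. \<Sum>i\<in>UNIV. u $ i * (hessian f x $ i $ j * v $ j))"
    by (rule sum.swap)
  also have "\<dots> = (\<Sum>j\<in>UNIV. \<Sum>i\<in>UNIV. v $ j * (hessian f x $ j $ i * u $ i))"
    using partial_commute[OF assms] by (intro sum.cong refl) (simp add: hessian_def)
  also have "\<dots> = v \<bullet> (hessian f x *v u)"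
    by (simp add: inner_vec_def matrix_vector_mult_def sum_distrib_left)
  finally show ?thesis .
qed

lemma partial_zero_at_minimum:
  assumes U: "open U" "x \<in> U" and C: "C_on (Suc m) U f" and min: "\<And>y. y \<in> U \<Longrightarrow> f x \<le> f y"
  shows "partial i f x = 0"
proof -
  obtain r where r: "r > 0" "ball x r \<subseteq> U" using U openE by blast
  have "f (x + 0 *\<^sub>R axis i 1) \<le> f (x + t *\<^sub>R axis i 1)" if "\<bar>0 - t\<bar> < r" for t
  proof -
    have "x + t *\<^sub>R axis i 1 \<in> ball x r" using that by (simp add: dist_norm)
    then show ?thesis using min r by auto
  qed
  then show ?thesis
    using DERIV_local_min[OF has_partial_0[OF C U(2), of i] r(1)] by blast
qed

lemma taylor_at_critical_point:
  fixes f :: "real^'d::finite \<Rightarrow> real"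
  assumes U: "open U" and C: "C_on 3 U f" and r: "cball 0 r \<subseteq> U" "0 \<le> r"
    and f0: "f 0 = 0" and grad: "\<And>i. partial i f 0 = 0"
  shows "\<exists>B\<ge>0. \<forall>y\<in>cball 0 r. \<bar>f y - y \<bullet> (hessian f 0 *v y) / 2\<bar> \<le> B * norm y ^ 3"
proof -
  have U0: "0 \<in> U" using r by auto
  have eq: "(\<Sum>n<3. (dird y ^^ n) f 0 / fact n) = y \<bullet> (hessian f 0 *v y) / 2" for y
  proof -
    have "dird y f 0 = 0" by (simp add: dird_def grad)
    moreover have "dird y (dird y f) 0 = y \<bullet> (hessian f 0 *v y)"
      by (rule dird_dird_eq_hessian[OF U _ U0, of 1]) (use C in \<open>simp only: numeral_3_eq_3 One_nat_def\<close>)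
    ultimately show ?thesis by (simp add: numeral_3_eq_3 f0)
  qed
  show ?thesis using multivariate_taylor[OF U C _ r(1)] unfolding eq by simp
qed

text \<open>Along a direction with \<open>v \<bullet> H v < 0\<close> the quadratic term of Taylor's formula would beat the cubic
remainder and make \<open>f\<close> negative close to \<open>0\<close>.\<close>

lemma hessian_nonneg_at_minimum:
  fixes f :: "real^'d::finite \<Rightarrow> real"
  assumes U: "open U" "0 \<in> U" and C: "C_on 3 U f" and f0: "f 0 = 0"
    and min: "\<And>y. y \<in> U \<Longrightarrow> 0 \<le> f y"
  shows "0 \<le> v \<bullet> (hessian f 0 *v v)"
proof (rule ccontr)
  define q where "q = v \<bullet> (hessian f 0 *v v)"
  assume "\<not> 0 \<le> v \<bullet> (hessian f 0 *v v)"
  then have q: "q < 0" by (simp add: q_def)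
  obtain r where r: "r > 0" "cball 0 r \<subseteq> U" using U open_contains_cball by blast
  have "partial i f 0 = 0" for i
    by (rule partial_zero_at_minimum[OF U, of 2]) (use C f0 min in \<open>simp_all only: numeral_3_eq_3 numeral_2_eq_2\<close>)
  then obtain B where B: "B \<ge> 0"
    "\<And>y. y \<in> cball 0 r \<Longrightarrow> \<bar>f y - y \<bullet> (hessian f 0 *v y) / 2\<bar> \<le> B * norm y ^ 3"
    using taylor_at_critical_point[OF U(1) C r(2) _ f0] r by auto
  \<comment> \<open>The step \<open>t\<close> keeps \<open>t v\<close> in the ball and makes the cubic remainder at most half as large as the quadratic term.\<close>
  define w where "w = 1 + norm v"
  have w: "w > 0" "norm v \<le> w" by (auto simp: w_def add_pos_nonneg)
  define t where "t = min (r / w) (- q / (4 * (B + 1) * w ^ 3))"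
  have "0 < - q / (4 * (B + 1) * w ^ 3)" using w q B(1) by (intro divide_pos_pos) auto
  then have t: "t > 0" "t \<le> r / w" "t \<le> - q / (4 * (B + 1) * w ^ 3)"
    using r(1) w by (auto simp: t_def)
  have "t * norm v \<le> t * w" using t w by simp
  also have "\<dots> \<le> r" using t w by (simp add: field_simps)
  finally have tv: "t *\<^sub>R v \<in> cball 0 r" using t by simp
  then have "0 \<le> f (t *\<^sub>R v)" using min r(2) by blast
  moreover have "t *\<^sub>R v \<bullet> (hessian f 0 *v (t *\<^sub>R v)) = t\<^sup>2 * q"
    by (simp add: q_def matrix_vector_mult_scaleR power2_eq_square)
  ultimately have "\<bar>f (t *\<^sub>R v) - t\<^sup>2 * q / 2\<bar> \<le> B * (t * norm v) ^ 3" and "0 \<le> f (t *\<^sub>R v)"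
    using B(2)[OF tv] t(1) by auto
  then have "- (t\<^sup>2 * q / 2) \<le> B * (t * norm v) ^ 3" by linarith
  also have "\<dots> \<le> (B + 1) * (t * w) ^ 3"
    using B(1) t w by (intro mult_mono power_mono) auto
  also have "\<dots> = t\<^sup>2 * (t * ((B + 1) * w ^ 3))"
    by (simp add: power_mult_distrib power2_eq_square power3_eq_cube)
  also have "\<dots> \<le> t\<^sup>2 * (- q / 4)"
  proof (rule mult_left_mono)
    have "0 < (B + 1) * w ^ 3" using B(1) w by simp
    then show "t * ((B + 1) * w ^ 3) \<le> - q / 4"
      using t(3) by (simp add: field_simps)
  qed simp
  finally have "t\<^sup>2 * (- q / 2) \<le> t\<^sup>2 * (- q / 4)" by simp
  then show False using t(1) q by simp
qed

text \<open>If \<open>v \<bullet> H v = 0\<close>, then \<open>v\<close> minimises the quadratic form, so the form has zero derivative there;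
this derivative is \<open>2 H v\<close>, and \<open>H\<close> is injective.\<close>

lemma psd_invertible_imp_pd:
  fixes H :: "real^'d::finite^'d"
  assumes sym: "\<And>u v. u \<bullet> (H *v v) = v \<bullet> (H *v u)" and nonneg: "\<And>v. 0 \<le> v \<bullet> (H *v v)"
    and inv: "invertible H" and v: "v \<noteq> 0"
  shows "0 < v \<bullet> (H *v v)"
proof (rule ccontr)
  assume "\<not> 0 < v \<bullet> (H *v v)"
  then have q0: "v \<bullet> (H *v v) = 0" using nonneg[of v] by simp
  define u where "u = H *v v"
  define b where "b = u \<bullet> (H *v u)"
  have b: "b \<ge> 0" unfolding b_def by (rule nonneg)
  have "v \<bullet> (H *v u) = u \<bullet> u" using sym[of v u] by (simp add: u_def)
  then have "0 \<le> - 2 * t * (u \<bullet> u) + t\<^sup>2 * b" for t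
    using nonneg[of "v - t *\<^sub>R u"] q0
    by (simp add: u_def[symmetric] b_def matrix_vector_mult_diff_distrib matrix_vector_mult_scaleR
        inner_diff_left inner_diff_right power2_eq_square algebra_simps inner_commute)
  \<comment> \<open>The minimum over \<open>t\<close> is at \<open>(u \<bullet> u) / b\<close>; the summand \<open>1\<close> covers the case \<open>b = 0\<close>.\<close>
  from this[of "(u \<bullet> u) / (1 + b)"] have "2 * (u \<bullet> u)\<^sup>2 / (1 + b) \<le> (u \<bullet> u)\<^sup>2 * (b / (1 + b)\<^sup>2)"
    by (simp add: power2_eq_square power_divide)
  also have "\<dots> \<le> (u \<bullet> u)\<^sup>2 * (1 / (1 + b))"
  proof (rule mult_left_mono)
    have "b / (1 + b)\<^sup>2 = b / (1 + b) * (1 / (1 + b))" by (simp add: power2_eq_square)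
    also have "\<dots> \<le> 1 * (1 / (1 + b))" using b by (intro mult_right_mono) auto
    finally show "b / (1 + b)\<^sup>2 \<le> 1 / (1 + b)" by simp
  qed simp
  finally have "(u \<bullet> u)\<^sup>2 / (1 + b) \<le> 0" by (simp add: field_simps)
  then have "u \<bullet> u = 0" using b by (simp add: divide_le_0_iff)
  then have "H *v v = 0" by (simp add: u_def)
  then show False using inv v by (metis invertible_def matrix_vector_mul_assoc matrix_vector_mul_lid matrix_vector_mult_0_right)
qed

text \<open>Gram-Schmidt for the inner product \<open>u \<bullet> H v\<close>: while there are fewer vectors than dimensions, some
nonzero \<open>x\<close> is orthogonal to all \<open>H w\<^sub>j\<close>, and it can be normalised.\<close>

lemma orthonormal_family_exists:
  fixes H :: "real^'d::finite^'d"
  assumes sym: "\<And>u v. u \<bullet> (H *v v) = v \<bullet> (H *v u)" and pd: "\<And>v. v \<noteq> 0 \<Longrightarrow> 0 < v \<bullet> (H *v v)"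
  shows "n \<le> CARD('d) \<Longrightarrow> \<exists>w :: nat \<Rightarrow> real^'d. \<forall>i<n. \<forall>j<n. w i \<bullet> (H *v w j) = (if i = j then 1 else 0)"
proof (induction n)
  case (Suc n)
  then obtain w :: "nat \<Rightarrow> real^'d"
    where w: "\<And>i j. i < n \<Longrightarrow> j < n \<Longrightarrow> w i \<bullet> (H *v w j) = (if i = j then 1 else 0)"
    by auto
  define S where "S = (\<lambda>j. H *v w j) ` {..<n}"
  have "dim S \<le> card S" by (rule dim_le_card') (simp add: S_def)
  also have "\<dots> \<le> n" unfolding S_def using card_image_le[of "{..<n}"] by simp
  finally have "dim S < DIM(real^'d)" using Suc.prems by simp
  then obtain x where x: "x \<noteq> 0" "\<And>y. y \<in> span S \<Longrightarrow> orthogonal x y"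
    using orthogonal_to_subspace_exists by blast
  define q where "q = sqrt (x \<bullet> (H *v x))"
  have q: "q > 0" "q * q = x \<bullet> (H *v x)" using pd[OF x(1)] by (auto simp: q_def)
  have orth: "x \<bullet> (H *v w j) = 0" if "j < n" for j
    using x(2)[of "H *v w j"] that by (auto simp: S_def orthogonal_def intro: span_base)
  define w' where "w' = w(n := (1 / q) *\<^sub>R x)"
  have "w' i \<bullet> (H *v w' j) = (if i = j then 1 else 0)" if "i < Suc n" "j < Suc n" for i j
  proof (cases "i = n \<or> j = n")
    case False
    then show ?thesis using that w by (auto simp: w'_def)
  next
    case True
    have "w j \<bullet> (H *v x) = 0" if "j < n" for j using orth[OF that] sym by metis
    with True show ?thesis
      using that orth q by (auto simp: w'_def matrix_vector_mult_scaleR simp flip: q(2))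
  qed
  then show ?case by blast
qed auto

text \<open>The columns of \<open>A\<close> are an orthonormal basis for the inner product \<open>u \<bullet> H v\<close>, which says
\<open>A\<^sup>T H A = 1\<close>. Taking determinants gives \<open>(det A)\<^sup>2 det H = 1\<close>.\<close>

lemma congruent_to_identity:
  fixes H :: "real^'d::finite^'d"
  assumes sym: "\<And>u v. u \<bullet> (H *v v) = v \<bullet> (H *v u)" and pd: "\<And>v. v \<noteq> 0 \<Longrightarrow> 0 < v \<bullet> (H *v v)"
  obtains A :: "real^'d^'d" where "invertible A" "0 < det H" "\<bar>det A\<bar> = 1 / sqrt (det H)"
    "\<And>i j. (A *v axis i 1) \<bullet> (H *v (A *v axis j 1)) = (if i = j then 1 else 0)"
proof -
  obtain w :: "nat \<Rightarrow> real^'d"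
    where w: "\<And>i j. i < CARD('d) \<Longrightarrow> j < CARD('d) \<Longrightarrow> w i \<bullet> (H *v w j) = (if i = j then 1 else 0)"
    using orthonormal_family_exists[OF assms, of "CARD('d)"] by auto
  obtain e :: "'d \<Rightarrow> nat" where e: "bij_betw e UNIV {..<CARD('d)}"
    using ex_bij_betw_finite_nat[of "UNIV :: 'd set"] by (auto simp: atLeast0LessThan)
  define A where "A = (\<chi> i j. w (e j) $ i)"
  have col: "A *v axis j 1 = w (e j)" for j
    by (simp add: A_def matrix_vector_mult_def vec_eq_iff axis_def if_distrib cong: if_cong)
  have e_less: "e i < CARD('d)" for i using e by (auto simp: bij_betw_def)
  have e_inj: "e i = e j \<longleftrightarrow> i = j" for i j using e by (auto simp: bij_betw_def inj_on_def)
  have orth: "(A *v axis i 1) \<bullet> (H *v (A *v axis j 1)) = (if i = j then 1 else 0)" for i j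
    using w[OF e_less e_less] by (simp add: col e_inj)
  have "transpose A ** (H ** A) = mat 1"
  proof -
    have "(transpose A ** (H ** A)) $ i $ j = (A *v axis i 1) \<bullet> (H *v (A *v axis j 1))" for i j
    proof -
      have "(transpose A ** (H ** A)) $ i $ j = (transpose A *v ((H ** A) *v axis j 1)) $ i"
        by (simp add: matrix_vector_mul_assoc) (simp add: matrix_vector_mult_def axis_def if_distrib cong: if_cong)
      also have "\<dots> = axis i 1 \<bullet> (transpose A *v ((H ** A) *v axis j 1))"
        by (simp add: inner_axis')
      also have "\<dots> = (A *v axis i 1) \<bullet> ((H ** A) *v axis j 1)"
        by (metis dot_lmul_matrix transpose_matrix_vector inner_commute transpose_transpose)
      finally show ?thesis by (simp add: matrix_vector_mul_assoc)
    qed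
    then show ?thesis by (simp add: vec_eq_iff mat_def orth)
  qed
  then have "det A * (det H * det A) = 1"
    using arg_cong[of _ _ det] by (metis det_I det_mul det_transpose)
  then have 1: "(det A)\<^sup>2 * det H = 1" by (simp add: power2_eq_square mult_ac)
  have A0: "det A \<noteq> 0" using 1 by auto
  then have H: "0 < det H" using 1 zero_less_mult_pos[of "(det A)\<^sup>2" "det H"] by simp
  have "sqrt ((det A)\<^sup>2 * det H) = 1" by (simp add: 1)
  then have "\<bar>det A\<bar> = 1 / sqrt (det H)" using H by (simp add: real_sqrt_mult field_simps)
  with H orth A0 show thesis by (intro that[of A]) (auto simp: invertible_det_nz)
qed

lemma hessian_compose_linear:
  assumes U: "open U" and C: "C_on (Suc (Suc m)) U f" and x: "A *v x \<in> U"
  shows "hessian (f \<circ> (*v) A) x $ i $ j = (A *v axis i 1) \<bullet> (hessian f (A *v x) *v (A *v axis j 1))"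
proof -
  define V where "V = (*v) A -` U"
  have V: "open V" unfolding V_def by (intro open_vimage U linear_continuous_on) auto
  have "partial i (partial j (f \<circ> (*v) A)) x = partial i (dird (A *v axis j 1) f \<circ> (*v) A) x"
  proof (rule partial_cong[OF V])
    show "x \<in> V" using x by (simp add: V_def)
    show "partial j (f \<circ> (*v) A) y = (dird (A *v axis j 1) f \<circ> (*v) A) y" if "y \<in> V" for y
      using partial_compose_linear[OF U C, of "(*v) A" y j] that by (simp add: V_def)
  qed
  also have "\<dots> = dird (A *v axis i 1) (dird (A *v axis j 1) f) (A *v x)"
    by (rule partial_compose_linear[OF U C_on_dird[OF U C], where A = "(*v) A"]) (use x in simp_all)
  also have "\<dots> = (A *v axis i 1) \<bullet> (hessian f (A *v x) *v (A *v axis j 1))"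
    by (rule dird_dird_eq_hessian[OF U C x])
  finally show ?thesis by (simp add: hessian_def)
qed

text \<open>The chain rule turns the Hessian into \<open>A\<^sup>T H A\<close>, so the congruence above normalises it.\<close>

theorem normal_coordinates:
  fixes f :: "real^'d::finite \<Rightarrow> real"
  assumes U: "open U" "0 \<in> U" and C: "C_on 3 U f" and f0: "f 0 = 0"
    and min: "\<And>y. y \<in> U \<Longrightarrow> 0 \<le> f y" and inv: "invertible (hessian f 0)"
  obtains A :: "real^'d^'d" where "invertible A" "0 < det (hessian f 0)"
    "\<bar>det A\<bar> = 1 / sqrt (det (hessian f 0))" "hessian (f \<circ> (*v) A) 0 = mat 1"
proof -
  have C': "C_on (Suc (Suc 1)) U f" using C by (simp only: numeral_3_eq_3 One_nat_def)
  note sym = hessian_symmetric[OF U(1) C' U(2)]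
  have pd: "0 < v \<bullet> (hessian f 0 *v v)" if "v \<noteq> 0" for v
    by (rule psd_invertible_imp_pd[OF sym hessian_nonneg_at_minimum[OF U C f0 min] inv that])
  obtain A :: "real^'d^'d" where A: "invertible A" "0 < det (hessian f 0)"
    "\<bar>det A\<bar> = 1 / sqrt (det (hessian f 0))"
    "\<And>i j. (A *v axis i 1) \<bullet> (hessian f 0 *v (A *v axis j 1)) = (if i = j then 1 else 0)"
    using congruent_to_identity[OF sym pd] by blast
  have "hessian (f \<circ> (*v) A) 0 = mat 1"
    using hessian_compose_linear[OF U(1) C', of A 0] U(2) by (simp add: vec_eq_iff mat_def A(4))
  with A show thesis by (intro that)
qed

section \<open>Expansions in powers of a small parameter\<close>

text \<open>Functions of the small parameter \<open>\<epsilon>\<close> and the rescaled variable \<open>z\<close> that grow at most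
polynomially in \<open>z\<close>, uniformly in \<open>\<epsilon>\<close>. The condition \<open>\<epsilon> |z| \<le> \<delta>\<close> says that the
original variable \<open>y = \<epsilon> z\<close> stays in the neighbourhood of \<open>0\<close> where the Taylor estimates hold.
These functions form a ring, which makes the bookkeeping of remainders automatic.\<close>

definition tame :: "real \<Rightarrow> (real \<Rightarrow> real^'d::finite \<Rightarrow> real) \<Rightarrow> bool" where
  "tame \<delta> F \<longleftrightarrow> (\<exists>C\<ge>0. \<exists>K. \<forall>\<epsilon> z. 0 < \<epsilon> \<longrightarrow> \<epsilon> \<le> 1 \<longrightarrow> \<epsilon> * norm z \<le> \<delta> \<longrightarrow>
     \<bar>F \<epsilon> z\<bar> \<le> C * (1 + norm z) ^ K)"

lemma tameI:
  assumes "\<And>\<epsilon> z. 0 < \<epsilon> \<Longrightarrow> \<epsilon> \<le> 1 \<Longrightarrow> \<epsilon> * norm z \<le> \<delta> \<Longrightarrow> \<bar>F \<epsilon> z\<bar> \<le> C * (1 + norm z) ^ K" "C \<ge> 0"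
  shows "tame \<delta> F"
  using assms unfolding tame_def by blast

lemma tameE:
  assumes "tame \<delta> F"
  obtains C K where "C \<ge> 0"
    "\<And>\<epsilon> z. 0 < \<epsilon> \<Longrightarrow> \<epsilon> \<le> 1 \<Longrightarrow> \<epsilon> * norm z \<le> \<delta> \<Longrightarrow> \<bar>F \<epsilon> z\<bar> \<le> C * (1 + norm z) ^ K"
  using assms unfolding tame_def by blast

lemma tame_const: "tame \<delta> (\<lambda>\<epsilon> z. c)"
  by (rule tameI[where C = "\<bar>c\<bar>" and K = 0]) auto

lemma tame_eps: "tame \<delta> (\<lambda>\<epsilon> z. \<epsilon>)"
  by (rule tameI[where C = 1 and K = 0]) auto

lemma tame_component: "tame \<delta> (\<lambda>\<epsilon> z. z $ i)"
proof (rule tameI[where C = 1 and K = 1])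
  show "\<bar>z $ i\<bar> \<le> 1 * (1 + norm z) ^ 1" for z
    using component_le_norm_cart[of z i] by simp
qed simp

lemma tame_add:
  assumes "tame \<delta> F" "tame \<delta> G"
  shows "tame \<delta> (\<lambda>\<epsilon> z. F \<epsilon> z + G \<epsilon> z)"
proof -
  obtain C K where F: "C \<ge> 0"
    "\<And>\<epsilon> z. 0 < \<epsilon> \<Longrightarrow> \<epsilon> \<le> 1 \<Longrightarrow> \<epsilon> * norm z \<le> \<delta> \<Longrightarrow> \<bar>F \<epsilon> z\<bar> \<le> C * (1 + norm z) ^ K"
    using assms(1) unfolding tame_def by blast
  obtain D L where G: "D \<ge> 0"
    "\<And>\<epsilon> z. 0 < \<epsilon> \<Longrightarrow> \<epsilon> \<le> 1 \<Longrightarrow> \<epsilon> * norm z \<le> \<delta> \<Longrightarrow> \<bar>G \<epsilon> z\<bar> \<le> D * (1 + norm z) ^ L"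
    using assms(2) unfolding tame_def by blast
  show ?thesis
  proof (rule tameI[where C = "C + D" and K = "max K L"])
    fix \<epsilon> and z :: "real^'a" assume dom: "0 < \<epsilon>" "\<epsilon> \<le> 1" "\<epsilon> * norm z \<le> \<delta>"
    have "(1 + norm z) ^ K \<le> (1 + norm z) ^ max K L" "(1 + norm z) ^ L \<le> (1 + norm z) ^ max K L"
      by (intro power_increasing; simp)+
    then have "C * (1 + norm z) ^ K \<le> C * (1 + norm z) ^ max K L"
      "D * (1 + norm z) ^ L \<le> D * (1 + norm z) ^ max K L"
      using F(1) G(1) by (auto intro: mult_left_mono)
    then show "\<bar>F \<epsilon> z + G \<epsilon> z\<bar> \<le> (C + D) * (1 + norm z) ^ max K L"
      using F(2)[OF dom] G(2)[OF dom] by (simp add: distrib_right)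
  qed (use F G in auto)
qed

lemma tame_mult:
  assumes "tame \<delta> F" "tame \<delta> G"
  shows "tame \<delta> (\<lambda>\<epsilon> z. F \<epsilon> z * G \<epsilon> z)"
proof -
  obtain C K where F: "C \<ge> 0"
    "\<And>\<epsilon> z. 0 < \<epsilon> \<Longrightarrow> \<epsilon> \<le> 1 \<Longrightarrow> \<epsilon> * norm z \<le> \<delta> \<Longrightarrow> \<bar>F \<epsilon> z\<bar> \<le> C * (1 + norm z) ^ K"
    using assms(1) unfolding tame_def by blast
  obtain D L where G: "D \<ge> 0"
    "\<And>\<epsilon> z. 0 < \<epsilon> \<Longrightarrow> \<epsilon> \<le> 1 \<Longrightarrow> \<epsilon> * norm z \<le> \<delta> \<Longrightarrow> \<bar>G \<epsilon> z\<bar> \<le> D * (1 + norm z) ^ L"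
    using assms(2) unfolding tame_def by blast
  show ?thesis
  proof (rule tameI[where C = "C * D" and K = "K + L"])
    fix \<epsilon> and z :: "real^'a" assume dom: "0 < \<epsilon>" "\<epsilon> \<le> 1" "\<epsilon> * norm z \<le> \<delta>"
    have "\<bar>F \<epsilon> z\<bar> * \<bar>G \<epsilon> z\<bar> \<le> (C * (1 + norm z) ^ K) * (D * (1 + norm z) ^ L)"
      using F(1) by (intro mult_mono F(2) G(2) dom) auto
    then show "\<bar>F \<epsilon> z * G \<epsilon> z\<bar> \<le> (C * D) * (1 + norm z) ^ (K + L)"
      by (simp add: abs_mult power_add mult_ac)
  qed (use F G in auto)
qed

lemma tame_sum: "(\<And>i. i \<in> I \<Longrightarrow> tame \<delta> (F i)) \<Longrightarrow> tame \<delta> (\<lambda>\<epsilon> z. \<Sum>i\<in>I. F i \<epsilon> z)"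
  by (induction I rule: infinite_finite_induct) (auto intro: tame_const tame_add)

lemma tame_prod: "(\<And>i. i \<in> I \<Longrightarrow> tame \<delta> (F i)) \<Longrightarrow> tame \<delta> (\<lambda>\<epsilon> z. \<Prod>i\<in>I. F i \<epsilon> z)"
  by (induction I rule: infinite_finite_induct) (auto intro: tame_const tame_mult)

lemma tame_power: "tame \<delta> F \<Longrightarrow> tame \<delta> (\<lambda>\<epsilon> z. F \<epsilon> z ^ n)"
  by (induction n) (auto intro: tame_const tame_mult)

lemmas tame_intros = tame_const tame_eps tame_component tame_add tame_mult tame_sum tame_prod tame_power

text \<open>Every \<open>z\<close> lies in the domain for a sufficiently small \<open>\<epsilon>\<close>.\<close>

lemma tame_independent:
  assumes "tame \<delta> (\<lambda>_. c)" "\<delta> > 0"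
  shows "\<exists>C\<ge>0. \<exists>K. \<forall>z. \<bar>c z\<bar> \<le> C * (1 + norm z) ^ K"
proof -
  obtain C K where F: "C \<ge> 0"
    "\<And>\<epsilon> z. 0 < \<epsilon> \<Longrightarrow> \<epsilon> \<le> 1 \<Longrightarrow> \<epsilon> * norm z \<le> \<delta> \<Longrightarrow> \<bar>c z\<bar> \<le> C * (1 + norm z) ^ K"
    using assms(1) unfolding tame_def by blast
  have "\<bar>c z\<bar> \<le> C * (1 + norm z) ^ K" for z
  proof (rule F(2)[of "min 1 (\<delta> / (1 + norm z))"])
    have "1 + norm z > 0" by (simp add: add_pos_nonneg)
    then show "0 < min 1 (\<delta> / (1 + norm z))" using assms(2) by simp
    have "min 1 (\<delta> / (1 + norm z)) * norm z \<le> \<delta> / (1 + norm z) * norm z"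
      by (intro mult_right_mono) auto
    also have "\<dots> \<le> \<delta> / (1 + norm z) * (1 + norm z)"
      using assms(2) by (intro mult_left_mono) auto
    also have "\<dots> = \<delta>" using \<open>1 + norm z > 0\<close> by simp
    finally show "min 1 (\<delta> / (1 + norm z)) * norm z \<le> \<delta>" .
  qed simp
  then show ?thesis using F(1) by blast
qed

text \<open>Congruence modulo \<open>\<epsilon>\<^sup>N\<close> in the ring of tame functions.\<close>

definition cong_eps ::
    "nat \<Rightarrow> real \<Rightarrow> (real \<Rightarrow> real^'d::finite \<Rightarrow> real) \<Rightarrow> (real \<Rightarrow> real^'d \<Rightarrow> real) \<Rightarrow> bool" where
  "cong_eps N \<delta> F G \<longleftrightarrow> (\<exists>H. tame \<delta> H \<and>
     (\<forall>\<epsilon> z. 0 < \<epsilon> \<longrightarrow> \<epsilon> \<le> 1 \<longrightarrow> \<epsilon> * norm z \<le> \<delta> \<longrightarrow> F \<epsilon> z = G \<epsilon> z + \<epsilon> ^ N * H \<epsilon> z))"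

lemma cong_epsI:
  assumes "tame \<delta> H"
    "\<And>\<epsilon> z. 0 < \<epsilon> \<Longrightarrow> \<epsilon> \<le> 1 \<Longrightarrow> \<epsilon> * norm z \<le> \<delta> \<Longrightarrow> F \<epsilon> z = G \<epsilon> z + \<epsilon> ^ N * H \<epsilon> z"
  shows "cong_eps N \<delta> F G"
  using assms unfolding cong_eps_def by blast

lemma cong_epsE:
  assumes "cong_eps N \<delta> F G"
  obtains H where "tame \<delta> H"
    "\<And>\<epsilon> z. 0 < \<epsilon> \<Longrightarrow> \<epsilon> \<le> 1 \<Longrightarrow> \<epsilon> * norm z \<le> \<delta> \<Longrightarrow> F \<epsilon> z = G \<epsilon> z + \<epsilon> ^ N * H \<epsilon> z"
  using assms unfolding cong_eps_def by blast

lemma cong_eps_refl: "cong_eps N \<delta> F F"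
  by (rule cong_epsI[OF tame_const[of _ 0]]) simp

lemma cong_eps_trans:
  assumes "cong_eps N \<delta> F G" "cong_eps N \<delta> G H"
  shows "cong_eps N \<delta> F H"
proof -
  obtain A where A: "tame \<delta> A"
    "\<And>\<epsilon> z. 0 < \<epsilon> \<Longrightarrow> \<epsilon> \<le> 1 \<Longrightarrow> \<epsilon> * norm z \<le> \<delta> \<Longrightarrow> F \<epsilon> z = G \<epsilon> z + \<epsilon> ^ N * A \<epsilon> z"
    using assms(1) unfolding cong_eps_def by blast
  obtain B where B: "tame \<delta> B"
    "\<And>\<epsilon> z. 0 < \<epsilon> \<Longrightarrow> \<epsilon> \<le> 1 \<Longrightarrow> \<epsilon> * norm z \<le> \<delta> \<Longrightarrow> G \<epsilon> z = H \<epsilon> z + \<epsilon> ^ N * B \<epsilon> z"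
    using assms(2) unfolding cong_eps_def by blast
  show ?thesis
    by (rule cong_epsI[OF tame_add[OF A(1) B(1)]]) (simp add: A(2) B(2) algebra_simps)
qed

lemma cong_eps_tame:
  assumes "cong_eps N \<delta> F G" "tame \<delta> G"
  shows "tame \<delta> F"
proof -
  obtain A where A: "tame \<delta> A"
    "\<And>\<epsilon> z. 0 < \<epsilon> \<Longrightarrow> \<epsilon> \<le> 1 \<Longrightarrow> \<epsilon> * norm z \<le> \<delta> \<Longrightarrow> F \<epsilon> z = G \<epsilon> z + \<epsilon> ^ N * A \<epsilon> z"
    using assms(1) unfolding cong_eps_def by blast
  have "tame \<delta> (\<lambda>\<epsilon> z. G \<epsilon> z + \<epsilon> ^ N * A \<epsilon> z)" by (intro tame_intros A assms)
  then show ?thesis by (rule tameE) (rule tameI, simp add: A(2))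
qed

lemma cong_eps_add:
  assumes "cong_eps N \<delta> F F'" "cong_eps N \<delta> G G'"
  shows "cong_eps N \<delta> (\<lambda>\<epsilon> z. F \<epsilon> z + G \<epsilon> z) (\<lambda>\<epsilon> z. F' \<epsilon> z + G' \<epsilon> z)"
proof -
  obtain A where A: "tame \<delta> A"
    "\<And>\<epsilon> z. 0 < \<epsilon> \<Longrightarrow> \<epsilon> \<le> 1 \<Longrightarrow> \<epsilon> * norm z \<le> \<delta> \<Longrightarrow> F \<epsilon> z = F' \<epsilon> z + \<epsilon> ^ N * A \<epsilon> z"
    using assms(1) unfolding cong_eps_def by blast
  obtain B where B: "tame \<delta> B"
    "\<And>\<epsilon> z. 0 < \<epsilon> \<Longrightarrow> \<epsilon> \<le> 1 \<Longrightarrow> \<epsilon> * norm z \<le> \<delta> \<Longrightarrow> G \<epsilon> z = G' \<epsilon> z + \<epsilon> ^ N * B \<epsilon> z"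
    using assms(2) unfolding cong_eps_def by blast
  show ?thesis
    by (rule cong_epsI[OF tame_add[OF A(1) B(1)]]) (simp add: A(2) B(2) algebra_simps)
qed

lemma cong_eps_mult:
  assumes "cong_eps N \<delta> F F'" "cong_eps N \<delta> G G'" "tame \<delta> F'" "tame \<delta> G'"
  shows "cong_eps N \<delta> (\<lambda>\<epsilon> z. F \<epsilon> z * G \<epsilon> z) (\<lambda>\<epsilon> z. F' \<epsilon> z * G' \<epsilon> z)"
proof -
  obtain A where A: "tame \<delta> A"
    "\<And>\<epsilon> z. 0 < \<epsilon> \<Longrightarrow> \<epsilon> \<le> 1 \<Longrightarrow> \<epsilon> * norm z \<le> \<delta> \<Longrightarrow> F \<epsilon> z = F' \<epsilon> z + \<epsilon> ^ N * A \<epsilon> z"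
    using assms(1) unfolding cong_eps_def by blast
  obtain B where B: "tame \<delta> B"
    "\<And>\<epsilon> z. 0 < \<epsilon> \<Longrightarrow> \<epsilon> \<le> 1 \<Longrightarrow> \<epsilon> * norm z \<le> \<delta> \<Longrightarrow> G \<epsilon> z = G' \<epsilon> z + \<epsilon> ^ N * B \<epsilon> z"
    using assms(2) unfolding cong_eps_def by blast
  have "tame \<delta> (\<lambda>\<epsilon> z. A \<epsilon> z * G' \<epsilon> z + F' \<epsilon> z * B \<epsilon> z + \<epsilon> ^ N * (A \<epsilon> z * B \<epsilon> z))"
    by (intro tame_intros A B assms)
  then show ?thesis
    by (rule cong_epsI) (simp add: A(2) B(2) algebra_simps)
qed

lemma cong_eps_power:
  assumes "cong_eps N \<delta> F F'" "tame \<delta> F'"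
  shows "cong_eps N \<delta> (\<lambda>\<epsilon> z. F \<epsilon> z ^ n) (\<lambda>\<epsilon> z. F' \<epsilon> z ^ n)"
proof (induction n)
  case (Suc n)
  show ?case
    unfolding power_Suc by (intro cong_eps_mult assms Suc tame_power)
qed (simp add: cong_eps_refl)

lemma cong_eps_cmult:
  "cong_eps N \<delta> F G \<Longrightarrow> cong_eps N \<delta> (\<lambda>\<epsilon> z. c * F \<epsilon> z) (\<lambda>\<epsilon> z. c * G \<epsilon> z)"
  by (erule cong_epsE, rule cong_epsI[OF tame_mult[OF tame_const[of _ c]]]) (auto simp: algebra_simps)

lemma cong_eps_sum:
  "(\<And>i. i \<in> I \<Longrightarrow> cong_eps N \<delta> (F i) (G i)) \<Longrightarrow>
    cong_eps N \<delta> (\<lambda>\<epsilon> z. \<Sum>i\<in>I. F i \<epsilon> z) (\<lambda>\<epsilon> z. \<Sum>i\<in>I. G i \<epsilon> z)"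
  by (induction I rule: infinite_finite_induct) (auto intro: cong_eps_refl cong_eps_add)

lemma cong_eps_truncate:
  assumes "finite X" "\<And>x. x \<in> X \<Longrightarrow> tame \<delta> (\<lambda>_. a x)"
  shows "cong_eps N \<delta> (\<lambda>\<epsilon> z. \<Sum>x\<in>X. \<epsilon> ^ d x * a x z) (\<lambda>\<epsilon> z. \<Sum>x\<in>{x\<in>X. d x < N}. \<epsilon> ^ d x * a x z)"
proof (rule cong_epsI)
  show "tame \<delta> (\<lambda>\<epsilon> z. \<Sum>x\<in>{x\<in>X. \<not> d x < N}. \<epsilon> ^ (d x - N) * a x z)"
    by (intro tame_intros assms(2)) auto
  fix \<epsilon> z
  have "(\<Sum>x\<in>X. \<epsilon> ^ d x * a x z) =
      (\<Sum>x\<in>{x\<in>X. d x < N}. \<epsilon> ^ d x * a x z) + (\<Sum>x\<in>{x\<in>X. \<not> d x < N}. \<epsilon> ^ d x * a x z)"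
    using assms(1) by (subst sum.union_disjoint[symmetric]) (auto intro: sum.cong)
  also have "(\<Sum>x\<in>{x\<in>X. \<not> d x < N}. \<epsilon> ^ d x * a x z) =
      (\<Sum>x\<in>{x\<in>X. \<not> d x < N}. \<epsilon> ^ N * (\<epsilon> ^ (d x - N) * a x z))"
    by (intro sum.cong refl) (simp add: mult.assoc[symmetric] power_add[symmetric])
  finally show "(\<Sum>x\<in>X. \<epsilon> ^ d x * a x z) = (\<Sum>x\<in>{x\<in>X. d x < N}. \<epsilon> ^ d x * a x z) +
      \<epsilon> ^ N * (\<Sum>x\<in>{x\<in>X. \<not> d x < N}. \<epsilon> ^ (d x - N) * a x z)"
    by (simp add: sum_distrib_left)
qed

text \<open>The coefficient of \<open>\<epsilon>\<^sup>l\<close> in \<open>exp (- P) Q\<close> for \<open>P = \<Sum>\<^bsub>n \<ge> 1\<^esub> p\<^sub>n \<epsilon>\<^sup>n\<close> and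
\<open>Q = \<Sum>\<^sub>n q\<^sub>n \<epsilon>\<^sup>n\<close>. The exponential series may be cut off at \<open>r < N\<close> for \<open>l < N\<close>, because a
composition of \<open>m\<close> has at most \<open>m \<le> l\<close> parts.\<close>

definition exp_coeff ::
    "nat \<Rightarrow> (nat \<Rightarrow> 'a \<Rightarrow> real) \<Rightarrow> (nat \<Rightarrow> 'a \<Rightarrow> real) \<Rightarrow> nat \<Rightarrow> 'a \<Rightarrow> real" where
  "exp_coeff N p q l z = (\<Sum>m\<le>l. \<Sum>r<N. (-1) ^ r / fact r *
     (\<Sum>n\<in>compositions m r. q (l - m) z * (\<Prod>i=1..r. p (n i) z)))"

text \<open>Multiplying out \<open>P\<^sup>r Q\<close> gives a sum over \<open>n\<^sub>1, ..., n\<^sub>r\<close> and \<open>b\<close> of terms of order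
\<open>n\<^sub>1 + ... + n\<^sub>r + b\<close>. Those of order at least \<open>N\<close> are dropped; the others are sorted by the total
order \<open>l\<close> and the partial sum \<open>m = n\<^sub>1 + ... + n\<^sub>r\<close>.\<close>

lemma product_series_coeff:
  fixes p q :: "nat \<Rightarrow> real^'d::finite \<Rightarrow> real"
  assumes p: "\<And>n. tame \<delta> (\<lambda>_. p n)" and q: "\<And>n. tame \<delta> (\<lambda>_. q n)"
  shows "cong_eps N \<delta> (\<lambda>\<epsilon> z. (\<Sum>n\<in>{1..<N}. \<epsilon> ^ n * p n z) ^ r * (\<Sum>b<N. \<epsilon> ^ b * q b z))
    (\<lambda>\<epsilon> z. \<Sum>l<N. \<epsilon> ^ l * (\<Sum>m\<le>l. \<Sum>n\<in>compositions m r. q (l - m) z * (\<Prod>i=1..r. p (n i) z)))"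
proof -
  define X where "X = ({1..r} \<rightarrow>\<^sub>E {1..<N}) \<times> {..<N}"
  define d where "d = (\<lambda>(n :: nat \<Rightarrow> nat, b). (\<Sum>i=1..r. n i) + b)"
  define a where "a = (\<lambda>(n, b) z. q b z * (\<Prod>i=1..r. p (n i) z))"
  have finX: "finite X" unfolding X_def by (intro finite_cartesian_product finite_PiE) auto
  have expand: "(\<Sum>n\<in>{1..<N}. \<epsilon> ^ n * p n z) ^ r * (\<Sum>b<N. \<epsilon> ^ b * q b z) = (\<Sum>x\<in>X. \<epsilon> ^ d x * a x z)" for \<epsilon> z
  proof -
    have "(\<Sum>n\<in>{1..<N}. \<epsilon> ^ n * p n z) ^ r = (\<Prod>i\<in>{1..r}. \<Sum>n\<in>{1..<N}. \<epsilon> ^ n * p n z)" by simp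
    also have "\<dots> = (\<Sum>n\<in>{1..r} \<rightarrow>\<^sub>E {1..<N}. \<Prod>i\<in>{1..r}. \<epsilon> ^ n i * p (n i) z)"
      by (rule prod_sum_PiE) auto
    also have "\<dots> = (\<Sum>n\<in>{1..r} \<rightarrow>\<^sub>E {1..<N}. \<epsilon> ^ (\<Sum>i=1..r. n i) * (\<Prod>i=1..r. p (n i) z))"
      by (simp only: prod.distrib power_sum)
    finally show ?thesis
      by (simp only: sum_product sum.cartesian_product X_def)
        (auto intro!: sum.cong simp: d_def a_def power_add mult_ac)
  qed
  have reindex: "(\<Sum>x\<in>{x\<in>X. d x < N}. \<epsilon> ^ d x * a x z) =
      (\<Sum>l<N. \<epsilon> ^ l * (\<Sum>m\<le>l. \<Sum>n\<in>compositions m r. q (l - m) z * (\<Prod>i=1..r. p (n i) z)))" for \<epsilon> z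
  proof -
    define Y where "Y = (SIGMA l:{..<N}. SIGMA m:{..l}. compositions m r)"
    define I where "I = (\<lambda>(n :: nat \<Rightarrow> nat, b). ((\<Sum>i=1..r. n i) + b, (\<Sum>i=1..r. n i), n))"
    define J where "J = (\<lambda>(l :: nat, m :: nat, n :: nat \<Rightarrow> nat). (n, l - m))"
    have "(\<Sum>l<N. \<epsilon> ^ l * (\<Sum>m\<le>l. \<Sum>n\<in>compositions m r. q (l - m) z * (\<Prod>i=1..r. p (n i) z))) =
        (\<Sum>(l, m, n)\<in>Y. \<epsilon> ^ l * (q (l - m) z * (\<Prod>i=1..r. p (n i) z)))"
      by (simp add: Y_def sum_distrib_left sum.Sigma finite_compositions split_def)
    also have "\<dots> = (\<Sum>x\<in>{x\<in>X. d x < N}. \<epsilon> ^ d x * a x z)"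
    proof (rule sum.reindex_bij_witness[of _ I J])
      fix y assume "y \<in> Y"
      then obtain l m n where y: "y = (l, m, n)" and l: "l < N" "m \<le> l" and n: "n \<in> compositions m r"
        by (auto simp: Y_def)
      have sum: "(\<Sum>i=1..r. n i) = m" using n by (simp add: compositions_def)
      show "I (J y) = y" using l sum by (simp add: y I_def J_def)
      have "n i \<le> m" if "i \<in> {1..r}" for i
        using member_le_sum[of i "{1..r}" n] that sum by simp
      moreover have "n \<in> {1..r} \<rightarrow>\<^sub>E {1..}" using n by (simp add: compositions_def)
      ultimately have "n i \<in> {1..<N}" if "i \<in> {1..r}" for i
        using l that PiE_mem[of n "{1..r}" "\<lambda>_. {1..}" i] by (meson atLeastLessThan_iff atLeast_iff le_less_trans)
      with \<open>n \<in> {1..r} \<rightarrow>\<^sub>E {1..}\<close> have "n \<in> {1..r} \<rightarrow>\<^sub>E {1..<N}"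
        unfolding PiE_iff by blast
      then show "J y \<in> {x\<in>X. d x < N}"
        using l sum by (auto simp: X_def d_def y J_def)
      show "\<epsilon> ^ d (J y) * a (J y) z = (case y of (l, m, n) \<Rightarrow> \<epsilon> ^ l * (q (l - m) z * (\<Prod>i=1..r. p (n i) z)))"
        using l sum by (simp add: d_def a_def y J_def)
    next
      fix x assume "x \<in> {x\<in>X. d x < N}"
      then obtain n b where x: "x = (n, b)" "(n, b) \<in> X" "d (n, b) < N" by (cases x) auto
      show "J (I x) = x" by (simp add: x I_def J_def)
      have "n \<in> compositions (\<Sum>i=1..r. n i) r"
        using x by (auto simp: X_def compositions_def PiE_iff)
      then show "I x \<in> Y"
        using x by (auto simp: d_def Y_def I_def)
    qed
    finally show ?thesis by simp
  qed
  have "tame \<delta> (\<lambda>_. a x)" for x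
  proof (cases x)
    case (Pair n b)
    have "tame \<delta> (\<lambda>_ z. q b z * (\<Prod>i=1..r. p (n i) z))" by (intro tame_mult tame_prod p q)
    then show ?thesis by (simp add: a_def Pair)
  qed
  then have "cong_eps N \<delta> (\<lambda>\<epsilon> z. \<Sum>x\<in>X. \<epsilon> ^ d x * a x z) (\<lambda>\<epsilon> z. \<Sum>x\<in>{x\<in>X. d x < N}. \<epsilon> ^ d x * a x z)"
    by (intro cong_eps_truncate finX)
  then show ?thesis unfolding expand reindex .
qed

lemma exp_series_coeff:
  fixes p q :: "nat \<Rightarrow> real^'d::finite \<Rightarrow> real"
  assumes p: "\<And>n. tame \<delta> (\<lambda>_. p n)" and q: "\<And>n. tame \<delta> (\<lambda>_. q n)"
    and S: "cong_eps N \<delta> S (\<lambda>\<epsilon> z. \<Sum>n\<in>{1..<N}. \<epsilon> ^ n * p n z)"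
    and g: "cong_eps N \<delta> g (\<lambda>\<epsilon> z. \<Sum>b<N. \<epsilon> ^ b * q b z)"
  shows "cong_eps N \<delta> (\<lambda>\<epsilon> z. (\<Sum>r<N. (- S \<epsilon> z) ^ r / fact r) * g \<epsilon> z)
    (\<lambda>\<epsilon> z. \<Sum>l<N. \<epsilon> ^ l * exp_coeff N p q l z)"
proof -
  have tP: "tame \<delta> (\<lambda>\<epsilon> z. \<Sum>n\<in>{1..<N}. \<epsilon> ^ n * p n z)" and tQ: "tame \<delta> (\<lambda>\<epsilon> z. \<Sum>b<N. \<epsilon> ^ b * q b z)"
    by (intro tame_intros p q)+
  have "cong_eps N \<delta> (\<lambda>\<epsilon> z. \<Sum>r<N. (-1) ^ r / fact r * (S \<epsilon> z ^ r * g \<epsilon> z))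
    (\<lambda>\<epsilon> z. \<Sum>r<N. (-1) ^ r / fact r *
      (\<Sum>l<N. \<epsilon> ^ l * (\<Sum>m\<le>l. \<Sum>n\<in>compositions m r. q (l - m) z * (\<Prod>i=1..r. p (n i) z))))"
    by (intro cong_eps_sum cong_eps_cmult cong_eps_trans[OF _ product_series_coeff[OF p q]]
        cong_eps_mult cong_eps_power S g tP tQ tame_power)
  moreover have "(\<Sum>r<N. (-1) ^ r / fact r * (S \<epsilon> z ^ r * g \<epsilon> z)) = (\<Sum>r<N. (- S \<epsilon> z) ^ r / fact r) * g \<epsilon> z" for \<epsilon> z
    by (simp add: sum_distrib_right power_minus[of "S \<epsilon> z"] mult.assoc)
  moreover have "(\<Sum>r<N. (-1) ^ r / fact r *
      (\<Sum>l<N. \<epsilon> ^ l * (\<Sum>m\<le>l. \<Sum>n\<in>compositions m r. q (l - m) z * (\<Prod>i=1..r. p (n i) z)))) =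
      (\<Sum>l<N. \<epsilon> ^ l * exp_coeff N p q l z)" for \<epsilon> z
  proof -
    have "(\<Sum>r<N. (-1) ^ r / fact r *
      (\<Sum>l<N. \<epsilon> ^ l * (\<Sum>m\<le>l. \<Sum>n\<in>compositions m r. q (l - m) z * (\<Prod>i=1..r. p (n i) z)))) =
      (\<Sum>r<N. \<Sum>l<N. \<Sum>m\<le>l. \<epsilon> ^ l * ((-1) ^ r / fact r *
        (\<Sum>n\<in>compositions m r. q (l - m) z * (\<Prod>i=1..r. p (n i) z))))"
      by (simp only: sum_distrib_left mult.left_commute)
    also have "\<dots> = (\<Sum>l<N. \<Sum>m\<le>l. \<Sum>r<N. \<epsilon> ^ l * ((-1) ^ r / fact r *
        (\<Sum>n\<in>compositions m r. q (l - m) z * (\<Prod>i=1..r. p (n i) z))))"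
      by (subst sum.swap) (intro sum.cong refl sum.swap)
    finally show ?thesis by (simp only: exp_coeff_def sum_distrib_left)
  qed
  ultimately show ?thesis by simp
qed

lemma exp_taylor_remainder:
  fixes x :: real
  shows "\<bar>exp x - (\<Sum>r<n. x ^ r / fact r)\<bar> \<le> \<bar>x\<bar> ^ n * exp \<bar>x\<bar>"
proof -
  obtain t where t: "\<bar>t\<bar> \<le> \<bar>x\<bar>" "exp x = (\<Sum>r<n. x ^ r / fact r) + exp t / fact n * x ^ n"
    using Maclaurin_exp_le by blast
  have "\<bar>exp x - (\<Sum>r<n. x ^ r / fact r)\<bar> = exp t / fact n * \<bar>x\<bar> ^ n"
    by (simp add: t(2) abs_mult power_abs)
  also have "exp t / fact n \<le> exp t" by (simp add: divide_le_eq fact_ge_1 mult_le_cancel_left1)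
  also have "exp t \<le> exp \<bar>x\<bar>" using t(1) by simp
  finally show ?thesis by (simp add: mult_right_mono mult.commute)
qed

text \<open>Replacing \<open>exp (- S)\<close> by its Taylor polynomial costs \<open>|S|\<^sup>N exp |S|\<close>. Here \<open>|S|\<^sup>N\<close> supplies
the factor \<open>\<epsilon>\<^sup>N\<close>, since \<open>S\<close> is \<open>\<epsilon>\<close> times a tame function, and \<open>exp |S|\<close> is at most
\<open>exp (|z|\<^sup>2 / 4)\<close>, which the Gaussian weight absorbs.\<close>

lemma exp_expansion_bound:
  fixes p q :: "nat \<Rightarrow> real^'d::finite \<Rightarrow> real"
  assumes p: "\<And>n. tame \<delta> (\<lambda>_. p n)" and q: "\<And>n. tame \<delta> (\<lambda>_. q n)"
    and S: "cong_eps N \<delta> S (\<lambda>\<epsilon> z. \<Sum>n\<in>{1..<N}. \<epsilon> ^ n * p n z)"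
    and g: "cong_eps N \<delta> g (\<lambda>\<epsilon> z. \<Sum>b<N. \<epsilon> ^ b * q b z)"
    and W: "tame \<delta> W" "\<And>\<epsilon> z. 0 < \<epsilon> \<Longrightarrow> \<epsilon> \<le> 1 \<Longrightarrow> \<epsilon> * norm z \<le> \<delta> \<Longrightarrow> S \<epsilon> z = \<epsilon> * W \<epsilon> z"
    and S4: "\<And>\<epsilon> z. 0 < \<epsilon> \<Longrightarrow> \<epsilon> \<le> 1 \<Longrightarrow> \<epsilon> * norm z \<le> \<delta> \<Longrightarrow> \<bar>S \<epsilon> z\<bar> \<le> (norm z)\<^sup>2 / 4"
  shows "\<exists>C\<ge>0. \<exists>K. \<forall>\<epsilon> z. 0 < \<epsilon> \<longrightarrow> \<epsilon> \<le> 1 \<longrightarrow> \<epsilon> * norm z \<le> \<delta> \<longrightarrow>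
    \<bar>exp (- S \<epsilon> z) * g \<epsilon> z - (\<Sum>l<N. \<epsilon> ^ l * exp_coeff N p q l z)\<bar>
      \<le> \<epsilon> ^ N * (C * (1 + norm z) ^ K * exp ((norm z)\<^sup>2 / 4))"
proof -
  obtain H where H: "tame \<delta> H" "\<And>\<epsilon> z. 0 < \<epsilon> \<Longrightarrow> \<epsilon> \<le> 1 \<Longrightarrow> \<epsilon> * norm z \<le> \<delta> \<Longrightarrow>
      (\<Sum>r<N. (- S \<epsilon> z) ^ r / fact r) * g \<epsilon> z = (\<Sum>l<N. \<epsilon> ^ l * exp_coeff N p q l z) + \<epsilon> ^ N * H \<epsilon> z"
    using exp_series_coeff[OF p q S g] unfolding cong_eps_def by blast
  have "tame \<delta> g" by (rule cong_eps_tame[OF g]) (intro tame_intros q)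
  then have "tame \<delta> (\<lambda>\<epsilon> z. W \<epsilon> z ^ N * g \<epsilon> z)" by (intro tame_intros W)
  then obtain C K where C: "C \<ge> 0" "\<And>\<epsilon> z. 0 < \<epsilon> \<Longrightarrow> \<epsilon> \<le> 1 \<Longrightarrow> \<epsilon> * norm z \<le> \<delta> \<Longrightarrow>
      \<bar>W \<epsilon> z ^ N * g \<epsilon> z\<bar> \<le> C * (1 + norm z) ^ K"
    unfolding tame_def by blast
  obtain D L where D: "D \<ge> 0" "\<And>\<epsilon> z. 0 < \<epsilon> \<Longrightarrow> \<epsilon> \<le> 1 \<Longrightarrow> \<epsilon> * norm z \<le> \<delta> \<Longrightarrow>
      \<bar>H \<epsilon> z\<bar> \<le> D * (1 + norm z) ^ L"
    using H(1) unfolding tame_def by blast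
  show ?thesis
  proof (intro exI[of _ "C + D"] conjI exI[of _ "max K L"] allI impI)
    fix \<epsilon> and z :: "real^'d" assume dom: "0 < \<epsilon>" "\<epsilon> \<le> 1" "\<epsilon> * norm z \<le> \<delta>"
    define E where "E = exp ((norm z)\<^sup>2 / 4)"
    define M where "M = (1 + norm z) ^ max K L"
    have E1: "1 \<le> E" by (simp add: E_def)
    have M: "(1 + norm z) ^ K \<le> M" "(1 + norm z) ^ L \<le> M"
      unfolding M_def by (intro power_increasing; simp)+
    have "\<bar>exp (- S \<epsilon> z) - (\<Sum>r<N. (- S \<epsilon> z) ^ r / fact r)\<bar> \<le> \<bar>S \<epsilon> z\<bar> ^ N * exp \<bar>S \<epsilon> z\<bar>"
      using exp_taylor_remainder[of "- S \<epsilon> z" N] by simp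
    also have "\<dots> \<le> \<bar>S \<epsilon> z\<bar> ^ N * E"
      using S4[OF dom] by (intro mult_left_mono) (auto simp: E_def)
    also have "\<bar>S \<epsilon> z\<bar> ^ N = \<epsilon> ^ N * \<bar>W \<epsilon> z ^ N\<bar>"
      using dom by (simp add: W(2)[OF dom] abs_mult power_mult_distrib power_abs)
    finally have "\<bar>(exp (- S \<epsilon> z) - (\<Sum>r<N. (- S \<epsilon> z) ^ r / fact r)) * g \<epsilon> z\<bar> \<le>
        (\<epsilon> ^ N * \<bar>W \<epsilon> z ^ N\<bar> * E) * \<bar>g \<epsilon> z\<bar>"
      unfolding abs_mult by (rule mult_right_mono) simp
    also have "\<dots> = \<epsilon> ^ N * (\<bar>W \<epsilon> z ^ N * g \<epsilon> z\<bar> * E)" by (simp add: abs_mult)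
    also have "\<dots> \<le> \<epsilon> ^ N * (C * M * E)"
      using dom E1 C(1) M(1) by (intro mult_left_mono mult_right_mono order_trans[OF C(2)[OF dom]]) auto
    finally have 1: "\<bar>(exp (- S \<epsilon> z) - (\<Sum>r<N. (- S \<epsilon> z) ^ r / fact r)) * g \<epsilon> z\<bar> \<le> \<epsilon> ^ N * (C * M * E)" .
    have "\<bar>H \<epsilon> z\<bar> \<le> D * M * 1"
      using D(1) M(2) by (simp, intro order_trans[OF D(2)[OF dom]] mult_left_mono) auto
    also have "D * M * 1 \<le> D * M * E"
      using E1 D(1) by (intro mult_left_mono) (auto simp: M_def)
    finally have 2: "\<bar>\<epsilon> ^ N * H \<epsilon> z\<bar> \<le> \<epsilon> ^ N * (D * M * E)"
      using dom by (simp add: abs_mult mult_left_mono)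
    have "exp (- S \<epsilon> z) * g \<epsilon> z - (\<Sum>l<N. \<epsilon> ^ l * exp_coeff N p q l z) =
        (exp (- S \<epsilon> z) - (\<Sum>r<N. (- S \<epsilon> z) ^ r / fact r)) * g \<epsilon> z + \<epsilon> ^ N * H \<epsilon> z"
      using H(2)[OF dom] by (simp add: algebra_simps)
    then have "\<bar>exp (- S \<epsilon> z) * g \<epsilon> z - (\<Sum>l<N. \<epsilon> ^ l * exp_coeff N p q l z)\<bar> \<le>
        \<epsilon> ^ N * (C * M * E) + \<epsilon> ^ N * (D * M * E)"
      using 1 2 by linarith
    then show "\<bar>exp (- S \<epsilon> z) * g \<epsilon> z - (\<Sum>l<N. \<epsilon> ^ l * exp_coeff N p q l z)\<bar>
        \<le> \<epsilon> ^ N * ((C + D) * (1 + norm z) ^ max K L * exp ((norm z)\<^sup>2 / 4))"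
      by (simp add: E_def M_def algebra_simps)
  qed (use C D in auto)
qed

text \<open>A pointwise expansion of \<open>F\<close> can be integrated against the Gaussian. Where \<open>\<epsilon> |z| > \<delta>\<close>, only
the expansion itself contributes, and there \<open>1 \<le> (\<epsilon> |z| / \<delta>)\<^sup>N\<close> provides the factor
\<open>\<epsilon>\<^sup>N\<close> at the price of a higher power of \<open>|z|\<close>.\<close>

lemma gaussian_integral_expansion:
  fixes F :: "real \<Rightarrow> real^'d::finite \<Rightarrow> real" and c :: "nat \<Rightarrow> real^'d \<Rightarrow> real"
  assumes \<delta>: "\<delta> > 0"
    and F: "\<And>\<epsilon> z. 0 < \<epsilon> \<Longrightarrow> \<epsilon> \<le> 1 \<Longrightarrow> \<epsilon> * norm z \<le> \<delta> \<Longrightarrow>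
      \<bar>F \<epsilon> z - (\<Sum>l<N. \<epsilon> ^ l * c l z)\<bar> \<le> \<epsilon> ^ N * (C * (1 + norm z) ^ K * exp ((norm z)\<^sup>2 / 4))"
    and C: "C \<ge> 0"
    and c: "\<And>l. tame \<delta> (\<lambda>_. c l)" and cm: "\<And>l. c l \<in> borel_measurable borel"
    and Fm: "\<And>\<epsilon>. 0 < \<epsilon> \<Longrightarrow> \<epsilon> \<le> 1 \<Longrightarrow> (\<lambda>z. indicator {z. \<epsilon> * norm z \<le> \<delta>} z * F \<epsilon> z) \<in> borel_measurable borel"
  shows "\<exists>D. \<forall>\<epsilon>. 0 < \<epsilon> \<longrightarrow> \<epsilon> \<le> 1 \<longrightarrow>
    \<bar>(\<integral>z. exp (- ((norm z)\<^sup>2 / 2)) * (indicator {z. \<epsilon> * norm z \<le> \<delta>} z * F \<epsilon> z) \<partial>lborel) -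
      (\<Sum>l<N. \<epsilon> ^ l * (\<integral>z. exp (- ((norm z)\<^sup>2 / 2)) * c l z \<partial>lborel))\<bar> \<le> D * \<epsilon> ^ N"
proof -
  have "tame \<delta> (\<lambda>_ z. \<Sum>l<N. \<bar>c l z\<bar>)"
  proof (rule tame_sum)
    fix l show "tame \<delta> (\<lambda>_ z. \<bar>c l z\<bar>)"
      using c[of l] by (rule tameE) (rule tameI, auto)
  qed
  then obtain C' K' where C': "C' \<ge> 0" "\<And>z. \<bar>\<Sum>l<N. \<bar>c l z\<bar>\<bar> \<le> C' * (1 + norm z) ^ K'"
    using tame_independent[OF _ \<delta>] by blast
  have int_c: "integrable lborel (\<lambda>z. exp (- ((norm z)\<^sup>2 / 2)) * c l z)" for l
  proof -
    obtain A L where A: "A \<ge> 0" "\<And>z. \<bar>c l z\<bar> \<le> A * (1 + norm z) ^ L"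
      using tame_independent[OF c \<delta>] by blast
    show ?thesis
    proof (rule Bochner_Integration.integrable_bound)
      show "integrable lborel (\<lambda>z :: real^'d. A * ((1 + norm z) ^ L * exp (- (1 / 2 * (norm z)\<^sup>2))))"
        by (intro integrable_mult_right integrable_polynomial_gauss) simp
      show "AE z in lborel. norm (exp (- ((norm z)\<^sup>2 / 2)) * c l z) \<le>
          norm (A * ((1 + norm z) ^ L * exp (- (1 / 2 * (norm z)\<^sup>2))))"
        using A by (intro AE_I2) (simp add: abs_mult mult_ac mult_left_mono)
    qed (use cm[of l] in measurable)
  qed
  define E where "E z = (1 + norm z) ^ (K + K' + N) * exp (- (1 / 4 * (norm z)\<^sup>2))" for z :: "real^'d"
  have E: "integrable lborel E" unfolding E_def[abs_def] by (rule integrable_polynomial_gauss) simp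
  define D where "D = C + C' / \<delta> ^ N"
  have D: "C \<le> D" "C' / \<delta> ^ N \<le> D" using C C' \<delta> by (auto simp: D_def)
  have bound: "\<bar>exp (- ((norm z)\<^sup>2 / 2)) * (indicator {z. \<epsilon> * norm z \<le> \<delta>} z * F \<epsilon> z) -
      (\<Sum>l<N. \<epsilon> ^ l * (exp (- ((norm z)\<^sup>2 / 2)) * c l z))\<bar> \<le> \<epsilon> ^ N * D * E z"
    if \<epsilon>: "0 < \<epsilon>" "\<epsilon> \<le> 1" for \<epsilon> z
  proof -
    have e4: "exp (- ((norm z)\<^sup>2 / 2)) * exp ((norm z)\<^sup>2 / 4) = exp (- (1 / 4 * (norm z)\<^sup>2))"
      by (simp flip: exp_add)
    have sum: "(\<Sum>l<N. \<epsilon> ^ l * (exp (- ((norm z)\<^sup>2 / 2)) * c l z)) =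
        exp (- ((norm z)\<^sup>2 / 2)) * (\<Sum>l<N. \<epsilon> ^ l * c l z)"
      by (simp add: sum_distrib_left mult.left_commute)
    show ?thesis
    proof (cases "\<epsilon> * norm z \<le> \<delta>")
      case True
      have "\<bar>exp (- ((norm z)\<^sup>2 / 2)) * (F \<epsilon> z - (\<Sum>l<N. \<epsilon> ^ l * c l z))\<bar> \<le>
          exp (- ((norm z)\<^sup>2 / 2)) * (\<epsilon> ^ N * (C * (1 + norm z) ^ K * exp ((norm z)\<^sup>2 / 4)))"
        unfolding abs_mult using F[OF \<epsilon> True] by (intro mult_mono) auto
      also have "\<dots> = \<epsilon> ^ N * C * ((1 + norm z) ^ K * exp (- (1 / 4 * (norm z)\<^sup>2)))"
        unfolding e4[symmetric] by (simp only: mult_ac)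
      also have "\<dots> \<le> \<epsilon> ^ N * D * E z"
        unfolding E_def using \<epsilon> C D
        by (intro mult_mono mult_left_mono power_increasing mult_right_mono) auto
      finally show ?thesis using True sum by (simp add: right_diff_distrib)
    next
      case False
      have "\<bar>\<Sum>l<N. \<epsilon> ^ l * c l z\<bar> \<le> (\<Sum>l<N. \<bar>c l z\<bar>)"
      proof (intro order_trans[OF sum_abs] sum_mono)
        fix l show "\<bar>\<epsilon> ^ l * c l z\<bar> \<le> \<bar>c l z\<bar>"
          using \<epsilon> by (simp add: abs_mult mult_left_le_one_le power_le_one)
      qed
      also have "\<dots> \<le> C' * (1 + norm z) ^ K'" using C'(2)[of z] by simp
      finally have 1: "\<bar>\<Sum>l<N. \<epsilon> ^ l * c l z\<bar> \<le> C' * (1 + norm z) ^ K'" .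
      have "1 \<le> (\<epsilon> * norm z / \<delta>) ^ N" using False \<delta> by (intro one_le_power) simp
      also have "\<dots> \<le> (\<epsilon> * (1 + norm z) / \<delta>) ^ N"
        using \<epsilon> \<delta> by (intro power_mono divide_right_mono mult_left_mono) auto
      finally have "C' * (1 + norm z) ^ K' * 1 \<le> C' * (1 + norm z) ^ K' * (\<epsilon> * (1 + norm z) / \<delta>) ^ N"
        using C'(1) by (intro mult_left_mono) auto
      also have "\<dots> = \<epsilon> ^ N * (C' / \<delta> ^ N) * (1 + norm z) ^ (K' + N)"
        by (simp add: power_mult_distrib power_divide power_add)
      finally have "\<bar>\<Sum>l<N. \<epsilon> ^ l * c l z\<bar> \<le> \<epsilon> ^ N * (C' / \<delta> ^ N) * (1 + norm z) ^ (K' + N)"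
        using 1 by simp
      also have "\<dots> \<le> \<epsilon> ^ N * D * (1 + norm z) ^ (K + K' + N)"
        using \<epsilon> C D by (intro mult_mono[OF mult_left_mono[OF D(2)] power_increasing]) auto
      finally have "exp (- ((norm z)\<^sup>2 / 2)) * \<bar>\<Sum>l<N. \<epsilon> ^ l * c l z\<bar> \<le>
          exp (- (1 / 4 * (norm z)\<^sup>2)) * (\<epsilon> ^ N * D * (1 + norm z) ^ (K + K' + N))"
        by (intro mult_mono) auto
      then show ?thesis using False unfolding sum by (simp add: abs_mult E_def mult_ac)
    qed
  qed
  show ?thesis
  proof (intro exI[of _ "D * integral\<^sup>L lborel E"] allI impI)
    fix \<epsilon> :: real assume \<epsilon>: "0 < \<epsilon>" "\<epsilon> \<le> 1"
    let ?f = "\<lambda>z. exp (- ((norm z)\<^sup>2 / 2)) * (indicator {z. \<epsilon> * norm z \<le> \<delta>} z * F \<epsilon> z)"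
    let ?s = "\<lambda>z. \<Sum>l<N. \<epsilon> ^ l * (exp (- ((norm z)\<^sup>2 / 2)) * c l z)"
    have s: "integrable lborel ?s" by (intro Bochner_Integration.integrable_sum integrable_mult_right int_c)
    have bE: "integrable lborel (\<lambda>z. \<epsilon> ^ N * D * E z)" by (intro integrable_mult_right E)
    have m: "?f \<in> borel_measurable borel" by (intro borel_measurable_times Fm[OF \<epsilon>]) measurable
    have diff: "integrable lborel (\<lambda>z. ?f z - ?s z)"
    proof (rule Bochner_Integration.integrable_bound[OF bE])
      show "AE z in lborel. norm (?f z - ?s z) \<le> norm (\<epsilon> ^ N * D * E z)"
      proof (rule AE_I2)
        fix z show "norm (?f z - ?s z) \<le> norm (\<epsilon> ^ N * D * E z)"
          using bound[OF \<epsilon>, of z] unfolding real_norm_def by linarith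
      qed
      show "(\<lambda>z. ?f z - ?s z) \<in> borel_measurable lborel"
        using m borel_measurable_integrable[OF s] by (intro borel_measurable_diff) simp_all
    qed
    have "integrable lborel (\<lambda>z. (?f z - ?s z) + ?s z)" by (intro Bochner_Integration.integrable_add diff s)
    then have f: "integrable lborel ?f" by simp
    have "integral\<^sup>L lborel ?s = (\<Sum>l<N. \<epsilon> ^ l * (\<integral>z. exp (- ((norm z)\<^sup>2 / 2)) * c l z \<partial>lborel))"
      by (subst Bochner_Integration.integral_sum) (auto intro!: integrable_mult_right int_c)
    then have eq: "(\<integral>z. ?f z \<partial>lborel) - (\<Sum>l<N. \<epsilon> ^ l * (\<integral>z. exp (- ((norm z)\<^sup>2 / 2)) * c l z \<partial>lborel)) =
        (\<integral>z. ?f z - ?s z \<partial>lborel)"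
      using Bochner_Integration.integral_diff[OF f s] by (simp only:)
    have "\<bar>\<integral>z. ?f z - ?s z \<partial>lborel\<bar> \<le> (\<integral>z. \<bar>?f z - ?s z\<bar> \<partial>lborel)"
      using integral_norm_bound[of lborel "\<lambda>z. ?f z - ?s z"] unfolding real_norm_def .
    also have "\<dots> \<le> (\<integral>z. \<epsilon> ^ N * D * E z \<partial>lborel)"
    proof (rule integral_mono[OF integrable_abs[OF diff] bE])
      show "\<bar>?f z - ?s z\<bar> \<le> \<epsilon> ^ N * D * E z" for z by (rule bound[OF \<epsilon>])
    qed
    also have "\<dots> = D * integral\<^sup>L lborel E * \<epsilon> ^ N" by simp
    finally show "\<bar>(\<integral>z. ?f z \<partial>lborel) - (\<Sum>l<N. \<epsilon> ^ l * (\<integral>z. exp (- ((norm z)\<^sup>2 / 2)) * c l z \<partial>lborel))\<bar>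
        \<le> D * integral\<^sup>L lborel E * \<epsilon> ^ N"
      unfolding eq .
  qed
qed

section \<open>The coefficients of the expansion\<close>

lemma monom_at_add: "monom_at z (\<alpha> + \<beta>) = monom_at z \<alpha> * monom_at z \<beta>"
  by (simp add: monom_at_def power_add prod.distrib)

lemma monom_at_sum: "monom_at z (\<Sum>i\<in>I. \<alpha> i) = (\<Prod>i\<in>I. monom_at z (\<alpha> i))"
  by (induction I rule: infinite_finite_induct) (simp_all add: monom_at_add, simp_all add: monom_at_def)

lemma monom_at_scale:
  assumes "\<alpha> \<in> multi_indices n"
  shows "monom_at (c *\<^sub>R z) \<alpha> = c ^ n * monom_at z \<alpha>"
  using assms by (simp add: monom_at_def power_mult_distrib prod.distrib multi_indices_def flip: power_sum)

lemma tame_monom_at: "tame \<delta> (\<lambda>_ z. monom_at z \<alpha>)"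
  unfolding monom_at_def by (intro tame_intros)

lemma borel_measurable_monom_at: "(\<lambda>z. monom_at z \<alpha>) \<in> borel_measurable borel"
  unfolding monom_at_def by measurable

text \<open>The Gaussian mean of \<open>exp_coeff\<close> when the coefficients are polynomials: \<open>a\<close> and \<open>b\<close> are the
Taylor coefficients \<open>D\<^bsup>\<alpha>\<^esup> f(0) / \<alpha>!\<close> and \<open>D\<^bsup>\<beta>\<^esup> g(0) / \<beta>!\<close>.\<close>

definition coeff_sum ::
    "nat \<Rightarrow> (nat^'d::finite \<Rightarrow> real) \<Rightarrow> (nat^'d \<Rightarrow> real) \<Rightarrow> nat \<Rightarrow> real" where
  "coeff_sum N a b l = (\<Sum>m\<le>l. \<Sum>r<N. (-1) ^ r / fact r *
     (\<Sum>n\<in>compositions m r. \<Sum>\<beta>\<in>multi_indices (l - m). \<Sum>\<alpha>\<in>multi_index_tuples n r.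
       b \<beta> * (\<Prod>i=1..r. a (\<alpha> i)) * gauss_weight (\<beta> + (\<Sum>i=1..r. \<alpha> i))))"

lemma exp_coeff_polynomial:
  fixes a b :: "nat^'d::finite \<Rightarrow> real"
  assumes p: "\<And>n z. p n z = (\<Sum>\<alpha>\<in>multi_indices (n + 2). a \<alpha> * monom_at z \<alpha>)"
    and q: "\<And>n z. q n z = (\<Sum>\<beta>\<in>multi_indices n. b \<beta> * monom_at z \<beta>)"
  shows "exp_coeff N p q l z = (\<Sum>m\<le>l. \<Sum>r<N. (-1) ^ r / fact r *
     (\<Sum>n\<in>compositions m r. \<Sum>\<beta>\<in>multi_indices (l - m). \<Sum>\<alpha>\<in>multi_index_tuples n r.
       b \<beta> * (\<Prod>i=1..r. a (\<alpha> i)) * monom_at z (\<beta> + (\<Sum>i=1..r. \<alpha> i))))"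
proof -
  have "q k z * (\<Prod>i=1..r. p (n i) z) =
      (\<Sum>\<beta>\<in>multi_indices k. \<Sum>\<alpha>\<in>multi_index_tuples n r.
        b \<beta> * (\<Prod>i=1..r. a (\<alpha> i)) * monom_at z (\<beta> + (\<Sum>i=1..r. \<alpha> i)))" for k n r
  proof -
    have "(\<Prod>i=1..r. p (n i) z) = (\<Sum>\<alpha>\<in>multi_index_tuples n r. \<Prod>i=1..r. a (\<alpha> i) * monom_at z (\<alpha> i))"
      unfolding p multi_index_tuples_def by (rule prod_sum_PiE) (auto simp: finite_multi_indices)
    then show ?thesis
      by (simp only: q sum_product monom_at_add monom_at_sum prod.distrib mult_ac)
  qed
  then show ?thesis by (simp only: exp_coeff_def)
qed

lemma integral_exp_coeff:
  fixes a b :: "nat^'d::finite \<Rightarrow> real"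
  assumes p: "\<And>n z. p n z = (\<Sum>\<alpha>\<in>multi_indices (n + 2). a \<alpha> * monom_at z \<alpha>)"
    and q: "\<And>n z. q n z = (\<Sum>\<beta>\<in>multi_indices n. b \<beta> * monom_at z \<beta>)"
  shows "(\<integral>z. exp (- ((norm z)\<^sup>2 / 2)) * exp_coeff N p q l z \<partial>lborel) =
    (2 * pi) powr (real CARD('d) / 2) * coeff_sum N a b l"
proof -
  define e where "e z = exp (- ((norm z)\<^sup>2 / 2))" for z :: "real^'d"
  define w where "w = (2 * pi) powr (real CARD('d) / 2)"
  have hbi: "has_bochner_integral lborel (\<lambda>z. e z * monom_at z \<gamma>) (w * gauss_weight \<gamma>)" for \<gamma> :: "nat^'d"
    unfolding e_def w_def using gauss_moment[of \<gamma>] by (simp add: has_bochner_integral_iff)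
  have "has_bochner_integral lborel
     (\<lambda>z. \<Sum>m\<le>l. \<Sum>r<N. (-1) ^ r / fact r *
       (\<Sum>n\<in>compositions m r. \<Sum>\<beta>\<in>multi_indices (l - m). \<Sum>\<alpha>\<in>multi_index_tuples n r.
         b \<beta> * (\<Prod>i=1..r. a (\<alpha> i)) * (e z * monom_at z (\<beta> + (\<Sum>i=1..r. \<alpha> i)))))
     (\<Sum>m\<le>l. \<Sum>r<N. (-1) ^ r / fact r *
       (\<Sum>n\<in>compositions m r. \<Sum>\<beta>\<in>multi_indices (l - m). \<Sum>\<alpha>\<in>multi_index_tuples n r.
         b \<beta> * (\<Prod>i=1..r. a (\<alpha> i)) * (w * gauss_weight (\<beta> + (\<Sum>i=1..r. \<alpha> i)))))"
    by (intro has_bochner_integral_sum has_bochner_integral_mult_right hbi)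
  moreover have "(\<Sum>m\<le>l. \<Sum>r<N. (-1) ^ r / fact r *
       (\<Sum>n\<in>compositions m r. \<Sum>\<beta>\<in>multi_indices (l - m). \<Sum>\<alpha>\<in>multi_index_tuples n r.
         b \<beta> * (\<Prod>i=1..r. a (\<alpha> i)) * (e z * monom_at z (\<beta> + (\<Sum>i=1..r. \<alpha> i))))) =
      e z * exp_coeff N p q l z" for z
    unfolding exp_coeff_polynomial[of p a q b, OF p q]
    by (simp only: sum_distrib_left mult.left_commute[of _ "e z"])
  moreover have "(\<Sum>m\<le>l. \<Sum>r<N. (-1) ^ r / fact r *
       (\<Sum>n\<in>compositions m r. \<Sum>\<beta>\<in>multi_indices (l - m). \<Sum>\<alpha>\<in>multi_index_tuples n r.
         b \<beta> * (\<Prod>i=1..r. a (\<alpha> i)) * (w * gauss_weight (\<beta> + (\<Sum>i=1..r. \<alpha> i))))) =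
      w * coeff_sum N a b l"
    unfolding coeff_sum_def by (simp only: sum_distrib_left mult.left_commute[of _ w])
  ultimately have "has_bochner_integral lborel (\<lambda>z. e z * exp_coeff N p q l z) (w * coeff_sum N a b l)"
    by simp
  then show ?thesis unfolding e_def w_def by (rule has_bochner_integral_integral_eq)
qed

lemma gauss_weight_odd:
  assumes "odd (\<Sum>p\<in>UNIV. \<gamma> $ p)"
  shows "gauss_weight \<gamma> = 0"
proof -
  have "\<not> (\<forall>p. even (\<gamma> $ p))" using assms by (auto intro: dvd_sum)
  then show ?thesis by (simp only: gauss_weight_def even_indicator_def if_False mult_zero_left)
qed

text \<open>Every monomial in it has degree \<open>(l - m) + \<Sum>\<^sub>i (n\<^sub>i + 2) = l + 2 r\<close>, which is odd.\<close>

lemma coeff_sum_odd: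
  fixes a b :: "nat^'d::finite \<Rightarrow> real"
  assumes "odd l"
  shows "coeff_sum N a b l = 0"
  unfolding coeff_sum_def
proof (intro sum.neutral ballI mult_eq_0_iff[THEN iffD2] disjI2)
  fix m r n and \<beta> :: "nat^'d" and \<alpha> :: "nat \<Rightarrow> nat^'d"
  assume m: "m \<in> {..l}" and n: "n \<in> compositions m r" and \<beta>: "\<beta> \<in> multi_indices (l - m)"
    and \<alpha>: "\<alpha> \<in> multi_index_tuples n r"
  have "(\<Sum>p\<in>UNIV. \<alpha> i $ p) = n i + 2" if "i \<in> {1..r}" for i
    using PiE_mem[OF \<alpha>[unfolded multi_index_tuples_def] that] by (simp add: multi_indices_def)
  then have "(\<Sum>i=1..r. \<Sum>p\<in>UNIV. \<alpha> i $ p) = (\<Sum>i=1..r. n i + 2)" by (intro sum.cong) auto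
  also have "\<dots> = (\<Sum>i=1..r. n i) + 2 * r" by (subst sum.distrib) simp
  also have "\<dots> = m + 2 * r" using n by (simp add: compositions_def)
  finally have "(\<Sum>p\<in>UNIV. (\<Sum>i=1..r. \<alpha> i $ p)) = m + 2 * r" by (subst sum.swap)
  then have "(\<Sum>p\<in>UNIV. (\<beta> + (\<Sum>i=1..r. \<alpha> i)) $ p) = l + 2 * r"
    using m \<beta> by (simp add: sum.distrib multi_indices_def)
  then show "gauss_weight (\<beta> + (\<Sum>i=1..r. \<alpha> i)) = 0"
    using assms by (intro gauss_weight_odd) simp
qed

lemma compositions_0_right: "compositions m 0 = (if m = 0 then {\<lambda>_. undefined} else {})"
  by (auto simp: compositions_def)

lemma compositions_empty: "m < r \<Longrightarrow> compositions m r = {}"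
proof -
  assume "m < r"
  have False if n: "n \<in> compositions m r" for n
  proof -
    have "(\<Sum>i=1..r. 1) \<le> (\<Sum>i=1..r. n i)"
      using n by (intro sum_mono) (auto simp: compositions_def PiE_iff)
    then show False using n \<open>m < r\<close> by (simp add: compositions_def)
  qed
  then show ?thesis by blast
qed

text \<open>For \<open>m = 0\<close> only \<open>r = 0\<close> has a composition, and for \<open>m \<ge> 1\<close> only \<open>1 \<le> r \<le> m\<close> has any; this
explains the range of \<open>r\<close> and the separate term for \<open>m = 0\<close> in \<open>laplace_coeff\<close>.\<close>

lemma laplace_coeff_eq_coeff_sum:
  fixes f g :: "real^'d::finite \<Rightarrow> real"
  assumes jN: "2 * j < N"
    and a: "\<And>\<alpha>. a \<alpha> = mixed_partial \<alpha> (f \<circ> inv P) 0 / multi_fact \<alpha>"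
    and b: "\<And>\<beta>. b \<beta> = mixed_partial \<beta> (g \<circ> inv P) 0 / multi_fact \<beta>"
  shows "laplace_coeff f g P j =
    (2 * pi) powr (real CARD('d) / 2) / sqrt (det (hessian f 0)) * coeff_sum N a b (2 * j)"
proof -
  define t where "t m r = (-1) ^ r / fact r *
     (\<Sum>\<beta>\<in>multi_indices (2 * j - m). \<Sum>n\<in>compositions m r. \<Sum>\<alpha>\<in>multi_index_tuples n r.
       b \<beta> * (\<Prod>i=1..r. a (\<alpha> i)) * gauss_weight (\<beta> + (\<Sum>i=1..r. \<alpha> i)))" for m r
  have cs: "coeff_sum N a b (2 * j) = (\<Sum>m=0..2*j. \<Sum>r<N. t m r)"
    unfolding coeff_sum_def t_def
    by (intro sum.cong arg_cong2[where f = "(*)"] refl sum.swap) auto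
  have "(\<Sum>r<N. t m r) = (if m = 0 then
        \<Sum>\<beta>\<in>multi_indices (2*j). gauss_weight \<beta> / multi_fact \<beta> * mixed_partial \<beta> (g \<circ> inv P) 0
      else \<Sum>r=1..m. (-1)^r / fact r *
        (\<Sum>\<beta>\<in>multi_indices (2*j - m). \<Sum>n\<in>compositions m r. \<Sum>\<alpha>\<in>multi_index_tuples n r.
           gauss_weight (\<beta> + (\<Sum>i=1..r. \<alpha> i)) / (multi_fact \<beta> * (\<Prod>i=1..r. multi_fact (\<alpha> i))) *
           mixed_partial \<beta> (g \<circ> inv P) 0 * (\<Prod>i=1..r. mixed_partial (\<alpha> i) (f \<circ> inv P) 0)))"
    if m: "m \<le> 2 * j" for m
  proof (cases "m = 0")
    case True
    have "(\<Sum>r<N. t m r) = (\<Sum>r\<in>{0}. t m r)"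
      by (rule sum.mono_neutral_right) (use jN True in \<open>auto simp: t_def compositions_empty\<close>)
    also have "\<dots> = (\<Sum>\<beta>\<in>multi_indices (2*j). gauss_weight \<beta> / multi_fact \<beta> * mixed_partial \<beta> (g \<circ> inv P) 0)"
      by (simp add: t_def True compositions_0_right multi_index_tuples_def b mult.commute)
    finally show ?thesis using True by simp
  next
    case False
    have "(\<Sum>r<N. t m r) = (\<Sum>r=1..m. t m r)"
    proof (rule sum.mono_neutral_right)
      show "\<forall>r\<in>{..<N} - {1..m}. t m r = 0"
      proof
        fix r assume "r \<in> {..<N} - {1..m}"
        then have "r = 0 \<or> m < r" by auto
        then have "compositions m r = {}" using False by (auto simp: compositions_0_right compositions_empty)
        then show "t m r = 0" by (simp add: t_def)
      qed
    qed (use m jN in auto)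
    then show ?thesis using False
      by (simp add: t_def a b prod_dividef mult_ac)
  qed
  then show ?thesis
    unfolding laplace_coeff_def Let_def cs
    by (intro arg_cong2[where f = "(*)"] refl sum.cong) auto
qed

section \<open>The contribution of a neighbourhood of the minimum\<close>

text \<open>The expansion in normal coordinates. After the substitution \<open>y = \<epsilon> z\<close> the exponent is
\<open>|z|\<^sup>2 / 2 + S \<epsilon> z\<close>, and Taylor's formula for \<open>f\<close> (to order \<open>N + 2\<close>, because of the division by
\<open>\<epsilon>\<^sup>2\<close>) and for \<open>g\<close> (to order \<open>N\<close>) provides the expansions of \<open>S\<close> and \<open>g\<close> modulo
\<open>\<epsilon>\<^sup>N\<close>.\<close>

theorem local_laplace_expansion:
  fixes f g :: "real^'d::finite \<Rightarrow> real"
  assumes N: "N \<ge> 1" and V: "open V" "0 \<in> V"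
    and Cf: "C_on (N + 2) V f" and Cg: "C_on N V g"
    and f0: "f 0 = 0" and grad: "\<And>i. partial i f 0 = 0" and hess: "hessian f 0 = mat 1"
    and a: "\<And>\<alpha>. a \<alpha> = mixed_partial \<alpha> f 0 / multi_fact \<alpha>"
    and b: "\<And>\<beta>. b \<beta> = mixed_partial \<beta> g 0 / multi_fact \<beta>"
  shows "\<exists>\<delta>>0. cball 0 \<delta> \<subseteq> V \<and> (\<exists>D. \<forall>\<epsilon>. 0 < \<epsilon> \<longrightarrow> \<epsilon> \<le> 1 \<longrightarrow>
    \<bar>(\<integral>z. indicator (cball 0 \<delta>) (\<epsilon> *\<^sub>R z) * (exp (- f (\<epsilon> *\<^sub>R z) / \<epsilon>\<^sup>2) * g (\<epsilon> *\<^sub>R z)) \<partial>lborel) -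
      (\<Sum>l<N. \<epsilon> ^ l * ((2 * pi) powr (real CARD('d) / 2) * coeff_sum N a b l))\<bar> \<le> D * \<epsilon> ^ N)"
proof -
  obtain r where r: "r > 0" "cball 0 r \<subseteq> V" using V open_contains_cball by blast
  have C3: "C_on 3 V f" using Cf N by (elim C_on_mono) simp
  obtain B3 where B3: "B3 \<ge> 0" "\<And>y. y \<in> cball 0 r \<Longrightarrow> \<bar>f y - (norm y)\<^sup>2 / 2\<bar> \<le> B3 * norm y ^ 3"
    using taylor_at_critical_point[OF V(1) C3 r(2) _ f0 grad] r(1)
    by (auto simp: hess power2_norm_eq_inner)
  obtain Bf where Bf: "Bf \<ge> 0" "\<And>y. y \<in> cball 0 r \<Longrightarrow>
      \<bar>f y - (\<Sum>n<N+2. (dird y ^^ n) f 0 / fact n)\<bar> \<le> Bf * norm y ^ (N + 2)"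
    using multivariate_taylor[OF V(1) Cf _ r(2)] by auto
  obtain Bg where Bg: "Bg \<ge> 0" "\<And>y. y \<in> cball 0 r \<Longrightarrow>
      \<bar>g y - (\<Sum>n<N. (dird y ^^ n) g 0 / fact n)\<bar> \<le> Bg * norm y ^ N"
    using multivariate_taylor[OF V(1) Cg _ r(2)] N by auto
  \<comment> \<open>This \<open>\<delta>\<close> ensures \<open>B3 * \<delta> \<le> 1 / 4\<close>, so that the cubic remainder is at most half of the quadratic term.\<close>
  define \<delta> where "\<delta> = min r (1 / (4 * (B3 + 1)))"
  have \<delta>: "\<delta> > 0" "\<delta> \<le> r" "\<delta> \<le> 1 / (4 * (B3 + 1))" using r B3(1) by (auto simp: \<delta>_def)
  have "B3 * \<delta> \<le> (B3 + 1) * (1 / (4 * (B3 + 1)))"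
    using \<delta> B3(1) by (intro mult_mono) auto
  also have "\<dots> = 1 / 4" using B3(1) by (simp add: field_simps)
  finally have B3\<delta>: "B3 * \<delta> \<le> 1 / 4" .
  have dom: "\<epsilon> *\<^sub>R z \<in> cball 0 r" if "0 < \<epsilon>" "\<epsilon> * norm z \<le> \<delta>" for \<epsilon> and z :: "real^'d"
    using that \<delta>(2) by simp
  define p where "p n z = (\<Sum>\<alpha>\<in>multi_indices (n + 2). a \<alpha> * monom_at z \<alpha>)" for n z
  define q where "q n z = (\<Sum>\<beta>\<in>multi_indices n. b \<beta> * monom_at z \<beta>)" for n z
  have tp: "tame \<delta> (\<lambda>_. p n)" and tq: "tame \<delta> (\<lambda>_. q n)" for n
    unfolding p_def[abs_def] q_def[abs_def] by (intro tame_intros tame_monom_at)+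
  have pd: "(dird (\<epsilon> *\<^sub>R z) ^^ (n + 2)) f 0 / fact (n + 2) = \<epsilon> ^ (n + 2) * p n z" if "n < N" for n \<epsilon> z
  proof -
    have "C_on (n + 2) V f" using Cf that by (elim C_on_mono) simp
    from dird_pow_multi_indices[OF V(1) this V(2)] show ?thesis
      by (simp only: p_def a sum_distrib_left monom_at_scale mult.left_commute cong: sum.cong)
  qed
  have qd: "(dird (\<epsilon> *\<^sub>R z) ^^ n) g 0 / fact n = \<epsilon> ^ n * q n z" if "n < N" for n \<epsilon> z
  proof -
    have "C_on n V g" using Cg that by (elim C_on_mono) simp
    from dird_pow_multi_indices[OF V(1) this V(2)] show ?thesis
      by (simp only: q_def b sum_distrib_left monom_at_scale mult.left_commute cong: sum.cong)
  qed
  have p0: "p 0 z = (norm z)\<^sup>2 / 2" for z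
  proof -
    have "dird z (dird z f) 0 = z \<bullet> (hessian f 0 *v z)"
      by (rule dird_dird_eq_hessian[OF V(1) _ V(2), of N]) (use Cf in \<open>simp del: C_on.simps\<close>)
    moreover have "dird z (dird z f) 0 / 2 = p 0 z" using pd[of 0 1 z] N by (simp add: numeral_2_eq_2)
    ultimately show ?thesis by (simp add: hess power2_norm_eq_inner)
  qed
  define S where "S \<epsilon> z = f (\<epsilon> *\<^sub>R z) / \<epsilon>\<^sup>2 - (norm z)\<^sup>2 / 2" for \<epsilon> z
  define G where "G \<epsilon> z = g (\<epsilon> *\<^sub>R z)" for \<epsilon> z
  have S_cong: "cong_eps N \<delta> S (\<lambda>\<epsilon> z. \<Sum>n\<in>{1..<N}. \<epsilon> ^ n * p n z)"
  proof (rule cong_epsI)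
    define H where "H \<epsilon> z = (f (\<epsilon> *\<^sub>R z) - (\<Sum>n<N+2. (dird (\<epsilon> *\<^sub>R z) ^^ n) f 0 / fact n)) / \<epsilon> ^ (N + 2)" for \<epsilon> z
    show "tame \<delta> H"
    proof (rule tameI)
      fix \<epsilon> and z :: "real^'d" assume d: "0 < \<epsilon>" "\<epsilon> \<le> 1" "\<epsilon> * norm z \<le> \<delta>"
      have "\<bar>H \<epsilon> z\<bar> \<le> Bf * norm (\<epsilon> *\<^sub>R z) ^ (N + 2) / \<epsilon> ^ (N + 2)"
        unfolding H_def abs_divide abs_of_pos[OF zero_less_power[OF d(1)]]
        by (rule divide_right_mono[OF Bf(2)[OF dom[OF d(1,3)]]]) (use d(1) in simp)
      also have "\<dots> = Bf * norm z ^ (N + 2)" using d(1) by (simp add: power_mult_distrib)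
      also have "\<dots> \<le> Bf * (1 + norm z) ^ (N + 2)" using Bf(1) by (intro mult_left_mono power_mono) auto
      finally show "\<bar>H \<epsilon> z\<bar> \<le> Bf * (1 + norm z) ^ (N + 2)" .
    qed (rule Bf)
    fix \<epsilon> and z :: "real^'d" assume d: "0 < \<epsilon>" "\<epsilon> \<le> 1" "\<epsilon> * norm z \<le> \<delta>"
    have "(\<Sum>n<N+2. (dird (\<epsilon> *\<^sub>R z) ^^ n) f 0 / fact n) =
        (\<Sum>n<N. (dird (\<epsilon> *\<^sub>R z) ^^ (n + 2)) f 0 / fact (n + 2))"
    proof -
      have "dird (\<epsilon> *\<^sub>R z) f 0 = 0" by (simp add: dird_def grad)
      have shift: "(\<Sum>n<N+2. t n) = t 0 + t 1 + (\<Sum>n<N. t (n + 2))" for t :: "nat \<Rightarrow> real"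
        by (simp add: sum.lessThan_Suc_shift del: sum.lessThan_Suc)
      show ?thesis unfolding shift using \<open>dird (\<epsilon> *\<^sub>R z) f 0 = 0\<close> f0 by simp
    qed
    also have "\<dots> = (\<Sum>n<N. \<epsilon> ^ (n + 2) * p n z)" by (intro sum.cong refl pd) simp
    also have "\<dots> = \<epsilon>\<^sup>2 * (\<Sum>n<N. \<epsilon> ^ n * p n z)"
      by (simp add: sum_distrib_left power_add mult_ac power2_eq_square)
    also have "(\<Sum>n<N. \<epsilon> ^ n * p n z) = (norm z)\<^sup>2 / 2 + (\<Sum>n\<in>{1..<N}. \<epsilon> ^ n * p n z)"
    proof -
      have "{..<N} = insert 0 {1..<N}" using N by auto
      then show ?thesis by (simp add: p0)
    qed
    finally have "f (\<epsilon> *\<^sub>R z) = \<epsilon>\<^sup>2 * ((norm z)\<^sup>2 / 2 + (\<Sum>n\<in>{1..<N}. \<epsilon> ^ n * p n z)) + \<epsilon> ^ (N + 2) * H \<epsilon> z"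
      using d(1) by (simp add: H_def)
    then have "f (\<epsilon> *\<^sub>R z) / \<epsilon>\<^sup>2 = (norm z)\<^sup>2 / 2 + (\<Sum>n\<in>{1..<N}. \<epsilon> ^ n * p n z) + \<epsilon> ^ N * H \<epsilon> z"
      using d(1) by (simp add: add_divide_distrib power_add power2_eq_square)
    then show "S \<epsilon> z = (\<Sum>n\<in>{1..<N}. \<epsilon> ^ n * p n z) + \<epsilon> ^ N * H \<epsilon> z" by (simp add: S_def)
  qed
  have G_cong: "cong_eps N \<delta> G (\<lambda>\<epsilon> z. \<Sum>n<N. \<epsilon> ^ n * q n z)"
  proof (rule cong_epsI)
    define H where "H \<epsilon> z = (g (\<epsilon> *\<^sub>R z) - (\<Sum>n<N. (dird (\<epsilon> *\<^sub>R z) ^^ n) g 0 / fact n)) / \<epsilon> ^ N" for \<epsilon> z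
    show "tame \<delta> H"
    proof (rule tameI)
      fix \<epsilon> and z :: "real^'d" assume d: "0 < \<epsilon>" "\<epsilon> \<le> 1" "\<epsilon> * norm z \<le> \<delta>"
      have "\<bar>H \<epsilon> z\<bar> \<le> Bg * norm (\<epsilon> *\<^sub>R z) ^ N / \<epsilon> ^ N"
        unfolding H_def abs_divide abs_of_pos[OF zero_less_power[OF d(1)]]
        by (rule divide_right_mono[OF Bg(2)[OF dom[OF d(1,3)]]]) (use d(1) in simp)
      also have "\<dots> = Bg * norm z ^ N" using d(1) by (simp add: power_mult_distrib)
      also have "\<dots> \<le> Bg * (1 + norm z) ^ N" using Bg(1) by (intro mult_left_mono power_mono) auto
      finally show "\<bar>H \<epsilon> z\<bar> \<le> Bg * (1 + norm z) ^ N" .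
    qed (rule Bg)
    fix \<epsilon> and z :: "real^'d" assume d: "0 < \<epsilon>" "\<epsilon> \<le> 1" "\<epsilon> * norm z \<le> \<delta>"
    have "(\<Sum>n<N. (dird (\<epsilon> *\<^sub>R z) ^^ n) g 0 / fact n) = (\<Sum>n<N. \<epsilon> ^ n * q n z)"
      by (intro sum.cong refl qd) simp
    then show "G \<epsilon> z = (\<Sum>n<N. \<epsilon> ^ n * q n z) + \<epsilon> ^ N * H \<epsilon> z"
      using d(1) by (simp add: G_def H_def)
  qed
  have S3: "\<bar>S \<epsilon> z\<bar> \<le> \<epsilon> * (B3 * norm z ^ 3)" if d: "0 < \<epsilon>" "\<epsilon> \<le> 1" "\<epsilon> * norm z \<le> \<delta>" for \<epsilon> z
  proof -
    have "S \<epsilon> z = (f (\<epsilon> *\<^sub>R z) - (norm (\<epsilon> *\<^sub>R z))\<^sup>2 / 2) / \<epsilon>\<^sup>2"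
      using d(1) by (simp add: S_def field_simps power_mult_distrib)
    then have "\<bar>S \<epsilon> z\<bar> = \<bar>f (\<epsilon> *\<^sub>R z) - (norm (\<epsilon> *\<^sub>R z))\<^sup>2 / 2\<bar> / \<epsilon>\<^sup>2" by (simp add: abs_divide)
    also have "\<dots> \<le> B3 * norm (\<epsilon> *\<^sub>R z) ^ 3 / \<epsilon>\<^sup>2"
      using B3(2)[OF dom[OF d(1,3)]] by (rule divide_right_mono) simp
    also have "\<dots> = \<epsilon> * (B3 * norm z ^ 3)"
      using d(1) by (simp add: power_mult_distrib power3_eq_cube power2_eq_square)
    finally show ?thesis .
  qed
  have tW: "tame \<delta> (\<lambda>\<epsilon> z. S \<epsilon> z / \<epsilon>)"
  proof (rule tameI)
    fix \<epsilon> and z :: "real^'d" assume d: "0 < \<epsilon>" "\<epsilon> \<le> 1" "\<epsilon> * norm z \<le> \<delta>"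
    have "\<bar>S \<epsilon> z / \<epsilon>\<bar> \<le> B3 * norm z ^ 3" using S3[OF d] d(1) by (simp add: abs_divide field_simps)
    also have "\<dots> \<le> B3 * (1 + norm z) ^ 3" using B3(1) by (intro mult_left_mono power_mono) auto
    finally show "\<bar>S \<epsilon> z / \<epsilon>\<bar> \<le> B3 * (1 + norm z) ^ 3" .
  qed (rule B3)
  have S4: "\<bar>S \<epsilon> z\<bar> \<le> (norm z)\<^sup>2 / 4" if d: "0 < \<epsilon>" "\<epsilon> \<le> 1" "\<epsilon> * norm z \<le> \<delta>" for \<epsilon> z
  proof -
    have "\<bar>S \<epsilon> z\<bar> \<le> B3 * (\<epsilon> * norm z) * (norm z)\<^sup>2"
      using S3[OF d] by (simp add: power3_eq_cube power2_eq_square mult_ac)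
    also have "\<dots> \<le> B3 * \<delta> * (norm z)\<^sup>2" using d B3(1) by (intro mult_right_mono mult_left_mono) auto
    also have "\<dots> \<le> 1 / 4 * (norm z)\<^sup>2" using B3\<delta> by (intro mult_right_mono) auto
    finally show ?thesis by simp
  qed
  obtain C K where C: "C \<ge> 0" "\<And>\<epsilon> z. 0 < \<epsilon> \<Longrightarrow> \<epsilon> \<le> 1 \<Longrightarrow> \<epsilon> * norm z \<le> \<delta> \<Longrightarrow>
      \<bar>exp (- S \<epsilon> z) * G \<epsilon> z - (\<Sum>l<N. \<epsilon> ^ l * exp_coeff N p q l z)\<bar>
        \<le> \<epsilon> ^ N * (C * (1 + norm z) ^ K * exp ((norm z)\<^sup>2 / 4))"
    using exp_expansion_bound[OF tp tq S_cong G_cong tW _ S4] by auto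
  have cont: "continuous_on {z. \<epsilon> * norm z \<le> \<delta>} (\<lambda>z. h (\<epsilon> *\<^sub>R z))" if "0 < \<epsilon>" "continuous_on V h"
    for \<epsilon> and h :: "real^'d \<Rightarrow> real"
    using that(2) by (rule continuous_on_compose2) (use dom[OF that(1)] r in \<open>auto intro!: continuous_intros\<close>)
  have exp_meas: "exp_coeff N p q l \<in> borel_measurable borel" for l
  proof -
    have [measurable]: "p n \<in> borel_measurable borel" "q n \<in> borel_measurable borel" for n
      unfolding p_def[abs_def] q_def[abs_def] using borel_measurable_monom_at by measurable
    show ?thesis unfolding exp_coeff_def[abs_def] by measurable
  qed
  have exp_tame: "tame \<delta> (\<lambda>_. exp_coeff N p q l)" for l
    unfolding exp_coeff_def[abs_def] by (intro tame_intros tp tq)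
  have F_meas: "(\<lambda>z. indicator {z. \<epsilon> * norm z \<le> \<delta>} z * (exp (- S \<epsilon> z) * G \<epsilon> z)) \<in> borel_measurable borel"
    if "0 < \<epsilon>" "\<epsilon> \<le> 1" for \<epsilon>
  proof -
    have "closed {z :: real^'d. \<epsilon> * norm z \<le> \<delta>}" by (intro closed_Collect_le continuous_intros)
    moreover have "continuous_on {z. \<epsilon> * norm z \<le> \<delta>} (\<lambda>z. exp (- S \<epsilon> z) * G \<epsilon> z)"
      unfolding S_def G_def
      by (intro continuous_intros cont that C_on_imp_continuous[OF Cf] C_on_imp_continuous[OF Cg]) (use that in auto)
    ultimately have "(\<lambda>z. indicator {z. \<epsilon> * norm z \<le> \<delta>} z *\<^sub>R (exp (- S \<epsilon> z) * G \<epsilon> z)) \<in> borel_measurable borel"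
      by (intro borel_measurable_continuous_on_indicator) auto
    then show ?thesis by simp
  qed
  obtain D where D: "\<And>\<epsilon>. 0 < \<epsilon> \<Longrightarrow> \<epsilon> \<le> 1 \<Longrightarrow>
    \<bar>(\<integral>z. exp (- ((norm z)\<^sup>2 / 2)) * (indicator {z. \<epsilon> * norm z \<le> \<delta>} z * (exp (- S \<epsilon> z) * G \<epsilon> z)) \<partial>lborel) -
      (\<Sum>l<N. \<epsilon> ^ l * (\<integral>z. exp (- ((norm z)\<^sup>2 / 2)) * exp_coeff N p q l z \<partial>lborel))\<bar> \<le> D * \<epsilon> ^ N"
    using gaussian_integral_expansion[OF \<delta>(1) C(2) C(1) exp_tame exp_meas F_meas] by blast
  have eq: "exp (- ((norm z)\<^sup>2 / 2)) * (indicator {z. \<epsilon> * norm z \<le> \<delta>} z * (exp (- S \<epsilon> z) * G \<epsilon> z)) =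
      indicator (cball 0 \<delta>) (\<epsilon> *\<^sub>R z) * (exp (- f (\<epsilon> *\<^sub>R z) / \<epsilon>\<^sup>2) * g (\<epsilon> *\<^sub>R z))" if "0 < \<epsilon>" for \<epsilon> z
  proof -
    have "exp (- S \<epsilon> z) * exp (- ((norm z)\<^sup>2 / 2)) = exp (- f (\<epsilon> *\<^sub>R z) / \<epsilon>\<^sup>2)"
      by (simp add: S_def flip: exp_add)
    moreover have "indicator {z. \<epsilon> * norm z \<le> \<delta>} z = (indicator (cball 0 \<delta>) (\<epsilon> *\<^sub>R z) :: real)"
      using that by (simp add: indicator_def)
    ultimately show ?thesis by (simp add: G_def mult.left_commute mult.assoc)
  qed
  have "\<exists>D. \<forall>\<epsilon>. 0 < \<epsilon> \<longrightarrow> \<epsilon> \<le> 1 \<longrightarrow>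
    \<bar>(\<integral>z. indicator (cball 0 \<delta>) (\<epsilon> *\<^sub>R z) * (exp (- f (\<epsilon> *\<^sub>R z) / \<epsilon>\<^sup>2) * g (\<epsilon> *\<^sub>R z)) \<partial>lborel) -
      (\<Sum>l<N. \<epsilon> ^ l * ((2 * pi) powr (real CARD('d) / 2) * coeff_sum N a b l))\<bar> \<le> D * \<epsilon> ^ N"
  proof (intro exI[of _ D] allI impI)
    fix \<epsilon> :: real assume \<epsilon>: "0 < \<epsilon>" "\<epsilon> \<le> 1"
    show "\<bar>(\<integral>z. indicator (cball 0 \<delta>) (\<epsilon> *\<^sub>R z) * (exp (- f (\<epsilon> *\<^sub>R z) / \<epsilon>\<^sup>2) * g (\<epsilon> *\<^sub>R z)) \<partial>lborel) -
      (\<Sum>l<N. \<epsilon> ^ l * ((2 * pi) powr (real CARD('d) / 2) * coeff_sum N a b l))\<bar> \<le> D * \<epsilon> ^ N"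
      using D[OF \<epsilon>] by (simp only: eq[OF \<epsilon>(1)] integral_exp_coeff[of p a q b, OF p_def q_def])
  qed
  moreover have "cball 0 \<delta> \<subseteq> V" using \<delta> r by auto
  ultimately show ?thesis using \<delta>(1) by blast
qed

section \<open>Laplace's asymptotic expansion\<close>

lemma exp_decay_bigo:
  fixes c k0 s :: real
  assumes "c > 0"
  shows "(\<lambda>k. exp (- ((k - k0) * c))) \<in> O(\<lambda>k. k powr s)"
proof -
  \<comment> \<open>For \<open>k \<ge> 2 k0\<close> the exponent is at most \<open>- k c / 2\<close>, and \<open>exp\<close> dominates its \<open>n\<close>-th series term.\<close>
  define n where "n = nat \<lceil>\<bar>s\<bar>\<rceil>"
  have n: "- real n \<le> s" unfolding n_def by linarith
  show ?thesis
  proof (rule bigoI)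
    show "\<forall>\<^sub>F k in at_top. norm (exp (- ((k - k0) * c))) \<le> fact n * (2 / c) ^ n * norm (k powr s)"
      using eventually_ge_at_top[of 1] eventually_ge_at_top[of "2 * k0"]
    proof eventually_elim
      case (elim k)
      have "(k * c / 2) ^ n / fact n \<le> exp (k * c / 2)"
        using elim assms by (intro power_div_fact_le_exp) auto
      moreover have pos: "0 < (k * c / 2) ^ n" using elim assms by simp
      ultimately have "exp (- (k * c / 2)) \<le> fact n / (k * c / 2) ^ n"
        by (simp add: exp_minus field_simps)
      moreover have "exp (- ((k - k0) * c)) \<le> exp (- (k * c / 2))"
      proof -
        have "k / 2 * c \<le> (k - k0) * c" using elim assms by (intro mult_right_mono) auto
        then show ?thesis by simp
      qed
      ultimately have "exp (- ((k - k0) * c)) \<le> fact n / (k * c / 2) ^ n" by linarith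
      also have "\<dots> = fact n * (2 / c) ^ n * k powr (- real n)"
        using elim assms by (simp add: powr_minus powr_realpow power_mult_distrib power_divide field_simps)
      also have "\<dots> \<le> fact n * (2 / c) ^ n * k powr s"
        using elim assms n by (intro mult_left_mono powr_mono) auto
      finally show ?case by simp
    qed
  qed
qed

lemma borel_measurable_indicator_continuous:
  fixes h :: "'a::euclidean_space \<Rightarrow> real"
  assumes "R \<in> sets lebesgue" "continuous_on R h"
  shows "(\<lambda>x. indicator R x * h x) \<in> borel_measurable lebesgue"
proof -
  have "h \<in> borel_measurable (lebesgue_on R)"
    using assms by (rule continuous_imp_measurable_on_sets_lebesgue[rotated])
  then have "(\<lambda>x. if x \<in> R then h x else 0) \<in> borel_measurable lebesgue"
    using borel_measurable_if[OF assms(1)] by blast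
  moreover have "(\<lambda>x. if x \<in> R then h x else 0) = (\<lambda>x. indicator R x * h x)"
    by (auto simp: indicator_def)
  ultimately show ?thesis by simp
qed

text \<open>On \<open>T\<close> the factor \<open>exp (- (k - k0) f)\<close> is at most \<open>exp (- (k - k0) c)\<close>, and the rest of the
integrand is the one for \<open>k0\<close>. With \<open>T = R\<close> and \<open>c = 0\<close> this gives integrability for all \<open>k \<ge> k0\<close>.\<close>

lemma laplace_tail:
  fixes f g :: "'a::euclidean_space \<Rightarrow> real"
  assumes T: "T \<in> sets lebesgue" "T \<subseteq> R" and cont: "continuous_on R f" "continuous_on R g"
    and int: "set_integrable lebesgue R (\<lambda>x. exp (- k0 * f x) * g x)"
    and c: "\<And>x. x \<in> T \<Longrightarrow> c \<le> f x" and k: "k0 \<le> k"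
  shows "set_integrable lebesgue T (\<lambda>x. exp (- k * f x) * g x)"
    and "\<bar>LINT x:T|lebesgue. exp (- k * f x) * g x\<bar> \<le>
      exp (- ((k - k0) * c)) * (LINT x:R|lebesgue. \<bar>exp (- k0 * f x) * g x\<bar>)"
proof -
  define M where "M x = exp (- ((k - k0) * c)) * (indicator R x * \<bar>exp (- k0 * f x) * g x\<bar>)" for x
  have "integrable lebesgue (\<lambda>x. \<bar>indicator R x *\<^sub>R (exp (- k0 * f x) * g x)\<bar>)"
    using int unfolding set_integrable_def by (rule integrable_abs)
  then have "integrable lebesgue (\<lambda>x. exp (- ((k - k0) * c)) * \<bar>indicator R x *\<^sub>R (exp (- k0 * f x) * g x)\<bar>)"
    by (rule integrable_mult_right)
  then have M: "integrable lebesgue M"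
    by (simp add: M_def[abs_def] abs_mult)
  have bound: "\<bar>indicator T x * (exp (- k * f x) * g x)\<bar> \<le> M x" for x
  proof (cases "x \<in> T")
    case True
    have "(k - k0) * c \<le> (k - k0) * f x" using c[OF True] k by (intro mult_left_mono) auto
    then have "exp (- k * f x) \<le> exp (- ((k - k0) * c)) * exp (- k0 * f x)"
      by (simp add: algebra_simps flip: exp_add)
    then have "exp (- k * f x) * \<bar>g x\<bar> \<le> exp (- ((k - k0) * c)) * exp (- k0 * f x) * \<bar>g x\<bar>"
      by (rule mult_right_mono) simp
    then show ?thesis using True T by (auto simp: M_def abs_mult)
  qed (simp add: M_def)
  have meas: "(\<lambda>x. indicator T x * (exp (- k * f x) * g x)) \<in> borel_measurable lebesgue"
    using cont T by (intro borel_measurable_indicator_continuous continuous_intros) (auto elim: continuous_on_subset)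
  have T_int: "integrable lebesgue (\<lambda>x. indicator T x * (exp (- k * f x) * g x))"
  proof (rule Bochner_Integration.integrable_bound[OF M meas])
    show "AE x in lebesgue. norm (indicator T x * (exp (- k * f x) * g x)) \<le> norm (M x)"
      using bound by (intro AE_I2) (metis abs_ge_self order_trans real_norm_def)
  qed
  then show "set_integrable lebesgue T (\<lambda>x. exp (- k * f x) * g x)"
    by (simp add: set_integrable_def)
  have "\<bar>LINT x:T|lebesgue. exp (- k * f x) * g x\<bar> \<le>
      (LINT x|lebesgue. \<bar>indicator T x * (exp (- k * f x) * g x)\<bar>)"
    unfolding set_lebesgue_integral_def
    using integral_norm_bound[of lebesgue "\<lambda>x. indicator T x * (exp (- k * f x) * g x)"] by simp
  also have "\<dots> \<le> integral\<^sup>L lebesgue M"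
    by (rule integral_mono[OF integrable_abs[OF T_int] M bound])
  also have "\<dots> = exp (- ((k - k0) * c)) * (LINT x:R|lebesgue. \<bar>exp (- k0 * f x) * g x\<bar>)"
    by (simp add: M_def[abs_def] set_lebesgue_integral_def)
  finally show "\<bar>LINT x:T|lebesgue. exp (- k * f x) * g x\<bar> \<le>
      exp (- ((k - k0) * c)) * (LINT x:R|lebesgue. \<bar>exp (- k0 * f x) * g x\<bar>)" .
qed

lemma det_scaleR_matrix:
  fixes A :: "real^'d::finite^'d"
  shows "det (c *\<^sub>R A) = c ^ CARD('d) * det A"
  by (simp add: det_def prod.distrib sum_distrib_left mult.left_commute)

text \<open>The substitution \<open>x = A (\<epsilon> z)\<close>.\<close>

lemma set_integral_rescaled:
  fixes A :: "real^'d::finite^'d" and h :: "real^'d \<Rightarrow> real"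
  assumes A: "invertible A" and "\<epsilon> > 0" and K: "compact K" and h: "continuous_on ((*v) A ` K) h"
  shows "(LINT x:(*v) A ` K|lebesgue. h x) =
    \<bar>det A\<bar> * \<epsilon> ^ CARD('d) * (\<integral>z. indicator K (\<epsilon> *\<^sub>R z) * h (A *v (\<epsilon> *\<^sub>R z)) \<partial>lborel)"
proof -
  define W where "W = (*v) A ` K"
  have "compact W"
    unfolding W_def by (intro compact_continuous_image K linear_continuous_on) auto
  then have "(\<lambda>x. indicator W x *\<^sub>R h x) \<in> borel_measurable borel"
    using h by (intro borel_measurable_continuous_on_indicator) (auto simp: W_def compact_imp_closed)
  then have meas: "(\<lambda>x. indicator W x * h x) \<in> borel_measurable borel" by simp
  have "inj ((*v) A)" using A by (metis inj_matrix_vector_mult)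
  then have ind: "indicator W (A *v y) = (indicator K y :: real)" for y
    by (auto simp: W_def indicator_def inj_image_mem_iff)
  have scale: "(\<epsilon> *\<^sub>R A) *v z = A *v (\<epsilon> *\<^sub>R z)" for z
    by (simp add: scaleR_matrix_vector_assoc matrix_vector_mult_scaleR)
  have det: "det (\<epsilon> *\<^sub>R A) = \<epsilon> ^ CARD('d) * det A" by (rule det_scaleR_matrix)
  have A\<epsilon>: "invertible (\<epsilon> *\<^sub>R A)"
    using A \<open>\<epsilon> > 0\<close> by (simp add: invertible_det_nz det)
  have "(LINT x:W|lebesgue. h x) = (\<integral>x. indicator W x * h x \<partial>lborel)"
    unfolding set_lebesgue_integral_def using meas by (simp add: integral_completion)
  also have "\<dots> = \<bar>det (\<epsilon> *\<^sub>R A)\<bar> * (\<integral>z. indicator W ((\<epsilon> *\<^sub>R A) *v z) * h ((\<epsilon> *\<^sub>R A) *v z) \<partial>lborel)"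
    by (rule integral_linear_substitution[OF A\<epsilon> meas])
  finally show ?thesis
    using \<open>\<epsilon> > 0\<close> by (simp add: W_def[symmetric] scale ind det abs_mult mult_ac)
qed

lemma sum_even_indices:
  fixes F :: "nat \<Rightarrow> real"
  assumes "\<And>l. odd l \<Longrightarrow> F l = 0"
  shows "(\<Sum>l<N. F l) = (\<Sum>j\<in>{j\<in>{0..N div 2}. 2 * j < N}. F (2 * j))"
proof -
  have "(\<Sum>l<N. F l) = (\<Sum>l\<in>(\<lambda>j. 2 * j) ` {j\<in>{0..N div 2}. 2 * j < N}. F l)"
  proof (rule sum.mono_neutral_right)
    show "\<forall>l\<in>{..<N} - (\<lambda>j. 2 * j) ` {j\<in>{0..N div 2}. 2 * j < N}. F l = 0"
    proof
      fix l assume l: "l \<in> {..<N} - (\<lambda>j. 2 * j) ` {j\<in>{0..N div 2}. 2 * j < N}"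
      have "odd l"
      proof
        assume "even l"
        then obtain j where "l = 2 * j" by (rule evenE)
        with l show False by auto
      qed
      then show "F l = 0" by (rule assms)
    qed
  qed auto
  also have "\<dots> = (\<Sum>j\<in>{j\<in>{0..N div 2}. 2 * j < N}. F (2 * j))"
    by (subst sum.reindex) (auto simp: inj_on_def)
  finally show ?thesis .
qed

theorem theorem1p1:
  fixes R :: "(real^'d::finite) set"
    and f g :: "real^'d \<Rightarrow> real"
    and N :: nat
    and k0 :: real
  assumes "N \<ge> 1"
    and "R \<in> sets lebesgue"
    and "0 \<in> interior R"
    and "C_restr (N + 2) R f"
    and "C_restr N R g"
    and "f 0 = 0"
    and "unique_minimum_at f R 0"
    and "invertible (hessian f 0)"
    and "k0 > 0"
    and "set_integrable lebesgue R (\<lambda>x. exp (- k0 * f x) * g x)"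
  shows "\<exists>P :: real^'d \<Rightarrow> real^'d.
    linear P \<and> bij P \<and> hessian (f \<circ> inv P) 0 = mat 1 \<and>
    (\<forall>\<^sub>F k in at_top. set_integrable lebesgue R (\<lambda>x. exp (- k * f x) * g x)) \<and>
    (\<lambda>k. (LINT x:R|lebesgue. exp (- k * f x) * g x)
        - k powr (- real CARD('d) / 2) *
          (\<Sum>j=0..N div 2. laplace_coeff f g P j * k powr (- real j)))
      \<in> O(\<lambda>k. k powr (- (real N + real CARD('d)) / 2 + 1))"
proof -
  define V where "V = interior R"
  have V: "open V" "0 \<in> V" "V \<subseteq> R" using assms(3) interior_subset by (auto simp: V_def)
  have restr: "C_on m V h \<and> continuous_on R h" if "C_restr m R h" for m and h :: "real^'d \<Rightarrow> real"
  proof -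
    obtain U F where U: "open U" "R \<subseteq> U" "C_on m U F" "\<forall>x\<in>R. F x = h x"
      using \<open>C_restr m R h\<close> unfolding C_restr_def by blast
    have "C_on m V F" using C_on_subset[OF U(3)] U(2) V(3) by blast
    then have "C_on m V h" by (rule C_on_cong_imp[OF V(1), rotated]) (use U(4) V(3) in auto)
    moreover have "continuous_on R F" using C_on_imp_continuous[OF U(3)] U(2) continuous_on_subset by blast
    then have "continuous_on R h" using U(4) by (simp cong: continuous_on_cong)
    ultimately show ?thesis by blast
  qed
  have Cf: "C_on (N + 2) V f" and cf: "continuous_on R f" using restr[OF assms(4)] by auto
  have Cg: "C_on N V g" and cg: "continuous_on R g" using restr[OF assms(5)] by auto
  have nonneg: "0 \<le> f x" if "x \<in> R" for x
    using assms(6,7) that unfolding unique_minimum_at_def by (cases "x = 0") auto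
  have C3: "C_on 3 V f" using Cf assms(1) by (elim C_on_mono) simp
  obtain A :: "real^'d^'d" where A: "invertible A" "0 < det (hessian f 0)"
    "\<bar>det A\<bar> = 1 / sqrt (det (hessian f 0))" "hessian (f \<circ> (*v) A) 0 = mat 1"
    using normal_coordinates[OF V(1,2) C3 assms(6) _ assms(8)] nonneg V(3) by blast
  obtain B where AB: "A ** B = mat 1" and BA: "B ** A = mat 1"
    using A(1) unfolding invertible_def by blast
  have inverse: "A *v (B *v x) = x" "B *v (A *v x) = x" for x
    by (simp_all add: matrix_vector_mul_assoc AB BA)
  define P where "P = (*v) B"
  have invP: "inv P = (*v) A" unfolding P_def by (rule inv_equality) (simp_all add: inverse)
  have linP: "linear P" by (simp add: P_def)
  have bijP: "bij P" unfolding P_def by (rule o_bij[of "(*v) A"]) (simp_all add: fun_eq_iff inverse)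
  define fy gy where "fy = f \<circ> (*v) A" and "gy = g \<circ> (*v) A"
  define V' where "V' = (*v) A -` V"
  have V': "open V'" "0 \<in> V'"
    using V by (auto simp: V'_def intro!: open_vimage linear_continuous_on)
  have Cfy: "C_on (N + 2) V' fy" and Cgy: "C_on N V' gy"
    unfolding fy_def gy_def V'_def by (intro C_on_compose_linear V(1) Cf Cg; simp)+
  have fy0: "fy 0 = 0" by (simp add: fy_def assms(6))
  have grad: "partial i fy 0 = 0" for i
  proof (rule partial_zero_at_minimum[OF V'])
    show "C_on (Suc (Suc N)) V' fy" using Cfy by (simp del: C_on.simps)
    show "fy 0 \<le> fy y" if "y \<in> V'" for y
      using nonneg V(3) that by (auto simp: fy0) (auto simp: fy_def V'_def)
  qed
  define a where "a \<alpha> = mixed_partial \<alpha> fy 0 / multi_fact \<alpha>" for \<alpha>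
  define b where "b \<beta> = mixed_partial \<beta> gy 0 / multi_fact \<beta>" for \<beta>
  define w where "w = (2 * pi) powr (real CARD('d) / 2)"
  obtain \<delta> D where \<delta>: "\<delta> > 0" "cball 0 \<delta> \<subseteq> V'" and D: "\<And>\<epsilon>. 0 < \<epsilon> \<Longrightarrow> \<epsilon> \<le> 1 \<Longrightarrow>
    \<bar>(\<integral>z. indicator (cball 0 \<delta>) (\<epsilon> *\<^sub>R z) * (exp (- fy (\<epsilon> *\<^sub>R z) / \<epsilon>\<^sup>2) * gy (\<epsilon> *\<^sub>R z)) \<partial>lborel) -
      (\<Sum>l<N. \<epsilon> ^ l * (w * coeff_sum N a b l))\<bar> \<le> D * \<epsilon> ^ N"
    using local_laplace_expansion[OF assms(1) V' Cfy Cgy fy0 grad A(4)[folded fy_def] a_def b_def]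
    unfolding w_def by blast
  define W where "W = (*v) A ` cball 0 \<delta>"
  have WR: "W \<subseteq> R" using \<delta>(2) V(3) by (auto simp: W_def V'_def)
  have "compact W" unfolding W_def by (intro compact_continuous_image linear_continuous_on) auto
  then have Wm: "W \<in> sets lebesgue" by (simp add: compact_imp_closed)
  have "open ((*v) B -` ball 0 \<delta>)" by (intro open_vimage linear_continuous_on) auto
  moreover have "0 \<in> (*v) B -` ball 0 \<delta>" using \<delta>(1) by simp
  ultimately obtain \<eta> where \<eta>: "\<eta> > 0" "ball 0 \<eta> \<subseteq> (*v) B -` ball 0 \<delta>" using openE by blast
  have \<eta>W: "ball 0 \<eta> \<subseteq> W"
  proof
    fix x :: "real^'d" assume "x \<in> ball 0 \<eta>"
    then have "B *v x \<in> cball 0 \<delta>" using \<eta>(2) by force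
    then have "A *v (B *v x) \<in> W" unfolding W_def by (rule imageI)
    then show "x \<in> W" by (simp add: inverse)
  qed
  obtain c where c: "c > 0" "\<And>x. x \<in> R \<Longrightarrow> \<eta> \<le> dist x 0 \<Longrightarrow> c \<le> f x"
    using assms(6,7) \<eta>(1) unfolding unique_minimum_at_def by metis
  have far: "c \<le> f x" if "x \<in> R - W" for x
  proof -
    have "x \<notin> ball 0 \<eta>" using that \<eta>W by blast
    then show ?thesis using c(2)[of x] that by simp
  qed
  have int: "set_integrable lebesgue R (\<lambda>x. exp (- k * f x) * g x)" if "k0 \<le> k" for k
    by (rule laplace_tail(1)[OF assms(2) _ cf cg assms(10) nonneg that]) auto
  \<comment> \<open>The scale \<open>\<epsilon> = 1 / sqrt k\<close> of the Gaussian peak.\<close>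
  define ep where "ep k = k powr (- 1 / 2)" for k :: real
  have ep: "0 < ep k" "ep k \<le> 1" "(ep k)\<^sup>2 = 1 / k" and ep_power: "ep k ^ n = k powr (- real n / 2)"
    if "k \<ge> 1" for k n
  proof -
    show "0 < ep k" using that by (simp add: ep_def)
    show "ep k \<le> 1" unfolding ep_def using that powr_mono[of "- 1 / 2" 0 k] by simp
    have "ep k ^ n = k powr (real n * (- 1 / 2))" for n
      unfolding ep_def by (rule powr_power) (use that in simp)
    then have *: "ep k ^ n = k powr (- real n / 2)" for n by simp
    show "ep k ^ n = k powr (- real n / 2)" by (rule *)
    have "(ep k)\<^sup>2 = k powr (- 1)" using *[of 2] by simp
    then show "(ep k)\<^sup>2 = 1 / k" using that by (simp add: powr_minus divide_inverse)
  qed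
  define J where "J = {j\<in>{0..N div 2}. 2 * j < N}"
  define J' where "J' = {j\<in>{0..N div 2}. \<not> 2 * j < N}"
  \<comment> \<open>The integral splits at \<open>W\<close>; the index sets \<open>J\<close> and \<open>J'\<close> separate the terms that are matched from the one that the error term absorbs.\<close>
  define near where "near k = (LINT x:W|lebesgue. exp (- k * f x) * g x)" for k
  define tail where "tail k = (LINT x:(R - W)|lebesgue. exp (- k * f x) * g x)" for k
  define s where "s = - (real N + real CARD('d)) / 2 + 1"
  have near_bound: "\<bar>near k - k powr (- real CARD('d) / 2) * (\<Sum>j\<in>J. laplace_coeff f g P j * k powr (- real j))\<bar>
      \<le> \<bar>det A\<bar> * \<bar>D\<bar> * k powr s" if k: "k \<ge> 1" for k
  proof -
    have cont: "continuous_on W (\<lambda>x. exp (- k * f x) * g x)"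
      using cf cg WR by (intro continuous_intros) (auto elim: continuous_on_subset)
    define I where "I = (\<integral>z. indicator (cball 0 \<delta>) (ep k *\<^sub>R z) *
      (exp (- fy (ep k *\<^sub>R z) / (ep k)\<^sup>2) * gy (ep k *\<^sub>R z)) \<partial>lborel)"
    define \<Sigma> where "\<Sigma> = (\<Sum>l<N. ep k ^ l * (w * coeff_sum N a b l))"
    have "near k = \<bar>det A\<bar> * ep k ^ CARD('d) * I"
    proof -
      have eq: "- fy y / (ep k)\<^sup>2 = - k * f (A *v y)" for y
        using k ep(3)[OF k] by (simp add: fy_def)
      show ?thesis
        unfolding near_def I_def eq W_def
        using set_integral_rescaled[OF A(1) ep(1)[OF k] compact_cball cont[unfolded W_def]]
        by (simp add: gy_def)
    qed
    moreover have "k powr (- real CARD('d) / 2) * (\<Sum>j\<in>J. laplace_coeff f g P j * k powr (- real j)) =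
        \<bar>det A\<bar> * ep k ^ CARD('d) * \<Sigma>"
    proof -
      have "\<Sigma> = (\<Sum>j\<in>J. ep k ^ (2 * j) * (w * coeff_sum N a b (2 * j)))"
        unfolding \<Sigma>_def J_def by (rule sum_even_indices) (simp add: coeff_sum_odd)
      also have "\<bar>det A\<bar> * \<dots> = (\<Sum>j\<in>J. laplace_coeff f g P j * k powr (- real j))"
        unfolding sum_distrib_left
      proof (rule sum.cong)
        fix j assume "j \<in> J"
        then have "laplace_coeff f g P j = w / sqrt (det (hessian f 0)) * coeff_sum N a b (2 * j)"
          unfolding w_def by (intro laplace_coeff_eq_coeff_sum)
            (auto simp: J_def a_def b_def invP fy_def gy_def)
        then show "\<bar>det A\<bar> * (ep k ^ (2 * j) * (w * coeff_sum N a b (2 * j))) =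
            laplace_coeff f g P j * k powr (- real j)"
          using k by (simp add: ep_power A(3))
      qed simp
      finally show ?thesis using k by (simp add: ep_power mult_ac)
    qed
    ultimately have "near k - k powr (- real CARD('d) / 2) * (\<Sum>j\<in>J. laplace_coeff f g P j * k powr (- real j)) =
        \<bar>det A\<bar> * ep k ^ CARD('d) * (I - \<Sigma>)"
      by (simp add: right_diff_distrib)
    also have "\<bar>\<dots>\<bar> = \<bar>det A\<bar> * ep k ^ CARD('d) * \<bar>I - \<Sigma>\<bar>"
      using ep(1)[OF k] by (simp add: abs_mult power_abs)
    also have "\<dots> \<le> \<bar>det A\<bar> * ep k ^ CARD('d) * (\<bar>D\<bar> * ep k ^ N)"
    proof (rule mult_left_mono)
      have "\<bar>I - \<Sigma>\<bar> \<le> D * ep k ^ N" unfolding I_def \<Sigma>_def by (rule D[OF ep(1,2)[OF k]])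
      also have "\<dots> \<le> \<bar>D\<bar> * ep k ^ N" using ep(1)[OF k] by (intro mult_right_mono) auto
      finally show "\<bar>I - \<Sigma>\<bar> \<le> \<bar>D\<bar> * ep k ^ N" .
    qed (use ep(1)[OF k] in simp)
    also have "\<dots> = \<bar>det A\<bar> * \<bar>D\<bar> * ep k ^ (N + CARD('d))" by (simp add: power_add)
    also have "\<dots> \<le> \<bar>det A\<bar> * \<bar>D\<bar> * k powr s"
      unfolding ep_power[OF k] s_def using k by (intro mult_left_mono powr_mono) auto
    finally show ?thesis .
  qed
  have near_O: "(\<lambda>k. near k - k powr (- real CARD('d) / 2) * (\<Sum>j\<in>J. laplace_coeff f g P j * k powr (- real j)))
      \<in> O(\<lambda>k. k powr s)"
    by (rule bigoI[where c = "\<bar>det A\<bar> * \<bar>D\<bar>"])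
      (use near_bound in \<open>auto intro: eventually_mono[OF eventually_ge_at_top[of 1]]\<close>)
  have tail_O: "tail \<in> O(\<lambda>k. k powr s)"
  proof (rule landau_o.big_trans)
    show "tail \<in> O(\<lambda>k. exp (- ((k - k0) * c)))"
    proof (rule bigoI)
      show "\<forall>\<^sub>F k in at_top. norm (tail k) \<le> (LINT x:R|lebesgue. \<bar>exp (- k0 * f x) * g x\<bar>) * norm (exp (- ((k - k0) * c)))"
        using eventually_ge_at_top[of k0]
      proof eventually_elim
        case (elim k)
        have "\<bar>tail k\<bar> \<le> exp (- ((k - k0) * c)) * (LINT x:R|lebesgue. \<bar>exp (- k0 * f x) * g x\<bar>)"
          unfolding tail_def
          by (rule laplace_tail(2)[OF _ _ cf cg assms(10) far elim]) (use assms(2) Wm in auto)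
        then show ?case by (simp add: mult.commute)
      qed
    qed
  qed (rule exp_decay_bigo[OF c(1)])
  have rest_O: "(\<lambda>k. \<Sum>j\<in>J'. laplace_coeff f g P j * (k powr (- real CARD('d) / 2) * k powr (- real j)))
      \<in> O(\<lambda>k. k powr s)"
  proof (rule big_sum_in_bigo)
    fix j assume j: "j \<in> J'"
    show "(\<lambda>k. laplace_coeff f g P j * (k powr (- real CARD('d) / 2) * k powr (- real j))) \<in> O(\<lambda>k. k powr s)"
    proof (rule bigoI[where c = "\<bar>laplace_coeff f g P j\<bar>"], rule eventually_mono[OF eventually_ge_at_top[of 1]])
      fix k :: real assume k: "1 \<le> k"
      have "k powr (- real CARD('d) / 2) * k powr (- real j) = k powr (- real CARD('d) / 2 - real j)"
        using k by (simp flip: powr_add)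
      also have "\<dots> \<le> k powr s"
      proof (rule powr_mono[OF _ k])
        have "real N \<le> 2 * real j" using j by (simp add: J'_def flip: of_nat_mult)
        then show "- real CARD('d) / 2 - real j \<le> s" by (simp add: s_def field_simps)
      qed
      finally show "norm (laplace_coeff f g P j * (k powr (- real CARD('d) / 2) * k powr (- real j)))
          \<le> \<bar>laplace_coeff f g P j\<bar> * norm (k powr s)"
        by (simp add: abs_mult mult_left_mono)
    qed
  qed
  have "(\<lambda>k. (near k - k powr (- real CARD('d) / 2) * (\<Sum>j\<in>J. laplace_coeff f g P j * k powr (- real j)) + tail k)
      - (\<Sum>j\<in>J'. laplace_coeff f g P j * (k powr (- real CARD('d) / 2) * k powr (- real j)))) \<in> O(\<lambda>k. k powr s)"
    by (rule sum_in_bigo(2)[OF sum_in_bigo(1)[OF near_O tail_O] rest_O])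
  moreover have "\<forall>\<^sub>F k in at_top.
      (near k - k powr (- real CARD('d) / 2) * (\<Sum>j\<in>J. laplace_coeff f g P j * k powr (- real j)) + tail k)
      - (\<Sum>j\<in>J'. laplace_coeff f g P j * (k powr (- real CARD('d) / 2) * k powr (- real j))) =
      (LINT x:R|lebesgue. exp (- k * f x) * g x)
        - k powr (- real CARD('d) / 2) * (\<Sum>j=0..N div 2. laplace_coeff f g P j * k powr (- real j))"
    using eventually_ge_at_top[of k0]
  proof eventually_elim
    case (elim k)
    have "set_integrable lebesgue W (\<lambda>x. exp (- k * f x) * g x)"
      "set_integrable lebesgue (R - W) (\<lambda>x. exp (- k * f x) * g x)"
      using set_integrable_subset[OF int[OF elim]] Wm WR assms(2) by auto
    then have "(LINT x:W \<union> (R - W)|lebesgue. exp (- k * f x) * g x) = near k + tail k"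
      unfolding near_def tail_def by (intro set_integral_Un) auto
    moreover have "W \<union> (R - W) = R" using WR by auto
    moreover have "(\<Sum>j=0..N div 2. laplace_coeff f g P j * k powr (- real j)) =
        (\<Sum>j\<in>J. laplace_coeff f g P j * k powr (- real j)) + (\<Sum>j\<in>J'. laplace_coeff f g P j * k powr (- real j))"
      unfolding J_def J'_def by (subst sum.union_disjoint[symmetric]) (auto intro: sum.cong)
    ultimately show ?case
      by (simp add: distrib_left sum_distrib_left mult.left_commute)
  qed
  ultimately have "(\<lambda>k. (LINT x:R|lebesgue. exp (- k * f x) * g x)
        - k powr (- real CARD('d) / 2) * (\<Sum>j=0..N div 2. laplace_coeff f g P j * k powr (- real j)))
      \<in> O(\<lambda>k. k powr s)"
    by (rule landau_o.big.in_cong[THEN iffD1, rotated])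
  moreover have "\<forall>\<^sub>F k in at_top. set_integrable lebesgue R (\<lambda>x. exp (- k * f x) * g x)"
    using eventually_ge_at_top[of k0] by (rule eventually_mono) (rule int)
  ultimately show ?thesis
    using linP bijP A(4) unfolding s_def by (intro exI[of _ P]) (simp add: invP)
qed

end
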